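(* Let $\Omega,\Omega',S$ be non-empty sets, $(\mathscr A,m)\in\mathscr M(\Omega)$, $X:\Omega\to S$, $X':\Omega'\to S$, and let $\mathscr H$ be a Stonean vector sublattice of the space of all functions $S\to\mathbb R$. Let $\mathscr N$ be an ideal of subsets of $\Omega'$. Below, $h$ ranges over the elements of $\mathscr H$ with $h(X)\in L^1(m)$. The condition $$\int h(X)\,dm<0\ \text{ implies }\ \sup_{N\in\mathscr N}\inf_{\omega'\in N^c}h\big(X'(\omega')\big)<0\qquad\text{for all such }h$$ is equivalent to the existence of a minimal $(\mathscr R,\mu)\in\mathscr M(\Omega')$ which satisfies $\mathscr N\subset\mathscr R$ and $$\mu(N)=0\ \ (N\in\mathscr N),\qquad h(X')\in L^1(\mu)\ \text{ and }\ \int h(X)\,dm=\int h(X')\,d\mu\quad\text{for all such }h.$$ Moreover: (a) $\mu$ is a probability if and only if $$\int h(X)\,dm\ge\sup_{N\in\mathscr N}\inf_{\omega'\in N^c}h\big(X'(\omega')\big)\qquad\text{for all such }h;$$ (b) if $\mathscr A$ is a $\sigma$-ring, $m$ is countably additive and $\mathscr N$ is a $\sigma$-ideal, then $\mu$ is countably additive provided $m_*\big(X\notin X'[N^c]\big)=0$ for all $N\in\mathscr N$.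
   Context: A family $\mathscr H$ of real functions is Stonean if $h\in\mathscr H$ implies $h\wedge1\in\mathscr H$. An ideal ($\sigma$-ideal) of subsets of $\Omega'$ is a non-empty family closed under taking subsets and finite (countable) unions. Complements $N^c$ are in $\Omega'$, $X'[N^c]$ is the image of $N^c$ under $X'$, and $\inf\varnothing=\infty$. Finitely additive integration. A measure structure on $\Omega$ is a pair $(\mathscr A,\lambda)$ with $\mathscr A$ a ring of subsets of $\Omega$ and $\lambda:\mathscr A\to[0,\infty)$ finitely additive; $\mathscr M(\Omega)$ is the collection of all of them. $\mathscr S(\mathscr A)$ is the linear span of the indicators of members of $\mathscr A$, with the obvious integral. For $E\subset\Omega$, $\lambda^*(E)=\inf\{\lambda(A):A\in\mathscr A, E\subset A\}$ and $\lambda_*(E)=\sup\{\lambda(B):B\in\mathscr A,B\subset E\}$. $X_n$ $\lambda$-converges to $X$ if $\lim_n\lambda^*(|X_n-X|>c)=0$ for every $c>0$. $X\in L^1(\lambda)$ if there is a sequence $X_n\in\mathscr S(\mathscr A)$ that $\lambda$-converges to $X$ and is Cauchy in the sense $\int|X_n-X_k|\,d\lambda\to0$ as $n,k\to\infty$; then $\int X\,d\lambda=\lim_n\int X_n\,d\lambda$. $\lambda$ is a probability if $\sup_{A\in\mathscr A}\lambda(A)=1$; it is countably additive if $\lambda(\bigcup_nA_n)=\sum_n\lambda(A_n)$ for disjoint $A_n\in\mathscr A$ with $\bigcup_nA_n\in\mathscr A$. Order: $\mathscr A(\lambda)=\{E\subset\Omega:\lambda^*(E)=\lambda_*(E)<\infty\}$,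 to which $\lambda$ extends uniquely (extension again denoted $\lambda$). Write $(\mathscr A,\lambda)\preceq(\mathscr B,\xi)$ if $\mathscr A\subset\mathscr B(\xi)$ and $\xi|_{\mathscr A}=\lambda$. A structure with a given property is minimal if it is $\preceq$ every structure with that property.
   Formalization: In (a), the "if" direction fails in general (e.g. H={0}); the equivalence is proved when Ω' ∈ R. In general: if μ is a probability the inequality holds, and the inequality holds iff μ extends to a probability satisfying all the conditions. *)

theory Defs
  imports "HOL-Analysis.Analysis"
begin

text \<open>
  The non-empty sets of the theory are the universes of type variables. A pair consisting of a
  ring \<open>\<A>\<close> and a set function on it is passed as two arguments; the values of the (total) set
  function outside \<open>\<A>\<close> are never used.
\<close>

definition measure_structure :: "'a set set \<Rightarrow> ('a set \<Rightarrow> real) \<Rightarrow> bool" where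
  "measure_structure \<A> l \<longleftrightarrow>
     ring_of_sets UNIV \<A> \<and> (\<forall>A\<in>\<A>. 0 \<le> l A) \<and> additive \<A> l"

text \<open>The infimum is \<open>\<infinity>\<close> for sets that are not covered by any member of \<open>\<A>\<close>.\<close>

definition outer_content :: "'a set set \<Rightarrow> ('a set \<Rightarrow> real) \<Rightarrow> 'a set \<Rightarrow> ennreal" where
  "outer_content \<A> l E = (INF A\<in>{A\<in>\<A>. E \<subseteq> A}. ennreal (l A))"

definition inner_content :: "'a set set \<Rightarrow> ('a set \<Rightarrow> real) \<Rightarrow> 'a set \<Rightarrow> ennreal" where
  "inner_content \<A> l E = (SUP B\<in>{B\<in>\<A>. B \<subseteq> E}. ennreal (l B))"

definition simple_functions :: "'a set set \<Rightarrow> ('a \<Rightarrow> real) set" where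
  "simple_functions \<A> =
     {f. \<exists>F c. finite F \<and> F \<subseteq> \<A> \<and> f = (\<lambda>x. \<Sum>A\<in>F. c A * indicator A x)}"

text \<open>
  For \<open>f \<in> simple_functions \<A>\<close> the set \<open>f -` {y}\<close> belongs to the ring \<open>\<A>\<close> if \<open>y \<noteq> 0\<close>; the term for
  \<open>y = 0\<close> vanishes whatever \<open>l (f -` {0})\<close> is.
\<close>

definition simple_integral :: "('a set \<Rightarrow> real) \<Rightarrow> ('a \<Rightarrow> real) \<Rightarrow> real" where
  "simple_integral l f = (\<Sum>y\<in>range f. y * l (f -` {y}))"

definition converges_in_content ::
    "'a set set \<Rightarrow> ('a set \<Rightarrow> real) \<Rightarrow> (nat \<Rightarrow> 'a \<Rightarrow> real) \<Rightarrow> ('a \<Rightarrow> real) \<Rightarrow> bool" where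
  "converges_in_content \<A> l F f \<longleftrightarrow>
     (\<forall>c>0. (\<lambda>n. outer_content \<A> l {x. \<bar>F n x - f x\<bar> > c}) \<longlonglongrightarrow> 0)"

definition defining_sequence ::
    "'a set set \<Rightarrow> ('a set \<Rightarrow> real) \<Rightarrow> (nat \<Rightarrow> 'a \<Rightarrow> real) \<Rightarrow> ('a \<Rightarrow> real) \<Rightarrow> bool" where
  "defining_sequence \<A> l F f \<longleftrightarrow>
     range F \<subseteq> simple_functions \<A> \<and> converges_in_content \<A> l F f \<and>
     ((\<lambda>(n, k). simple_integral l (\<lambda>x. \<bar>F n x - F k x\<bar>)) \<longlongrightarrow> 0) (sequentially \<times>\<^sub>F sequentially)"

definition L1 :: "'a set set \<Rightarrow> ('a set \<Rightarrow> real) \<Rightarrow> ('a \<Rightarrow> real) set" where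
  "L1 \<A> l = {f. \<exists>F. defining_sequence \<A> l F f}"

definition content_integral :: "'a set set \<Rightarrow> ('a set \<Rightarrow> real) \<Rightarrow> ('a \<Rightarrow> real) \<Rightarrow> real" where
  "content_integral \<A> l f =
     (THE I. \<exists>F. defining_sequence \<A> l F f \<and> (\<lambda>n. simple_integral l (F n)) \<longlonglongrightarrow> I)"

definition completion_sets :: "'a set set \<Rightarrow> ('a set \<Rightarrow> real) \<Rightarrow> 'a set set" where
  "completion_sets \<A> l =
     {E. outer_content \<A> l E = inner_content \<A> l E \<and> outer_content \<A> l E < \<infinity>}"

text \<open>
  On \<open>completion_sets \<A> l\<close> the common value of outer and inner content is the unique
  extension of \<open>l\<close>.
\<close>

definition extended_content :: "'a set set \<Rightarrow> ('a set \<Rightarrow> real) \<Rightarrow> 'a set \<Rightarrow> real" where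
  "extended_content \<A> l E = enn2real (outer_content \<A> l E)"

definition structure_le ::
    "'a set set \<Rightarrow> ('a set \<Rightarrow> real) \<Rightarrow> 'a set set \<Rightarrow> ('a set \<Rightarrow> real) \<Rightarrow> bool" where
  "structure_le \<A> l \<B> k \<longleftrightarrow>
     \<A> \<subseteq> completion_sets \<B> k \<and> (\<forall>A\<in>\<A>. extended_content \<B> k A = l A)"

definition minimal_structure ::
    "('a set set \<Rightarrow> ('a set \<Rightarrow> real) \<Rightarrow> bool) \<Rightarrow> 'a set set \<Rightarrow> ('a set \<Rightarrow> real) \<Rightarrow> bool" where
  "minimal_structure P \<A> l \<longleftrightarrow>
     measure_structure \<A> l \<and> P \<A> l \<and>
     (\<forall>\<B> k. measure_structure \<B> k \<longrightarrow> P \<B> k \<longrightarrow> structure_le \<A> l \<B> k)"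

text \<open>
  The whole space need not be a member of \<open>\<A>\<close>, nor be covered by one.
\<close>

definition probability :: "'a set set \<Rightarrow> ('a set \<Rightarrow> real) \<Rightarrow> bool" where
  "probability \<A> l \<longleftrightarrow> (SUP A\<in>\<A>. ennreal (l A)) = 1"

definition countably_additive_content :: "'a set set \<Rightarrow> ('a set \<Rightarrow> real) \<Rightarrow> bool" where
  "countably_additive_content \<A> l \<longleftrightarrow> countably_additive \<A> (\<lambda>A. ennreal (l A))"

definition sigma_ring :: "'a set set \<Rightarrow> bool" where
  "sigma_ring \<A> \<longleftrightarrow>
     ring_of_sets UNIV \<A> \<and> (\<forall>A::nat \<Rightarrow> 'a set. range A \<subseteq> \<A> \<longrightarrow> (\<Union>n. A n) \<in> \<A>)"

definition set_ideal :: "'a set set \<Rightarrow> bool" where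
  "set_ideal \<N> \<longleftrightarrow>
     \<N> \<noteq> {} \<and> (\<forall>N\<in>\<N>. \<forall>M. M \<subseteq> N \<longrightarrow> M \<in> \<N>) \<and> (\<forall>M\<in>\<N>. \<forall>N\<in>\<N>. M \<union> N \<in> \<N>)"

definition set_sigma_ideal :: "'a set set \<Rightarrow> bool" where
  "set_sigma_ideal \<N> \<longleftrightarrow>
     \<N> \<noteq> {} \<and> (\<forall>N\<in>\<N>. \<forall>M. M \<subseteq> N \<longrightarrow> M \<in> \<N>) \<and>
     (\<forall>N::nat \<Rightarrow> 'a set. range N \<subseteq> \<N> \<longrightarrow> (\<Union>n. N n) \<in> \<N>)"

definition vector_sublattice :: "('s \<Rightarrow> real) set \<Rightarrow> bool" where
  "vector_sublattice H \<longleftrightarrow>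
     (\<lambda>s. 0) \<in> H \<and>
     (\<forall>f\<in>H. \<forall>g\<in>H. (\<lambda>s. f s + g s) \<in> H) \<and>
     (\<forall>f\<in>H. \<forall>a. (\<lambda>s. a * f s) \<in> H) \<and>
     (\<forall>f\<in>H. \<forall>g\<in>H. (\<lambda>s. max (f s) (g s)) \<in> H) \<and>
     (\<forall>f\<in>H. \<forall>g\<in>H. (\<lambda>s. min (f s) (g s)) \<in> H)"

definition stonean :: "('s \<Rightarrow> real) set \<Rightarrow> bool" where
  "stonean H \<longleftrightarrow> (\<forall>h\<in>H. (\<lambda>s. min (h s) 1) \<in> H)"

text \<open>
  The infimum over an empty complement is \<open>\<infinity>\<close>, and functions that are unbounded below on the
  complement contribute \<open>-\<infinity>\<close>.
\<close>

definition sup_inf_modulo :: "'b set set \<Rightarrow> ('b \<Rightarrow> real) \<Rightarrow> ereal" where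
  "sup_inf_modulo \<N> f = (SUP N\<in>\<N>. INF w\<in>- N. ereal (f w))"

definition represents ::
    "'a set set \<Rightarrow> ('a set \<Rightarrow> real) \<Rightarrow> ('a \<Rightarrow> 's) \<Rightarrow> ('b \<Rightarrow> 's) \<Rightarrow> ('s \<Rightarrow> real) set \<Rightarrow> 'b set set \<Rightarrow>
     'b set set \<Rightarrow> ('b set \<Rightarrow> real) \<Rightarrow> bool" where
  "represents \<A> m X X' H \<N> \<R> \<mu> \<longleftrightarrow>
     \<N> \<subseteq> \<R> \<and> (\<forall>N\<in>\<N>. \<mu> N = 0) \<and>
     (\<forall>h\<in>H. h \<circ> X \<in> L1 \<A> m \<longrightarrow>
        h \<circ> X' \<in> L1 \<R> \<mu> \<and> content_integral \<A> m (h \<circ> X) = content_integral \<R> \<mu> (h \<circ> X'))"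

end

theory Submission
  imports Defs
begin

text \<open>
  On the Stonean lattice \<open>L\<close> of all \<open>h \<in> H\<close> with \<open>h \<circ> X\<close> integrable, the functional
  \<open>I h = \<integral> h \<circ> X dm\<close> is positive with respect to the order
  "\<open>h \<circ> X' \<ge> 0\<close> off some \<open>N \<in> \<N>\<close>"; this is what the condition says.
  It therefore descends to the functions \<open>h \<circ> X'\<close> modulo \<open>\<N>\<close> and extends to the space \<open>V\<close> of all
  functions that are approximated by them in the sense of the Riemann-Daniell completion. The sets
  whose indicators lie in \<open>V\<close> form a ring \<open>\<R>\<close>, and \<open>\<mu> E = J (indicator E)\<close> represents \<open>J\<close>:
  for \<open>g \<ge> 0\<close> in \<open>V\<close> all but countably many superlevel sets of \<open>g\<close> lie in \<open>\<R>\<close>, and \<open>g\<close> is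
  approximated by staircases over a mesh avoiding the bad levels. Any other representing structure
  integrates the functions between which the indicator of a member of \<open>\<R>\<close> is squeezed, which gives
  minimality.

  For (a), the inequality says that \<open>\<mu>\<close> is bounded by 1, and a total mass 1 may then be assigned to
  the whole space. For (b), a decreasing sequence in \<open>\<R>\<close> with empty intersection and \<open>\<mu>\<close> bounded
  away from 0 yields a decreasing sequence \<open>h\<^sub>n \<circ> X\<close> with integrals bounded away from 0, hence a set
  of positive \<open>m\<close>-measure on which all \<open>h\<^sub>n \<circ> X\<close> are positive. There \<open>X\<close> avoids \<open>X' ` (- N)\<close> for
  some \<open>N \<in> \<N>\<close>.
\<close>

section \<open>Integrals of simple functions and uniqueness of the finitely additive integral\<close>

text \<open>The obstacle throughout is that the ring need not contain the whole space and constants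
  need not be integrable, so a small uniform bound says nothing about an integral. Every estimate
  therefore has two halves: a height bound \<open>M\<close> and a support of finite content. For an
  abstract functional these halves become two truncation laws, \<open>J_truncate_above\<close> and
  \<open>J_truncate_below\<close>. They hold in \<open>L1\<close>, pass to \<open>I\<close> because
  they only mention compositions with \<open>X\<close>, pass on to \<open>J\<close> by
  approximation, and are what makes the staircases converge. A second obstacle is that
  \<open>X'\<close> need not be onto: functions on \<open>'b\<close> and on \<open>'s\<close> can be
  compared only at points \<open>X' w\<close> with \<open>w\<close> outside some null set, so
  inequalities needed on all of \<open>'s\<close> must be forced by a lattice operation. Finally,
  minimality determines a structure only up to completion. The ring is taken complete, so that every
  minimal structure is a restriction of it and inherits its properties.\<close>

locale content =
  fixes \<A> :: "'a set set" and l :: "'a set \<Rightarrow> real"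
  assumes measure_structure: "measure_structure \<A> l"

sublocale content \<subseteq> ring_of_sets UNIV \<A>
  using measure_structure by (simp add: measure_structure_def)

context content
begin

lemma content_nonneg: "A \<in> \<A> \<Longrightarrow> 0 \<le> l A"
  and additive_content: "additive \<A> l"
  using measure_structure by (auto simp: measure_structure_def)

lemma content_Un: "A \<in> \<A> \<Longrightarrow> B \<in> \<A> \<Longrightarrow> A \<inter> B = {} \<Longrightarrow> l (A \<union> B) = l A + l B"
  using additive_content by (auto simp: additive_def)

lemma content_empty: "l {} = 0"
  using content_Un[of "{}" "{}"] by simp

lemma content_UN:
  "finite S \<Longrightarrow> (\<And>i. i \<in> S \<Longrightarrow> A i \<in> \<A>) \<Longrightarrow> disjoint_family_on A S \<Longrightarrow>
    l (\<Union>i\<in>S. A i) = (\<Sum>i\<in>S. l (A i))"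
proof (induction S rule: finite_induct)
  case (insert i S)
  have "A i \<inter> (\<Union>i\<in>S. A i) = {}"
    using insert.prems(2) insert.hyps(2) by (fastforce simp: disjoint_family_on_def)
  moreover have "disjoint_family_on A S"
    by (rule disjoint_family_on_mono[OF _ insert.prems(2)]) auto
  ultimately show ?case
    using insert by (simp add: content_Un finite_UN)
qed (simp add: content_empty)

lemma content_Diff: "A \<in> \<A> \<Longrightarrow> B \<in> \<A> \<Longrightarrow> A \<subseteq> B \<Longrightarrow> l (B - A) = l B - l A"
  using content_Un[of A "B - A"] Diff[of B A] by (simp add: Un_absorb1)

lemma content_mono: "A \<in> \<A> \<Longrightarrow> B \<in> \<A> \<Longrightarrow> A \<subseteq> B \<Longrightarrow> l A \<le> l B"
  using content_Diff[of A B] content_nonneg[of "B - A"] by auto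

lemma content_Un_le: "A \<in> \<A> \<Longrightarrow> B \<in> \<A> \<Longrightarrow> l (A \<union> B) \<le> l A + l B"
  using content_Un[of A "B - A"] content_mono[of "B - A" B] Diff[of B A] by auto

text \<open>
  The default value \<open>v0\<close> plays the role of 0: its level set need not belong to the ring. Allowing
  arbitrary types of values makes pairs of simple functions step functions as well.
\<close>

definition step :: "('a \<Rightarrow> 'c) \<Rightarrow> 'c \<Rightarrow> bool" where
  "step p v0 \<longleftrightarrow> finite (range p) \<and> (\<forall>T. v0 \<notin> T \<longrightarrow> p -` T \<in> \<A>)"

lemma step_comp: "step p v0 \<Longrightarrow> step (\<lambda>x. \<phi> (p x)) (\<phi> v0)"
  unfolding step_def
proof safe
  assume *: "finite (range p)" "\<forall>T. v0 \<notin> T \<longrightarrow> p -` T \<in> \<A>"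
  show "finite (range (\<lambda>x. \<phi> (p x)))"
    using finite_imageI[OF *(1), of \<phi>] by (simp add: image_image)
  fix T assume "\<phi> v0 \<notin> T"
  then show "(\<lambda>x. \<phi> (p x)) -` T \<in> \<A>"
    using *(2)[rule_format, of "\<phi> -` T"] by (simp add: vimage_def)
qed

text \<open>A fibre over a default value may lie outside the ring. When one coordinate has its
  default value, the intersection of the two fibres is obtained by subtracting from the other fibre
  the preimage of all non-default values, which does lie in the ring.\<close>

lemma step_Pair:
  assumes p: "step p v0" and q: "step q u0"
  shows "step (\<lambda>x. (p x, q x)) (v0, u0)"
  unfolding step_def
proof safe
  have fin: "finite (range p \<times> range q)"
    using p q by (simp add: step_def)
  show "finite (range (\<lambda>x. (p x, q x)))"
    by (rule finite_subset[OF _ fin]) auto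
  fix T assume T: "(v0, u0) \<notin> T"
  have "p -` {v} \<inter> q -` {u} \<in> \<A>" if vu: "(v, u) \<in> T" for v u
  proof -
    consider "v \<noteq> v0" "u \<noteq> u0" | "v \<noteq> v0" "u = u0" | "v = v0" "u \<noteq> u0"
      using vu T by auto
    then show ?thesis
    proof cases
      case 1
      then show ?thesis using p q by (intro Int) (auto simp: step_def)
    next
      case 2
      have "p -` {v} - q -` (- {u}) \<in> \<A>"
        using p q 2 by (intro Diff) (auto simp: step_def)
      moreover have "p -` {v} - q -` (- {u}) = p -` {v} \<inter> q -` {u}" by auto
      ultimately show ?thesis by simp
    next
      case 3
      have "q -` {u} - p -` (- {v}) \<in> \<A>"
        using p q 3 by (intro Diff) (auto simp: step_def)
      moreover have "q -` {u} - p -` (- {v}) = p -` {v} \<inter> q -` {u}" by auto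
      ultimately show ?thesis by simp
    qed
  qed
  then have "(\<Union>(v, u)\<in>T \<inter> (range p \<times> range q). p -` {v} \<inter> q -` {u}) \<in> \<A>"
    using fin by (intro finite_UN) auto
  also have "(\<Union>(v, u)\<in>T \<inter> (range p \<times> range q). p -` {v} \<inter> q -` {u})
      = (\<lambda>x. (p x, q x)) -` T" by auto
  finally show "(\<lambda>x. (p x, q x)) -` T \<in> \<A>" .
qed

text \<open>Trades linear combinations of indicators for a condition on fibres. Any operation that
  fixes 0 then preserves simple functions by \<open>step_comp\<close> and \<open>step_Pair\<close>,
  with no manipulation of representations.\<close>

lemma simple_functions_iff: "f \<in> simple_functions \<A> \<longleftrightarrow> step f 0"
proof
  assume "f \<in> simple_functions \<A>"
  then obtain F c where F: "finite F" "F \<subseteq> \<A>" and f: "f = (\<lambda>x. \<Sum>A\<in>F. c A * indicator A x)"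
    by (auto simp: simple_functions_def)
  from F show "step f 0"
    unfolding f
  proof (induction F)
    case empty
    then show ?case by (auto simp: step_def vimage_def)
  next
    case (insert A F)
    have "step (\<lambda>x. (x \<in> A, \<Sum>A\<in>F. c A * indicator A x)) (False, 0)"
    proof (rule step_Pair)
      have "finite (range (\<lambda>x. x \<in> A))" by (rule finite_subset[of _ UNIV]) auto
      moreover have "(\<lambda>x. x \<in> A) -` T \<in> \<A>" if "False \<notin> T" for T
      proof (cases "True \<in> T")
        case True
        then have "(\<lambda>x. x \<in> A) -` T = A" using that by (auto, metis (full_types))
        then show ?thesis using insert by simp
      next
        case False
        then have "(\<lambda>x. x \<in> A) -` T = {}" using that by (auto, metis (full_types))
        then show ?thesis by simp
      qed
      ultimately show "step (\<lambda>x. x \<in> A) False" by (simp add: step_def)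
      show "step (\<lambda>x. \<Sum>A\<in>F. c A * indicator A x) 0" using insert by simp
    qed
    from step_comp[OF this, of "\<lambda>(b, y). c A * of_bool b + y"]
    show ?case using insert by (simp add: indicator_def of_bool_def)
  qed
next
  assume f: "step f 0"
  let ?F = "(\<lambda>y. f -` {y}) ` (range f - {0})"
  \<comment> \<open>Coefficients are indexed by sets, so the value has to be recovered from the
    fibre; this is possible because the fibre of a value in the range is non-empty.\<close>
  let ?c = "\<lambda>A. f (SOME x. x \<in> A)"
  have inj: "inj_on (\<lambda>y. f -` {y}) (range f - {0})"
    by (auto simp: inj_on_def)
  have c: "?c (f -` {y}) = y" if y: "y \<in> range f" for y
  proof -
    obtain x where "x \<in> f -` {y}" using y by auto
    then have "(SOME x. x \<in> f -` {y}) \<in> f -` {y}" by (rule someI)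
    then show ?thesis by simp
  qed
  have fin: "finite (range f - {0})" using f by (simp add: step_def)
  have "(\<Sum>A\<in>?F. ?c A * indicator A x) = f x" for x
  proof -
    have "(\<Sum>A\<in>?F. ?c A * indicator A x) = (\<Sum>y\<in>range f - {0}. ?c (f -` {y}) * indicator (f -` {y}) x)"
      by (rule sum.reindex_cong[OF inj]) auto
    also have "\<dots> = (\<Sum>y\<in>range f - {0}. if y = f x then y else 0)"
    proof (intro sum.cong refl)
      fix y assume "y \<in> range f - {0}"
      then have "?c (f -` {y}) = y" using c by blast
      then show "?c (f -` {y}) * indicator (f -` {y}) x = (if y = f x then y else 0)"
        by (simp add: indicator_def)
    qed
    also have "\<dots> = f x"
      using fin by (simp add: sum.delta')
    finally show ?thesis .
  qed
  moreover have "finite ?F" "?F \<subseteq> \<A>"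
    using f by (auto simp: step_def)
  ultimately show "f \<in> simple_functions \<A>"
    unfolding simple_functions_def by (intro CollectI exI[of _ ?F] exI[of _ ?c]) auto
qed

text \<open>The fibres of \<open>p\<close> are regrouped by the value of \<open>\<phi>\<close>. With
  a pair as \<open>p\<close>, two simple functions are put on one finite partition, where linearity
  and monotonicity of the integral hold term by term.\<close>

lemma simple_integral_comp:
  assumes p: "step p v0" and \<phi>: "\<phi> v0 = 0"
  shows "simple_integral l (\<lambda>x. \<phi> (p x)) = (\<Sum>v\<in>range p - {v0}. \<phi> v * l (p -` {v}))"
proof -
  let ?f = "\<lambda>x. \<phi> (p x)"
  let ?S = "{v \<in> range p. \<phi> v \<noteq> 0}"
  have fin: "finite (range p)" using p by (simp add: step_def)
  have finf: "finite (range ?f)"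
    using finite_imageI[OF fin, of \<phi>] by (simp add: image_image)
  have "simple_integral l ?f = (\<Sum>y\<in>range ?f - {0}. y * l (?f -` {y}))"
    unfolding simple_integral_def using finf by (intro sum.mono_neutral_right) auto
  also have "\<dots> = (\<Sum>y\<in>range ?f - {0}. \<Sum>v\<in>{v\<in>?S. \<phi> v = y}. \<phi> v * l (p -` {v}))"
  proof (intro sum.cong refl)
    fix y assume y: "y \<in> range ?f - {0}"
    have "(\<Sum>v\<in>{v\<in>?S. \<phi> v = y}. l (p -` {v})) = l (\<Union>v\<in>{v\<in>?S. \<phi> v = y}. p -` {v})"
      using p \<phi> y fin
      by (intro content_UN[symmetric]) (auto simp: step_def disjoint_family_on_def)
    also have "(\<Union>v\<in>{v\<in>?S. \<phi> v = y}. p -` {v}) = ?f -` {y}"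
      using y by auto
    finally have "y * l (?f -` {y}) = (\<Sum>v\<in>{v\<in>?S. \<phi> v = y}. y * l (p -` {v}))"
      by (simp only: sum_distrib_left[symmetric])
    also have "\<dots> = (\<Sum>v\<in>{v\<in>?S. \<phi> v = y}. \<phi> v * l (p -` {v}))"
      by (rule sum.cong) auto
    finally show "y * l (?f -` {y}) = (\<Sum>v\<in>{v\<in>?S. \<phi> v = y}. \<phi> v * l (p -` {v}))" .
  qed
  also have "\<dots> = (\<Sum>v\<in>?S. \<phi> v * l (p -` {v}))"
    using fin finf by (intro sum.group) auto
  also have "\<dots> = (\<Sum>v\<in>range p - {v0}. \<phi> v * l (p -` {v}))"
    using fin \<phi> by (intro sum.mono_neutral_left) auto
  finally show ?thesis .
qed

lemma simple_comp2:
  assumes "f \<in> simple_functions \<A>" "g \<in> simple_functions \<A>" "\<phi> 0 0 = 0"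
  shows "(\<lambda>x. \<phi> (f x) (g x)) \<in> simple_functions \<A>"
  using step_comp[OF step_Pair, of f 0 g 0 "\<lambda>(y, z). \<phi> y z"] assms
  by (simp add: simple_functions_iff)

lemma simple_integral_comp2:
  assumes "f \<in> simple_functions \<A>" "g \<in> simple_functions \<A>" "\<phi> 0 0 = 0"
  shows "simple_integral l (\<lambda>x. \<phi> (f x) (g x)) =
    (\<Sum>v\<in>range (\<lambda>x. (f x, g x)) - {(0, 0)}. \<phi> (fst v) (snd v) * l ((\<lambda>x. (f x, g x)) -` {v}))"
  using simple_integral_comp[OF step_Pair, of f 0 g 0 "\<lambda>v. \<phi> (fst v) (snd v)"] assms
  by (simp add: simple_functions_iff)

lemma simple_linear:
  assumes f: "f \<in> simple_functions \<A>" and g: "g \<in> simple_functions \<A>"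
  shows "(\<lambda>x. a * f x + b * g x) \<in> simple_functions \<A>"
    and "simple_integral l (\<lambda>x. a * f x + b * g x) = a * simple_integral l f + b * simple_integral l g"
proof -
  show "(\<lambda>x. a * f x + b * g x) \<in> simple_functions \<A>"
    by (rule simple_comp2[OF f g]) simp
  show "simple_integral l (\<lambda>x. a * f x + b * g x) = a * simple_integral l f + b * simple_integral l g"
    using simple_integral_comp2[OF f g, of "\<lambda>y z. a * y + b * z"]
      simple_integral_comp2[OF f g, of "\<lambda>y z. y"] simple_integral_comp2[OF f g, of "\<lambda>y z. z"]
    by (simp add: sum_distrib_left sum.distrib algebra_simps)
qed

lemma simple_integral_mono:
  assumes f: "f \<in> simple_functions \<A>" and g: "g \<in> simple_functions \<A>" and le: "\<And>x. f x \<le> g x"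
  shows "simple_integral l f \<le> simple_integral l g"
proof -
  have "(\<lambda>x. (f x, g x)) -` {v} \<in> \<A>" if "v \<noteq> (0, 0)" for v
    using step_Pair[of f 0 g 0] f g that by (simp add: simple_functions_iff step_def)
  then have "(\<Sum>v\<in>range (\<lambda>x. (f x, g x)) - {(0, 0)}. fst v * l ((\<lambda>x. (f x, g x)) -` {v}))
    \<le> (\<Sum>v\<in>range (\<lambda>x. (f x, g x)) - {(0, 0)}. snd v * l ((\<lambda>x. (f x, g x)) -` {v}))"
    by (intro sum_mono mult_right_mono content_nonneg) (auto simp: le)
  then show ?thesis
    using simple_integral_comp2[OF f g, of "\<lambda>y z. y"] simple_integral_comp2[OF f g, of "\<lambda>y z. z"]
    by simp
qed

lemma simple_indicator:
  assumes "E \<in> \<A>"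
  shows "indicator E \<in> simple_functions \<A>" and "simple_integral l (indicator E) = l E"
proof -
  show "indicator E \<in> simple_functions \<A>"
    unfolding simple_functions_def
    by (intro CollectI exI[of _ "{E}"] exI[of _ "\<lambda>_. 1"]) (use assms in auto)
  \<comment> \<open>For empty \<open>E\<close> the value 1 is not attained; the sum may still run
    over \<open>{0, 1}\<close> because the extra fibre is empty.\<close>
  have "indicator E -` {1::real} = {}" if "1 \<notin> range (indicator E :: 'a \<Rightarrow> real)"
    using that by auto
  then have "simple_integral l (indicator E) = (\<Sum>y\<in>{0, 1}. y * l (indicator E -` {y}))"
    unfolding simple_integral_def
    by (intro sum.mono_neutral_left) (auto simp: content_empty indicator_def)
  moreover have "indicator E -` {1::real} = E" by (auto simp: indicator_def split: if_splits)
  ultimately show "simple_integral l (indicator E) = l E" by simp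
qed

lemma simple_support: "f \<in> simple_functions \<A> \<Longrightarrow> {x. f x \<noteq> 0} \<in> \<A>"
  and simple_superlevel: "f \<in> simple_functions \<A> \<Longrightarrow> 0 \<le> c \<Longrightarrow> {x. c < f x} \<in> \<A>"
proof -
  assume f: "f \<in> simple_functions \<A>"
  have "f -` (- {0}) \<in> \<A>" using f by (simp add: simple_functions_iff step_def)
  then show "{x. f x \<noteq> 0} \<in> \<A>" by (simp add: vimage_def)
  assume c: "0 \<le> c"
  have "f -` {c<..} \<in> \<A>" using f c by (simp add: simple_functions_iff step_def)
  then show "{x. c < f x} \<in> \<A>" by (simp add: vimage_def)
qed

lemma simple_bounded:
  assumes "f \<in> simple_functions \<A>"
  obtains M where "0 < M" "\<And>x. \<bar>f x\<bar> \<le> M"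
proof -
  have "finite (range f)" using assms by (simp add: simple_functions_iff step_def)
  then have "bounded (range f)" by (rule finite_imp_bounded)
  then obtain M where "0 < M" "\<And>x. \<bar>f x\<bar> \<le> M"
    unfolding bounded_pos by auto
  then show thesis by (rule that)
qed

lemma simple_abs_diff:
  "f \<in> simple_functions \<A> \<Longrightarrow> g \<in> simple_functions \<A> \<Longrightarrow> (\<lambda>x. \<bar>f x - g x\<bar>) \<in> simple_functions \<A>"
  by (rule simple_comp2) auto

lemma simple_abs: "f \<in> simple_functions \<A> \<Longrightarrow> (\<lambda>x. \<bar>f x\<bar>) \<in> simple_functions \<A>"
  by (rule simple_comp2[where g=f and \<phi>="\<lambda>y z. \<bar>y\<bar>"]) auto

lemma simple_minus: "f \<in> simple_functions \<A> \<Longrightarrow> g \<in> simple_functions \<A> \<Longrightarrow>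
    (\<lambda>x. f x - g x) \<in> simple_functions \<A>"
  and simple_integral_minus: "f \<in> simple_functions \<A> \<Longrightarrow> g \<in> simple_functions \<A> \<Longrightarrow>
    simple_integral l (\<lambda>x. f x - g x) = simple_integral l f - simple_integral l g"
  using simple_linear[of f g 1 "-1"] by simp_all

lemma simple_add: "f \<in> simple_functions \<A> \<Longrightarrow> g \<in> simple_functions \<A> \<Longrightarrow>
    (\<lambda>x. f x + g x) \<in> simple_functions \<A>"
  and simple_integral_add: "f \<in> simple_functions \<A> \<Longrightarrow> g \<in> simple_functions \<A> \<Longrightarrow>
    simple_integral l (\<lambda>x. f x + g x) = simple_integral l f + simple_integral l g"
  using simple_linear[of f g 1 1] by simp_all

lemma simple_cmult: "f \<in> simple_functions \<A> \<Longrightarrow> (\<lambda>x. a * f x) \<in> simple_functions \<A>"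
  and simple_integral_cmult: "f \<in> simple_functions \<A> \<Longrightarrow>
    simple_integral l (\<lambda>x. a * f x) = a * simple_integral l f"
  using simple_linear[of f f a 0] by simp_all

lemma simple_integral_abs:
  assumes "f \<in> simple_functions \<A>"
  shows "\<bar>simple_integral l f\<bar> \<le> simple_integral l (\<lambda>x. \<bar>f x\<bar>)"
  using simple_integral_mono[OF assms simple_abs[OF assms]]
    simple_integral_mono[OF simple_cmult[OF assms, of "-1"] simple_abs[OF assms]]
    simple_integral_cmult[OF assms, of "-1"]
  by (simp add: abs_le_iff)

section \<open>Convergence in content through covering ring sets of small real content, and defining
  sequences\<close>

lemma converges_in_content_iff:
  "converges_in_content \<A> l F f \<longleftrightarrow>
    (\<forall>c>0. \<forall>e>0. \<forall>\<^sub>F n in sequentially. \<exists>A\<in>\<A>. {x. \<bar>F n x - f x\<bar> > c} \<subseteq> A \<and> l A < e)"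
    (is "_ \<longleftrightarrow> ?R")
proof -
  have less: "outer_content \<A> l E < ennreal e \<longleftrightarrow> (\<exists>A\<in>\<A>. E \<subseteq> A \<and> l A < e)" if "0 < e" for E e
    using content_nonneg that
    by (auto simp: outer_content_def INF_less_iff ennreal_less_iff)
  have "converges_in_content \<A> l F f \<longleftrightarrow> (\<forall>c>0. \<forall>e>0. \<forall>\<^sub>F n in sequentially.
      outer_content \<A> l {x. \<bar>F n x - f x\<bar> > c} < ennreal e)"
  proof -
    have "(G \<longlonglongrightarrow> 0) \<longleftrightarrow> (\<forall>e>0. \<forall>\<^sub>F n in sequentially. G n < ennreal e)" for G :: "nat \<Rightarrow> ennreal"
    proof
      assume "G \<longlonglongrightarrow> 0"
      then show "\<forall>e>0. \<forall>\<^sub>F n in sequentially. G n < ennreal e"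
        by (auto simp: order_tendsto_iff)
    next
      assume *: "\<forall>e>0. \<forall>\<^sub>F n in sequentially. G n < ennreal e"
      show "G \<longlonglongrightarrow> 0"
      proof (rule order_tendstoI)
        \<comment> \<open>The level \<open>a\<close> may be infinite, so a finite level below it is
          tested instead.\<close>
        fix a :: ennreal assume "0 < a"
        then obtain b where b: "0 < b" "b < a" using dense by blast
        then have "b < top" by (metis order_less_le_trans top_greatest)
        with b have "ennreal (enn2real b) = b" "0 < enn2real b"
          by (auto simp: enn2real_positive_iff)
        with *[rule_format, of "enn2real b"] have "\<forall>\<^sub>F n in sequentially. G n < b" by simp
        then show "\<forall>\<^sub>F n in sequentially. G n < a"
          by (rule eventually_mono) (use b in auto)
      qed simp
    qed
    then show ?thesis by (simp add: converges_in_content_def)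
  qed
  also have "\<dots> \<longleftrightarrow> ?R" by (simp add: less)
  finally show ?thesis .
qed

lemma defining_sequenceD:
  assumes "defining_sequence \<A> l F f"
  shows "F n \<in> simple_functions \<A>"
    and "0 < c \<Longrightarrow> 0 < e \<Longrightarrow>
      \<forall>\<^sub>F n in sequentially. \<exists>A\<in>\<A>. {x. \<bar>F n x - f x\<bar> > c} \<subseteq> A \<and> l A < e"
    and "0 < e \<Longrightarrow> \<exists>n0. \<forall>n\<ge>n0. \<forall>k\<ge>n0. simple_integral l (\<lambda>x. \<bar>F n x - F k x\<bar>) < e"
proof -
  show F: "F n \<in> simple_functions \<A>" for n
    using assms by (auto simp: defining_sequence_def)
  show "0 < c \<Longrightarrow> 0 < e \<Longrightarrow>
      \<forall>\<^sub>F n in sequentially. \<exists>A\<in>\<A>. {x. \<bar>F n x - f x\<bar> > c} \<subseteq> A \<and> l A < e"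
    using assms by (auto simp: defining_sequence_def converges_in_content_iff)
  assume "0 < e"
  have "((\<lambda>(n, k). simple_integral l (\<lambda>x. \<bar>F n x - F k x\<bar>)) \<longlongrightarrow> 0) (sequentially \<times>\<^sub>F sequentially)"
    using assms by (simp add: defining_sequence_def)
  from order_tendstoD(2)[OF this \<open>0 < e\<close>]
  show "\<exists>n0. \<forall>n\<ge>n0. \<forall>k\<ge>n0. simple_integral l (\<lambda>x. \<bar>F n x - F k x\<bar>) < e"
    unfolding eventually_prod_sequentially by auto
qed

lemma defining_sequenceI:
  assumes F: "\<And>n. F n \<in> simple_functions \<A>"
    and conv: "\<And>c e. 0 < c \<Longrightarrow> 0 < e \<Longrightarrow>
      \<forall>\<^sub>F n in sequentially. \<exists>A\<in>\<A>. {x. \<bar>F n x - f x\<bar> > c} \<subseteq> A \<and> l A < e"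
    and Cauchy: "\<And>e. 0 < e \<Longrightarrow> \<exists>n0. \<forall>n\<ge>n0. \<forall>k\<ge>n0. simple_integral l (\<lambda>x. \<bar>F n x - F k x\<bar>) < e"
  shows "defining_sequence \<A> l F f"
proof -
  have nn: "0 \<le> simple_integral l (\<lambda>x. \<bar>F n x - F k x\<bar>)" for n k
    using simple_integral_abs[OF simple_abs_diff[OF F[of n] F[of k]]] by simp
  have "((\<lambda>(n, k). simple_integral l (\<lambda>x. \<bar>F n x - F k x\<bar>)) \<longlongrightarrow> 0) (sequentially \<times>\<^sub>F sequentially)"
  proof (rule order_tendstoI)
    fix a :: real assume "a < 0"
    then show "\<forall>\<^sub>F x in sequentially \<times>\<^sub>F sequentially.
        a < (case x of (n, k) \<Rightarrow> simple_integral l (\<lambda>x. \<bar>F n x - F k x\<bar>))"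
      by (intro always_eventually) (auto intro: less_le_trans[OF _ nn])
  next
    fix a :: real assume "0 < a"
    from Cauchy[OF this] show "\<forall>\<^sub>F x in sequentially \<times>\<^sub>F sequentially.
        (case x of (n, k) \<Rightarrow> simple_integral l (\<lambda>x. \<bar>F n x - F k x\<bar>)) < a"
      unfolding eventually_prod_sequentially by auto
  qed
  with F conv show ?thesis
    by (auto simp: defining_sequence_def converges_in_content_iff)
qed

text \<open>One Lipschitz argument serves linear combinations, absolute values, maxima and
  truncations alike. Outside two exceptional sets both deviations are at most
  \<open>c / (2 * K)\<close>, hence the composite deviates by at most \<open>c\<close>.\<close>

lemma defining_sequence_comp2:
  assumes F: "defining_sequence \<A> l F f" and G: "defining_sequence \<A> l G g"
    and \<phi>: "\<phi> 0 0 = 0" and K: "0 < K"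
    and Lip: "\<And>x y x' y'. \<bar>\<phi> x y - \<phi> x' y'\<bar> \<le> K * (\<bar>x - x'\<bar> + \<bar>y - y'\<bar>)"
  shows "defining_sequence \<A> l (\<lambda>n x. \<phi> (F n x) (G n x)) (\<lambda>x. \<phi> (f x) (g x))"
proof (rule defining_sequenceI)
  note FS = defining_sequenceD(1)[OF F] and GS = defining_sequenceD(1)[OF G]
  show "(\<lambda>x. \<phi> (F n x) (G n x)) \<in> simple_functions \<A>" for n
    using FS GS \<phi> by (rule simple_comp2)
  show "\<forall>\<^sub>F n in sequentially. \<exists>A\<in>\<A>. {x. \<bar>\<phi> (F n x) (G n x) - \<phi> (f x) (g x)\<bar> > c} \<subseteq> A \<and> l A < e"
    if "0 < c" "0 < e" for c e
  proof -
    have c: "0 < c / (2 * K)" "0 < e / 2" using that K by auto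
    show ?thesis
      using defining_sequenceD(2)[OF F c] defining_sequenceD(2)[OF G c]
    proof eventually_elim
      case (elim n)
      then obtain A B where A: "A \<in> \<A>" "{x. \<bar>F n x - f x\<bar> > c / (2 * K)} \<subseteq> A" "l A < e / 2"
        and B: "B \<in> \<A>" "{x. \<bar>G n x - g x\<bar> > c / (2 * K)} \<subseteq> B" "l B < e / 2" by blast
      have "{x. \<bar>\<phi> (F n x) (G n x) - \<phi> (f x) (g x)\<bar> > c} \<subseteq> A \<union> B"
      proof (intro subsetI)
        fix x assume x: "x \<in> {x. \<bar>\<phi> (F n x) (G n x) - \<phi> (f x) (g x)\<bar> > c}"
        show "x \<in> A \<union> B"
        proof (rule ccontr)
          assume "x \<notin> A \<union> B"
          with A B have "\<bar>F n x - f x\<bar> + \<bar>G n x - g x\<bar> \<le> c / K" by force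
          with K have "K * (\<bar>F n x - f x\<bar> + \<bar>G n x - g x\<bar>) \<le> c"
            by (simp add: pos_le_divide_eq mult.commute)
          with Lip[of "F n x" "G n x" "f x" "g x"] x show False by simp
        qed
      qed
      moreover have "l (A \<union> B) < e" using content_Un_le[of A B] A B by simp
      ultimately show ?case using A B by (intro bexI[of _ "A \<union> B"]) auto
    qed
  qed
  show "\<exists>n0. \<forall>n\<ge>n0. \<forall>k\<ge>n0.
      simple_integral l (\<lambda>x. \<bar>\<phi> (F n x) (G n x) - \<phi> (F k x) (G k x)\<bar>) < e" if "0 < e" for e
  proof -
    have e: "0 < e / (2 * K)" using that K by auto
    from defining_sequenceD(3)[OF F e] obtain n1 where
      n1: "\<And>n k. n1 \<le> n \<Longrightarrow> n1 \<le> k \<Longrightarrow> simple_integral l (\<lambda>x. \<bar>F n x - F k x\<bar>) < e / (2 * K)" by blast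
    from defining_sequenceD(3)[OF G e] obtain n2 where
      n2: "\<And>n k. n2 \<le> n \<Longrightarrow> n2 \<le> k \<Longrightarrow> simple_integral l (\<lambda>x. \<bar>G n x - G k x\<bar>) < e / (2 * K)" by blast
    show ?thesis
    proof (intro exI allI impI)
      fix n k assume nk: "max n1 n2 \<le> n" "max n1 n2 \<le> k"
      have "simple_integral l (\<lambda>x. \<bar>\<phi> (F n x) (G n x) - \<phi> (F k x) (G k x)\<bar>)
         \<le> simple_integral l (\<lambda>x. K * \<bar>F n x - F k x\<bar> + K * \<bar>G n x - G k x\<bar>)"
        using Lip FS GS \<phi>
        by (intro simple_integral_mono simple_abs_diff simple_comp2[where \<phi>=\<phi>] simple_linear)
          (auto simp: distrib_left)
      also have "\<dots> = K * simple_integral l (\<lambda>x. \<bar>F n x - F k x\<bar>) + K * simple_integral l (\<lambda>x. \<bar>G n x - G k x\<bar>)"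
        using FS GS by (intro simple_linear simple_abs_diff)
      also have "\<dots> < K * (e / (2 * K)) + K * (e / (2 * K))"
        using n1[of n k] n2[of n k] nk K by (intro add_strict_mono mult_strict_left_mono) auto
      also have "\<dots> = e" using K by (simp add: field_simps)
      finally show "simple_integral l (\<lambda>x. \<bar>\<phi> (F n x) (G n x) - \<phi> (F k x) (G k x)\<bar>) < e" .
    qed
  qed
qed

text \<open>The fixed function \<open>g\<close> supplies the finite support and the bound. Where
  \<open>g\<close> vanishes, \<open>f\<close> is itself the difference; on the support of
  \<open>g\<close> outside \<open>A\<close>, \<open>f\<close> is at most \<open>c\<close> in
  absolute value; on \<open>A\<close> the triangle inequality costs \<open>M\<close>.\<close>

lemma simple_abs_integral_le:
  assumes f: "f \<in> simple_functions \<A>" and g: "g \<in> simple_functions \<A>"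
    and M: "\<And>x. \<bar>g x\<bar> \<le> M" and c: "0 \<le> c" and A: "A \<in> \<A>" "{x. \<bar>f x\<bar> > c} \<subseteq> A"
  shows "simple_integral l (\<lambda>x. \<bar>f x\<bar>) \<le>
    simple_integral l (\<lambda>x. \<bar>f x - g x\<bar>) + c * l {x. g x \<noteq> 0} + M * l A"
proof -
  let ?S = "{x. g x \<noteq> 0}"
  have S: "?S \<in> \<A>" using g by (rule simple_support)
  have M0: "0 \<le> M" using M[of undefined] by simp
  have "simple_integral l (\<lambda>x. \<bar>f x\<bar>) \<le>
      simple_integral l (\<lambda>x. \<bar>f x - g x\<bar> + (c * indicator ?S x + M * indicator A x))"
  proof (rule simple_integral_mono)
    show "(\<lambda>x. \<bar>f x\<bar>) \<in> simple_functions \<A>" using f by (rule simple_abs)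
    show "(\<lambda>x. \<bar>f x - g x\<bar> + (c * indicator ?S x + M * indicator A x)) \<in> simple_functions \<A>"
      using f g S A by (intro simple_add simple_abs_diff simple_linear simple_indicator)
    show "\<bar>f x\<bar> \<le> \<bar>f x - g x\<bar> + (c * indicator ?S x + M * indicator A x)" for x
      using A(2) M[of x] M0 c by (cases "x \<in> A"; cases "g x = 0") (force simp: indicator_def)+
  qed
  also have "\<dots> = simple_integral l (\<lambda>x. \<bar>f x - g x\<bar>) + (c * l ?S + M * l A)"
    using f g S A(1)
    by (simp add: simple_integral_add simple_abs_diff simple_linear simple_indicator)
  finally show ?thesis by simp
qed

text \<open>The heart of the uniqueness of the integral. All late \<open>F n\<close> are compared
  with one fixed \<open>F n0\<close>, whose support and bound are known before the level
  \<open>c\<close> and the exceptional set are chosen.\<close>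

lemma defining_sequence_0:
  assumes F: "defining_sequence \<A> l F (\<lambda>x. 0)"
  shows "(\<lambda>n. simple_integral l (\<lambda>x. \<bar>F n x\<bar>)) \<longlonglongrightarrow> 0"
proof (rule order_tendstoI)
  note FS = defining_sequenceD(1)[OF F]
  fix a :: real
  show "\<forall>\<^sub>F n in sequentially. a < simple_integral l (\<lambda>x. \<bar>F n x\<bar>)" if "a < 0"
  proof (intro always_eventually allI)
    show "a < simple_integral l (\<lambda>x. \<bar>F n x\<bar>)" for n
      using that simple_integral_abs[OF simple_abs[OF FS[of n]]] by simp
  qed
  assume a: "0 < a"
  then obtain n0 where n0: "\<And>n k. n0 \<le> n \<Longrightarrow> n0 \<le> k \<Longrightarrow> simple_integral l (\<lambda>x. \<bar>F n x - F k x\<bar>) < a / 3"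
    using defining_sequenceD(3)[OF F, of "a / 3"] by auto
  obtain M where M: "0 < M" "\<And>x. \<bar>F n0 x\<bar> \<le> M" using simple_bounded[OF FS] by blast
  define s where "s = l {x. F n0 x \<noteq> 0}"
  have s: "0 \<le> s" unfolding s_def by (intro content_nonneg simple_support FS)
  \<comment> \<open>The summand 1 keeps the denominator positive when the support has content 0.
    Each of the three terms in \<open>simple_abs_integral_le\<close> gets a third of
    \<open>a\<close>.\<close>
  define c where "c = a / (3 * (s + 1))"
  have c: "0 < c" "c * s < a / 3" using a s by (auto simp: c_def field_simps)
  have "0 < a / (3 * M)" using a M by simp
  from defining_sequenceD(2)[OF F c(1) this] eventually_ge_at_top[of n0]
  show "\<forall>\<^sub>F n in sequentially. simple_integral l (\<lambda>x. \<bar>F n x\<bar>) < a"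
  proof eventually_elim
    case (elim n)
    then obtain A where A: "A \<in> \<A>" "{x. \<bar>F n x\<bar> > c} \<subseteq> A" "l A < a / (3 * M)" by auto
    have "M * l A < a / 3" using A(3) M by (simp add: field_simps)
    with simple_abs_integral_le[OF FS FS M(2) _ A(1,2)] n0[of n n0] c elim(2)
    show ?case by (force simp: s_def)
  qed
qed

lemma defining_sequence_integral_Cauchy:
  assumes F: "defining_sequence \<A> l F f"
  shows "convergent (\<lambda>n. simple_integral l (F n))"
proof -
  note FS = defining_sequenceD(1)[OF F]
  have "Cauchy (\<lambda>n. simple_integral l (F n))"
    unfolding Cauchy_def
  proof (intro allI impI)
    fix e :: real assume "0 < e"
    from defining_sequenceD(3)[OF F this] obtain n0 where
      n0: "\<And>n k. n0 \<le> n \<Longrightarrow> n0 \<le> k \<Longrightarrow> simple_integral l (\<lambda>x. \<bar>F n x - F k x\<bar>) < e" by blast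
    have "dist (simple_integral l (F n)) (simple_integral l (F k)) < e" if "n0 \<le> n" "n0 \<le> k" for n k
      using n0[OF that] simple_integral_abs[OF simple_minus[OF FS[of n] FS[of k]]]
      by (simp add: dist_real_def simple_integral_minus FS)
    then show "\<exists>M. \<forall>m\<ge>M. \<forall>n\<ge>M. dist (simple_integral l (F m)) (simple_integral l (F n)) < e" by blast
  qed
  then show ?thesis by (rule Cauchy_convergent)
qed

text \<open>Justifies the definite description in \<open>content_integral\<close>: the difference of
  two defining sequences of \<open>f\<close> is a defining sequence of 0.\<close>

lemma defining_sequence_integral:
  assumes F: "defining_sequence \<A> l F f"
  shows "(\<lambda>n. simple_integral l (F n)) \<longlonglongrightarrow> content_integral \<A> l f"
proof -
  obtain I where I: "(\<lambda>n. simple_integral l (F n)) \<longlonglongrightarrow> I"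
    using defining_sequence_integral_Cauchy[OF F] by (auto simp: convergent_def)
  have "content_integral \<A> l f = I"
    unfolding content_integral_def
  proof (rule the_equality)
    show "\<exists>F. defining_sequence \<A> l F f \<and> (\<lambda>n. simple_integral l (F n)) \<longlonglongrightarrow> I"
      using F I by blast
    fix I' assume "\<exists>F. defining_sequence \<A> l F f \<and> (\<lambda>n. simple_integral l (F n)) \<longlonglongrightarrow> I'"
    then obtain G where G: "defining_sequence \<A> l G f" and I': "(\<lambda>n. simple_integral l (G n)) \<longlonglongrightarrow> I'" by blast
    note S = defining_sequenceD(1)[OF F] defining_sequenceD(1)[OF G]
    have "defining_sequence \<A> l (\<lambda>n x. F n x - G n x) (\<lambda>x. f x - f x)"
      by (rule defining_sequence_comp2[OF F G, of _ 1]) auto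
    then have 0: "(\<lambda>n. simple_integral l (\<lambda>x. \<bar>F n x - G n x\<bar>)) \<longlonglongrightarrow> 0"
      using defining_sequence_0[of "\<lambda>n x. F n x - G n x"] by simp
    have "(\<lambda>n. simple_integral l (F n) - simple_integral l (G n)) \<longlonglongrightarrow> 0"
      by (rule Lim_null_comparison[OF _ 0])
        (use simple_integral_abs[OF simple_minus[OF S]] in
          \<open>auto simp: simple_integral_minus S intro!: always_eventually\<close>)
    with tendsto_diff[OF I I'] have "I - I' = 0" by (metis LIMSEQ_unique)
    then show "I' = I" by simp
  qed
  with I show ?thesis by simp
qed

end

section \<open>Stonean lattice functionals and the space of integrable functions\<close>

text \<open>The truncation laws exclude positive functionals that no content represents. On
  continuous piecewise linear functions, the slope at infinity violates the first law, and the right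
  derivative at 0 of functions vanishing at 0 violates the second.\<close>

locale stone_functional =
  fixes V :: "('x \<Rightarrow> real) set" and J :: "('x \<Rightarrow> real) \<Rightarrow> real"
  assumes zero_mem: "(\<lambda>x. 0) \<in> V"
    and linear_mem: "f \<in> V \<Longrightarrow> g \<in> V \<Longrightarrow> (\<lambda>x. a * f x + b * g x) \<in> V"
    and J_linear: "f \<in> V \<Longrightarrow> g \<in> V \<Longrightarrow> J (\<lambda>x. a * f x + b * g x) = a * J f + b * J g"
    and max_mem: "f \<in> V \<Longrightarrow> g \<in> V \<Longrightarrow> (\<lambda>x. max (f x) (g x)) \<in> V"
    and min_1_mem: "f \<in> V \<Longrightarrow> (\<lambda>x. min (f x) 1) \<in> V"
    and J_nonneg: "f \<in> V \<Longrightarrow> (\<And>x. 0 \<le> f x) \<Longrightarrow> 0 \<le> J f"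
    and J_truncate_above: "f \<in> V \<Longrightarrow> (\<And>x. 0 \<le> f x) \<Longrightarrow> 0 < e \<Longrightarrow>
      \<exists>K>0. J f - J (\<lambda>x. min (f x) K) < e"
    and J_truncate_below: "f \<in> V \<Longrightarrow> (\<And>x. 0 \<le> f x) \<Longrightarrow> 0 < e \<Longrightarrow>
      \<exists>d>0. J (\<lambda>x. min (f x) d) < e"
begin

lemma add_mem: "f \<in> V \<Longrightarrow> g \<in> V \<Longrightarrow> (\<lambda>x. f x + g x) \<in> V"
  and J_add: "f \<in> V \<Longrightarrow> g \<in> V \<Longrightarrow> J (\<lambda>x. f x + g x) = J f + J g"
  using linear_mem[of f g 1 1] J_linear[of f g 1 1] by simp_all

lemma diff_mem: "f \<in> V \<Longrightarrow> g \<in> V \<Longrightarrow> (\<lambda>x. f x - g x) \<in> V"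
  and J_diff: "f \<in> V \<Longrightarrow> g \<in> V \<Longrightarrow> J (\<lambda>x. f x - g x) = J f - J g"
  using linear_mem[of f g 1 "-1"] J_linear[of f g 1 "-1"] by simp_all

lemma cmult_mem: "f \<in> V \<Longrightarrow> (\<lambda>x. a * f x) \<in> V"
  and J_cmult: "f \<in> V \<Longrightarrow> J (\<lambda>x. a * f x) = a * J f"
  using linear_mem[of f f a 0] J_linear[of f f a 0] by simp_all

lemma uminus_mem: "f \<in> V \<Longrightarrow> (\<lambda>x. - f x) \<in> V"
  and J_uminus: "f \<in> V \<Longrightarrow> J (\<lambda>x. - f x) = - J f"
  using cmult_mem[of f "-1"] J_cmult[of f "-1"] by simp_all

lemma J_0: "J (\<lambda>x. 0) = 0"
  using J_linear[OF zero_mem zero_mem, of 0 0] by simp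

lemma J_mono: "f \<in> V \<Longrightarrow> g \<in> V \<Longrightarrow> (\<And>x. f x \<le> g x) \<Longrightarrow> J f \<le> J g"
  using J_nonneg[of "\<lambda>x. g x - f x"] diff_mem[of g f] J_diff[of g f] by simp

lemma min_mem: 
  assumes "f \<in> V" "g \<in> V" shows "(\<lambda>x. min (f x) (g x)) \<in> V"
proof -
  have "(\<lambda>x. min (f x) (g x)) = (\<lambda>x. - max (- f x) (- g x))" by (auto simp: fun_eq_iff)
  then show ?thesis using assms by (simp add: uminus_mem max_mem)
qed

lemma abs_mem:
  assumes "f \<in> V" shows "(\<lambda>x. \<bar>f x\<bar>) \<in> V"
proof -
  have "(\<lambda>x. \<bar>f x\<bar>) = (\<lambda>x. max (f x) (- f x))" by (auto simp: fun_eq_iff)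
  then show ?thesis using assms by (simp add: uminus_mem max_mem)
qed

lemma min_const_mem:
  assumes "f \<in> V" "0 < t" shows "(\<lambda>x. min (f x) t) \<in> V"
proof -
  have "(\<lambda>x. min (f x) t) = (\<lambda>x. t * min (1 / t * f x) 1)"
    using assms(2) by (auto simp: fun_eq_iff min_def field_simps)
  then show ?thesis using assms(1) by (simp only: cmult_mem min_1_mem)
qed

lemma sum_mem: "finite S \<Longrightarrow> (\<And>i. i \<in> S \<Longrightarrow> f i \<in> V) \<Longrightarrow> (\<lambda>x. \<Sum>i\<in>S. c i * f i x) \<in> V"
  and J_sum: "finite S \<Longrightarrow> (\<And>i. i \<in> S \<Longrightarrow> f i \<in> V) \<Longrightarrow>
    J (\<lambda>x. \<Sum>i\<in>S. c i * f i x) = (\<Sum>i\<in>S. c i * J (f i))"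
proof -
  have *: "(\<lambda>x. \<Sum>i\<in>S. c i * f i x) \<in> V \<and> J (\<lambda>x. \<Sum>i\<in>S. c i * f i x) = (\<Sum>i\<in>S. c i * J (f i))"
    if "finite S" "\<And>i. i \<in> S \<Longrightarrow> f i \<in> V"
    using that
    by (induction S rule: finite_induct) (simp_all add: zero_mem J_0 add_mem J_add cmult_mem J_cmult)
  show "finite S \<Longrightarrow> (\<And>i. i \<in> S \<Longrightarrow> f i \<in> V) \<Longrightarrow> (\<lambda>x. \<Sum>i\<in>S. c i * f i x) \<in> V"
    and "finite S \<Longrightarrow> (\<And>i. i \<in> S \<Longrightarrow> f i \<in> V) \<Longrightarrow>
    J (\<lambda>x. \<Sum>i\<in>S. c i * f i x) = (\<Sum>i\<in>S. c i * J (f i))"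
    using * by blast+
qed

lemma abs_J_le: "f \<in> V \<Longrightarrow> \<bar>J f\<bar> \<le> J (\<lambda>x. \<bar>f x\<bar>)"
  using J_mono[of f "\<lambda>x. \<bar>f x\<bar>"] J_mono[of "\<lambda>x. - f x" "\<lambda>x. \<bar>f x\<bar>"]
  by (simp add: abs_mem uminus_mem J_uminus abs_le_iff)

end

section \<open>Integrable functions: lattice operations, truncation, null sets and
  approximation\<close>

context content
begin

abbreviation (input) "\<I> \<equiv> content_integral \<A> l"

lemma L1_comp2:
  assumes "f \<in> L1 \<A> l" "g \<in> L1 \<A> l" "\<phi> 0 0 = 0" "0 < K"
    and "\<And>x y x' y'. \<bar>\<phi> x y - \<phi> x' y'\<bar> \<le> K * (\<bar>x - x'\<bar> + \<bar>y - y'\<bar>)"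
  shows "(\<lambda>x. \<phi> (f x) (g x)) \<in> L1 \<A> l"
  using assms defining_sequence_comp2[of _ f _ g \<phi> K] unfolding L1_def by blast

lemma abs_linear_diff_le:
  "\<bar>(a * x + b * y) - (a * x' + b * y')\<bar> \<le> (\<bar>a\<bar> + \<bar>b\<bar> + 1) * (\<bar>x - x'\<bar> + \<bar>y - y'\<bar>)" for a b :: real
proof -
  have "\<bar>(a * x + b * y) - (a * x' + b * y')\<bar> = \<bar>a * (x - x') + b * (y - y')\<bar>"
    by (simp add: algebra_simps)
  also have "\<dots> \<le> \<bar>a\<bar> * \<bar>x - x'\<bar> + \<bar>b\<bar> * \<bar>y - y'\<bar>"
    by (metis abs_mult abs_triangle_ineq)
  also have "\<dots> \<le> (\<bar>a\<bar> + \<bar>b\<bar> + 1) * \<bar>x - x'\<bar> + (\<bar>a\<bar> + \<bar>b\<bar> + 1) * \<bar>y - y'\<bar>"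
    by (intro add_mono mult_right_mono) auto
  finally show ?thesis by (simp add: distrib_left)
qed

lemma defining_sequence_linear:
  "defining_sequence \<A> l F f \<Longrightarrow> defining_sequence \<A> l G g \<Longrightarrow>
    defining_sequence \<A> l (\<lambda>n x. a * F n x + b * G n x) (\<lambda>x. a * f x + b * g x)"
  by (rule defining_sequence_comp2[where K="\<bar>a\<bar> + \<bar>b\<bar> + 1"]) (auto simp: abs_linear_diff_le)

lemma defining_sequence_abs:
  "defining_sequence \<A> l F f \<Longrightarrow> defining_sequence \<A> l (\<lambda>n x. \<bar>F n x\<bar>) (\<lambda>x. \<bar>f x\<bar>)"
  by (rule defining_sequence_comp2[where K=1 and \<phi>="\<lambda>x y. \<bar>x\<bar>"]) auto

lemma L1_linear:
  assumes f: "f \<in> L1 \<A> l" and g: "g \<in> L1 \<A> l"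
  shows "(\<lambda>x. a * f x + b * g x) \<in> L1 \<A> l"
    and "\<I> (\<lambda>x. a * f x + b * g x) = a * \<I> f + b * \<I> g"
proof -
  obtain F G where F: "defining_sequence \<A> l F f" and G: "defining_sequence \<A> l G g"
    using f g by (auto simp: L1_def)
  note FG = defining_sequence_linear[OF F G, of a b]
  show "(\<lambda>x. a * f x + b * g x) \<in> L1 \<A> l"
    using FG unfolding L1_def by blast
  have "(\<lambda>n. a * simple_integral l (F n) + b * simple_integral l (G n)) \<longlonglongrightarrow> a * \<I> f + b * \<I> g"
    by (intro tendsto_intros defining_sequence_integral F G)
  with defining_sequence_integral[OF FG] show "\<I> (\<lambda>x. a * f x + b * g x) = a * \<I> f + b * \<I> g"
    using defining_sequenceD(1)[OF F] defining_sequenceD(1)[OF G]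
    by (simp add: simple_linear) (metis LIMSEQ_unique)
qed

lemma simple_L1:
  assumes f: "f \<in> simple_functions \<A>"
  shows "f \<in> L1 \<A> l" and "\<I> f = simple_integral l f"
proof -
  have "simple_integral l (\<lambda>x. \<bar>f x - f x\<bar>) = 0"
    using simple_integral_cmult[OF f, of 0] by simp
  then have *: "defining_sequence \<A> l (\<lambda>n. f) f"
    using f by (intro defining_sequenceI) (auto intro!: bexI[of _ "{}"] simp: content_empty)
  then show "f \<in> L1 \<A> l" by (auto simp: L1_def)
  show "\<I> f = simple_integral l f"
    using defining_sequence_integral[OF *] by (simp add: LIMSEQ_const_iff)
qed

text \<open>A non-negative \<open>f\<close> equals its absolute value, so the absolute values of a
  defining sequence define \<open>f\<close> as well.\<close>

lemma L1_nonneg: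
  assumes f: "f \<in> L1 \<A> l" and nn: "\<And>x. 0 \<le> f x"
  shows "0 \<le> \<I> f"
proof -
  obtain F where F: "defining_sequence \<A> l F f" using f by (auto simp: L1_def)
  note S = defining_sequenceD(1)[OF F]
  have "(\<lambda>n. simple_integral l (\<lambda>x. \<bar>F n x\<bar>)) \<longlonglongrightarrow> \<I> f"
    using defining_sequence_integral[OF defining_sequence_abs[OF F]] nn by simp
  moreover have "0 \<le> simple_integral l (\<lambda>x. \<bar>F n x\<bar>)" for n
    using simple_integral_abs[OF simple_abs[OF S[of n]]] by simp
  ultimately show ?thesis by (intro LIMSEQ_le_const) auto
qed

text \<open>For fixed \<open>n0\<close> the functions \<open>\<bar>F n x - F n0 x\<bar>\<close> form
  a defining sequence of \<open>\<bar>f x - F n0 x\<bar>\<close>; the Cauchy property bounds their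
  integrals and hence the limit.\<close>

lemma L1_simple_approx:
  assumes f: "f \<in> L1 \<A> l" and e: "0 < e"
  obtains F where "F \<in> simple_functions \<A>" "\<I> (\<lambda>x. \<bar>f x - F x\<bar>) < e"
proof -
  obtain F where F: "defining_sequence \<A> l F f" using f by (auto simp: L1_def)
  note S = defining_sequenceD(1)[OF F]
  obtain n0 where n0: "\<And>n k. n0 \<le> n \<Longrightarrow> n0 \<le> k \<Longrightarrow> simple_integral l (\<lambda>x. \<bar>F n x - F k x\<bar>) < e / 2"
    using defining_sequenceD(3)[OF F, of "e / 2"] e by auto
  have "defining_sequence \<A> l (\<lambda>n. F n0) (F n0)"
    using S[of n0] simple_integral_cmult[OF S[of n0], of 0]
    by (intro defining_sequenceI) (auto intro!: bexI[of _ "{}"] simp: content_empty)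
  from defining_sequence_abs[OF defining_sequence_linear[OF F this, of 1 "-1"]]
  have "(\<lambda>n. simple_integral l (\<lambda>x. \<bar>F n x - F n0 x\<bar>)) \<longlonglongrightarrow> \<I> (\<lambda>x. \<bar>f x - F n0 x\<bar>)"
    by (intro defining_sequence_integral) simp
  then have "\<I> (\<lambda>x. \<bar>f x - F n0 x\<bar>) \<le> e / 2"
    by (rule LIMSEQ_le_const2) (use n0 in \<open>auto intro!: exI[of _ n0] less_imp_le\<close>)
  with e have "\<I> (\<lambda>x. \<bar>f x - F n0 x\<bar>) < e" by simp
  with S show thesis by (rule that)
qed

lemma L1_max: "f \<in> L1 \<A> l \<Longrightarrow> g \<in> L1 \<A> l \<Longrightarrow> (\<lambda>x. max (f x) (g x)) \<in> L1 \<A> l"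
  by (rule L1_comp2[where K=1]) auto

lemma L1_abs: "f \<in> L1 \<A> l \<Longrightarrow> (\<lambda>x. \<bar>f x\<bar>) \<in> L1 \<A> l"
  by (rule L1_comp2[where K=1 and \<phi>="\<lambda>x y. \<bar>x\<bar>" and g=f]) auto

lemma L1_min_const: "f \<in> L1 \<A> l \<Longrightarrow> 0 < t \<Longrightarrow> (\<lambda>x. min (f x) t) \<in> L1 \<A> l"
  by (rule L1_comp2[where K=1 and \<phi>="\<lambda>x y. min x t" and g=f]) auto

lemma L1_mono: "f \<in> L1 \<A> l \<Longrightarrow> g \<in> L1 \<A> l \<Longrightarrow> (\<And>x. f x \<le> g x) \<Longrightarrow> \<I> f \<le> \<I> g"
  using L1_nonneg[of "\<lambda>x. g x - f x"] L1_linear[of g f 1 "-1"] by simp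

text \<open>Both truncation laws come from one simple approximation \<open>F\<close> of
  \<open>f\<close>. The part of \<open>f\<close> above the bound \<open>M\<close> of
  \<open>F\<close> is at most the error \<open>\<bar>f x - F x\<bar>\<close>. The truncation at
  \<open>d\<close> is at most \<open>d\<close> on the support of \<open>F\<close> and at most the
  error elsewhere.\<close>

sublocale integral: stone_functional "L1 \<A> l" "content_integral \<A> l"
proof
  show "(\<lambda>x. 0) \<in> L1 \<A> l"
    by (intro simple_L1) (auto simp: simple_functions_def intro!: exI[of _ "{}"])
  fix f assume f: "f \<in> L1 \<A> l" 
  show "(\<lambda>x. min (f x) 1) \<in> L1 \<A> l" using f by (rule L1_min_const) simp
  assume nn: "\<And>x. 0 \<le> f x"
  show "0 \<le> \<I> f" using f nn by (rule L1_nonneg)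
  fix e :: real assume e: "0 < e"
  then have "0 < e / 2" by simp
  then obtain F where F: "F \<in> simple_functions \<A>" and Fe: "\<I> (\<lambda>x. \<bar>f x - F x\<bar>) < e / 2"
    using L1_simple_approx[OF f] by blast
  have FL: "F \<in> L1 \<A> l" and dL: "(\<lambda>x. \<bar>f x - F x\<bar>) \<in> L1 \<A> l"
    using simple_L1[OF F] L1_abs[OF L1_linear(1)[OF f simple_L1(1)[OF F], of 1 "-1"]] by auto
  obtain M where M: "0 < M" "\<And>x. \<bar>F x\<bar> \<le> M" using simple_bounded[OF F] by blast
  have "\<I> f \<le> \<I> (\<lambda>x. 1 * min (f x) M + 1 * \<bar>f x - F x\<bar>)"
  proof (intro L1_mono L1_linear L1_min_const f M dL)
    show "f x \<le> 1 * min (f x) M + 1 * \<bar>f x - F x\<bar>" for x using M(2)[of x] by auto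
  qed
  also have "\<dots> = \<I> (\<lambda>x. min (f x) M) + \<I> (\<lambda>x. \<bar>f x - F x\<bar>)"
    by (subst L1_linear) (auto intro: L1_min_const f M dL)
  finally show "\<exists>K>0. \<I> f - \<I> (\<lambda>x. min (f x) K) < e"
    using Fe e M by (intro exI[of _ M]) auto
  let ?S = "{x. F x \<noteq> 0}"
  have S: "?S \<in> \<A>" using F by (rule simple_support)
  then have iS: "indicator ?S \<in> L1 \<A> l" "\<I> (indicator ?S) = l ?S"
    using simple_L1[of "indicator ?S"] by (simp_all add: simple_indicator)
  define d where "d = e / (2 * (l ?S + 1))"
  have d: "0 < d" "d * l ?S < e / 2"
    using e content_nonneg[OF S] by (auto simp: d_def field_simps)
  have "\<I> (\<lambda>x. min (f x) d) \<le> \<I> (\<lambda>x. d * indicator ?S x + 1 * \<bar>f x - F x\<bar>)"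
  proof (intro L1_mono L1_linear L1_min_const f d dL iS)
    show "min (f x) d \<le> d * indicator ?S x + 1 * \<bar>f x - F x\<bar>" for x
      using nn[of x] by (auto simp: indicator_def)
  qed
  also have "\<dots> = d * l ?S + \<I> (\<lambda>x. \<bar>f x - F x\<bar>)"
    by (subst L1_linear) (auto intro: iS dL simp: iS)
  finally show "\<exists>d>0. \<I> (\<lambda>x. min (f x) d) < e"
    using Fe e d by (intro exI[of _ d]) auto
qed (use L1_linear L1_max in auto)

lemma L1_indicator: "A \<in> \<A> \<Longrightarrow> indicator A \<in> L1 \<A> l"
  and integral_indicator: "A \<in> \<A> \<Longrightarrow> \<I> (indicator A) = l A"
  using simple_L1[of "indicator A"] by (simp_all add: simple_indicator)

text \<open>The same defining sequence serves \<open>g\<close>, once every exceptional set is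
  enlarged by \<open>N\<close>.\<close>

lemma L1_null_modification:
  assumes f: "f \<in> L1 \<A> l" and N: "N \<in> \<A>" "l N = 0" and eq: "\<And>x. x \<notin> N \<Longrightarrow> g x = f x"
  shows "g \<in> L1 \<A> l" and "\<I> g = \<I> f"
proof -
  obtain F where F: "defining_sequence \<A> l F f" using f by (auto simp: L1_def)
  have G: "defining_sequence \<A> l F g"
  proof (rule defining_sequenceI)
    show "F n \<in> simple_functions \<A>" for n by (rule defining_sequenceD(1)[OF F])
    show "\<exists>n0. \<forall>n\<ge>n0. \<forall>k\<ge>n0. simple_integral l (\<lambda>x. \<bar>F n x - F k x\<bar>) < e" if "0 < e" for e
      using that by (rule defining_sequenceD(3)[OF F])
    fix c e :: real assume "0 < c" "0 < e"
    from defining_sequenceD(2)[OF F this]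
    show "\<forall>\<^sub>F n in sequentially. \<exists>A\<in>\<A>. {x. \<bar>F n x - g x\<bar> > c} \<subseteq> A \<and> l A < e"
    proof eventually_elim
      case (elim n)
      then obtain A where A: "A \<in> \<A>" "{x. \<bar>F n x - f x\<bar> > c} \<subseteq> A" "l A < e" by blast
      have "{x. \<bar>F n x - g x\<bar> > c} \<subseteq> A \<union> N" using A(2) eq by auto
      moreover have "l (A \<union> N) < e" using content_Un_le[of A N] A N by simp
      ultimately show ?case using A N by (intro bexI[of _ "A \<union> N"]) auto
    qed
  qed
  then show "g \<in> L1 \<A> l" by (auto simp: L1_def)
  show "\<I> g = \<I> f"
    using defining_sequence_integral[OF F] defining_sequence_integral[OF G] by (rule LIMSEQ_unique[symmetric])
qed

lemma integral_mono_null: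
  assumes f: "f \<in> L1 \<A> l" and g: "g \<in> L1 \<A> l" and N: "N \<in> \<A>" "l N = 0"
    and le: "\<And>x. x \<notin> N \<Longrightarrow> f x \<le> g x"
  shows "\<I> f \<le> \<I> g"
proof -
  let ?g = "\<lambda>x. max (f x) (g x)"
  have "\<I> f \<le> \<I> ?g" using f g by (intro integral.J_mono integral.max_mem) auto
  also have "\<I> ?g = \<I> g"
    using g N by (rule L1_null_modification) (use le in \<open>auto simp: max_def intro: antisym\<close>)
  finally show ?thesis .
qed

text \<open>A Chebyshev inequality whose sets come from the ring. Superlevel sets of
  \<open>f\<close> may lie outside the ring, so a superlevel set of some \<open>F n\<close> is used,
  together with the exceptional set where \<open>F n\<close> is far from \<open>f\<close>.\<close>

lemma L1_cover:
  assumes f: "f \<in> L1 \<A> l" and nn: "\<And>x. 0 \<le> f x" and E: "\<And>x. x \<in> E \<Longrightarrow> 1 \<le> f x" and e: "0 < e"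
  obtains A where "A \<in> \<A>" "E \<subseteq> A" "l A < \<I> f + e"
proof -
  obtain F where F: "defining_sequence \<A> l F f" using f by (auto simp: L1_def)
  note S = defining_sequenceD(1)[OF F]
  define I where "I = \<I> f"
  have I: "0 \<le> I" unfolding I_def using f nn by (rule L1_nonneg)
  have lim: "(\<lambda>n. simple_integral l (\<lambda>x. \<bar>F n x\<bar>)) \<longlonglongrightarrow> I"
    using defining_sequence_integral[OF defining_sequence_abs[OF F]] nn by (simp add: I_def)
  have lim_less: "\<forall>\<^sub>F n in sequentially. simple_integral l (\<lambda>x. \<bar>F n x\<bar>) < I + e / 2"
    by (rule order_tendstoD(2)[OF lim]) (use e in simp)
  \<comment> \<open>Chosen so that division by \<open>1 - 2 * c\<close> raises
    \<open>I + e / 2\<close> to at most \<open>I + 2 * e / 3\<close>. Together with the content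
    \<open>e / 4\<close> of \<open>A\<close> this stays below \<open>I + e\<close>.\<close>
  define c where "c = e / (12 * (I + e))"
  have c: "0 < c" "c \<le> 1 / 12" using I e by (auto simp: c_def field_simps)
  have "12 * (I + e) * c = e" using I e by (simp add: c_def)
  then have "12 * (I * c) + 12 * (e * c) = e" by (simp add: algebra_simps)
  moreover have "0 < I * c + e * c" "0 < e * c" using I e c by (simp_all add: add_nonneg_pos)
  ultimately have bound: "I + e / 2 \<le> (1 - 2 * c) * (I + 2 * e / 3)"
    by (simp add: algebra_simps)
  have "0 < e / 4" using e by simp
  with defining_sequenceD(2)[OF F c(1)]
  have ev: "\<forall>\<^sub>F n in sequentially. \<exists>A\<in>\<A>. {x. \<bar>F n x - f x\<bar> > c} \<subseteq> A \<and> l A < e / 4" by blast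
  have "\<exists>n A. A \<in> \<A> \<and> {x. \<bar>F n x - f x\<bar> > c} \<subseteq> A \<and> l A < e / 4
      \<and> simple_integral l (\<lambda>x. \<bar>F n x\<bar>) < I + e / 2"
    using eventually_happens[OF eventually_conj[OF ev lim_less]] by auto
  then obtain n A where A: "A \<in> \<A>" "{x. \<bar>F n x - f x\<bar> > c} \<subseteq> A" "l A < e / 4"
    and n: "simple_integral l (\<lambda>x. \<bar>F n x\<bar>) < I + e / 2" by blast
  \<comment> \<open>Where \<open>f x \<ge> 1\<close> and \<open>x \<notin> A\<close>,
    \<open>\<bar>F n x\<bar>\<close> is at least \<open>1 - c\<close>, which strictly exceeds the
    level used here.\<close>
  define B where "B = {x. 1 - 2 * c < \<bar>F n x\<bar>}"
  have B: "B \<in> \<A>"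
    unfolding B_def using c by (intro simple_superlevel[OF simple_abs[OF S]]) auto
  have "(1 - 2 * c) * l B = simple_integral l (\<lambda>x. (1 - 2 * c) * indicator B x)"
    using simple_integral_cmult[OF simple_indicator(1)[OF B]] simple_indicator(2)[OF B] by simp
  also have "\<dots> \<le> simple_integral l (\<lambda>x. \<bar>F n x\<bar>)"
    by (intro simple_integral_mono simple_cmult simple_indicator B simple_abs S)
      (auto simp: B_def indicator_def)
  finally have "(1 - 2 * c) * l B < (1 - 2 * c) * (I + 2 * e / 3)" using n bound by simp
  then have "l B < I + 2 * e / 3" using c by simp
  then have "l (A \<union> B) < \<I> f + e"
    using content_Un_le[OF A(1) B] A(3) e by (simp add: I_def)
  moreover have "E \<subseteq> A \<union> B"
  proof
    fix x assume "x \<in> E"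
    then have "1 \<le> f x" by (rule E)
    then show "x \<in> A \<union> B" using A(2) c by (force simp: B_def)
  qed
  ultimately show thesis using A(1) B that by blast
qed

text \<open>Lowering \<open>\<bar>F\<bar>\<close> by \<open>c\<close> and cutting off the set
  \<open>A\<close> where \<open>F\<close> is far from \<open>f\<close> produces a minorant. Taking
  the minimum with \<open>\<bar>F0\<bar>\<close> first confines the loss to \<open>c\<close> on
  \<open>S\<close> and \<open>M\<close> on \<open>A\<close>, up to the two approximation
  errors.\<close>

lemma L1_lower_approx:
  assumes f: "f \<in> L1 \<A> l" and nn: "\<And>x. 0 \<le> f x" and e: "0 < e"
  obtains G where "G \<in> simple_functions \<A>" "\<And>x. 0 \<le> G x" "\<And>x. G x \<le> f x" "\<I> f - e < \<I> G"
proof -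
  \<comment> \<open>The support and the bound of \<open>F0\<close> must be known before the closer approximation \<open>F\<close> is chosen.\<close>
  have "0 < e / 4" using e by simp
  then obtain F0 where F0: "F0 \<in> simple_functions \<A>" and F0e: "\<I> (\<lambda>x. \<bar>f x - F0 x\<bar>) < e / 4"
    using L1_simple_approx[OF f] by blast
  obtain M where M: "0 < M" "\<And>x. \<bar>F0 x\<bar> \<le> M" using simple_bounded[OF F0] by blast
  define S where "S = {x. F0 x \<noteq> 0}"
  have S: "S \<in> \<A>" unfolding S_def using F0 by (rule simple_support)
  define c where "c = e / (4 * (l S + 1))"
  have c: "0 < c" "c * l S < e / 4" using e content_nonneg[OF S] by (auto simp: c_def field_simps)
  \<comment> \<open>The first bound keeps the error of \<open>F\<close> below \<open>e / 4\<close>.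
    The second makes the Chebyshev estimate of \<open>l A\<close> at level \<open>c\<close> at most
    \<open>e / (4 * M)\<close>, so that \<open>M * l A\<close> is below
    \<open>e / 4\<close>.\<close>
  define d where "d = min (e / 4) (c * e / (8 * M))"
  have d: "0 < d" "d \<le> e / 4" "d \<le> c * e / (8 * M)"
    using c e M by (auto simp: d_def)
  from d(3) have "d / c \<le> e / (8 * M)"
    using c M by (simp add: field_simps)
  obtain F where F: "F \<in> simple_functions \<A>" and Fd: "\<I> (\<lambda>x. \<bar>f x - F x\<bar>) < d"
    using L1_simple_approx[OF f d(1)] by blast
  have dL: "(\<lambda>x. \<bar>f x - F x\<bar>) \<in> L1 \<A> l" "(\<lambda>x. \<bar>f x - F0 x\<bar>) \<in> L1 \<A> l"
    using F F0 f simple_L1 by (auto intro!: integral.abs_mem integral.diff_mem)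
  have "0 < e / (8 * M)" using e M by simp
  then obtain A where A: "A \<in> \<A>" "{x. c < \<bar>f x - F x\<bar>} \<subseteq> A"
    and "l A < \<I> (\<lambda>x. 1 / c * \<bar>f x - F x\<bar>) + e / (8 * M)"
    using L1_cover[OF integral.cmult_mem[OF dL(1), of "1 / c"], of "{x. c < \<bar>f x - F x\<bar>}"] c
    by (auto simp: field_simps)
  then have "l A < \<I> (\<lambda>x. \<bar>f x - F x\<bar>) / c + e / (8 * M)"
    using integral.J_cmult[OF dL(1), of "1 / c"] by simp
  also have "\<dots> < d / c + e / (8 * M)" using Fd c by (simp add: divide_strict_right_mono)
  also have "\<dots> \<le> e / (4 * M)" using \<open>d / c \<le> e / (8 * M)\<close> by (simp add: field_simps)
  finally have "M * l A < e / 4" using M by (simp add: field_simps)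
  define G where "G = (\<lambda>x. max 0 (min \<bar>F x\<bar> \<bar>F0 x\<bar> - c) * indicator (- A) x)"
  have "(\<lambda>x. max 0 (min \<bar>F x\<bar> \<bar>F0 x\<bar> - c)) \<in> simple_functions \<A>"
    using simple_comp2[OF F F0, of "\<lambda>y z. max 0 (min \<bar>y\<bar> \<bar>z\<bar> - c)"] c by simp
  then have "(\<lambda>x. max 0 (min \<bar>F x\<bar> \<bar>F0 x\<bar> - c) * (1 - indicator A x)) \<in> simple_functions \<A>"
    using simple_indicator(1)[OF A(1)] by (rule simple_comp2[where \<phi>="\<lambda>y z. y * (1 - z)"]) simp
  also have "(\<lambda>x. max 0 (min \<bar>F x\<bar> \<bar>F0 x\<bar> - c) * (1 - indicator A x)) = G"
    by (auto simp: G_def fun_eq_iff indicator_def)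
  finally have G: "G \<in> simple_functions \<A>" .
  have FA: "\<bar>f x - F x\<bar> \<le> c" if "x \<notin> A" for x using A(2) that by force
  have Gf: "G x \<le> f x" for x
    using FA[of x] nn[of x] by (auto simp: G_def indicator_def)
  note GL = simple_L1(1)[OF G]
  have fG: "f x \<le> G x + (\<bar>f x - F x\<bar> + (\<bar>f x - F0 x\<bar> + (c * indicator S x + M * indicator A x)))" for x
    using nn[of x] M(2)[of x] M(1) c(1)
    by (cases "x \<in> A"; cases "F0 x = 0") (auto simp: G_def S_def indicator_def max_def min_def)
  note iL = integral.linear_mem[OF L1_indicator[OF S] L1_indicator[OF A(1)], of c M]
  have "\<I> f \<le> \<I> (\<lambda>x. G x + (\<bar>f x - F x\<bar> + (\<bar>f x - F0 x\<bar> + (c * indicator S x + M * indicator A x))))"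
    using f fG by (intro integral.J_mono integral.add_mem GL dL iL)
  also have "\<dots> = \<I> G + (\<I> (\<lambda>x. \<bar>f x - F x\<bar>) + (\<I> (\<lambda>x. \<bar>f x - F0 x\<bar>) + (c * l S + M * l A)))"
    using integral.J_linear[OF L1_indicator[OF S] L1_indicator[OF A(1)], of c M]
    by (simp only: integral.J_add integral.add_mem GL dL iL integral_indicator S A)
  finally have "\<I> f - e < \<I> G"
    using Fd F0e d(2) c(2) \<open>M * l A < e / 4\<close> by simp
  moreover have "0 \<le> G x" for x by (simp add: G_def)
  ultimately show thesis using G Gf that by blast
qed

end

section \<open>Representation of a complete Stonean lattice functional by a content\<close>

text \<open>Completeness under squeezing is what brings sets into the ring: superlevel sets at
  continuity points in \<open>countable_bad_levels\<close>, and the sets of the completion in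
  \<open>completion_pull\<close>.\<close>

locale complete_stone_functional = stone_functional +
  assumes sandwich_mem: "(\<And>e. 0 < e \<Longrightarrow>
    \<exists>g\<in>V. \<exists>h\<in>V. (\<forall>x. g x \<le> f x \<and> f x \<le> h x) \<and> J h - J g < e) \<Longrightarrow> f \<in> V"
begin

definition \<R> :: "'a set set" where "\<R> = {E. indicator E \<in> V}"

definition \<mu> :: "'a set \<Rightarrow> real" where "\<mu> E = J (indicator E)"

lemma indicator_mem: "E \<in> \<R> \<Longrightarrow> indicator E \<in> V"
  by (simp add: \<R>_def)

lemma measure_structure_\<R>: "measure_structure \<R> \<mu>"
  unfolding measure_structure_def
proof (intro conjI ballI)
  show "ring_of_sets UNIV \<R>"
    unfolding ring_of_sets_iff
  proof (intro conjI ballI)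
    have "indicator {} = (\<lambda>x::'a. 0 :: real)" by auto
    then show "{} \<in> \<R>" using zero_mem by (simp add: \<R>_def)
    fix A B assume AB: "A \<in> \<R>" "B \<in> \<R>"
    have "indicator (A \<union> B) = (\<lambda>x. max (indicator A x) (indicator B x :: real))"
      by (auto simp: fun_eq_iff indicator_def)
    then show "A \<union> B \<in> \<R>"
      using AB max_mem[of "indicator A" "indicator B"] by (simp add: \<R>_def)
    have "indicator (A - B) = (\<lambda>x. indicator A x - min (indicator A x) (indicator B x :: real))"
      by (auto simp: fun_eq_iff indicator_def)
    then show "A - B \<in> \<R>"
      using AB by (simp add: \<R>_def diff_mem min_mem)
  qed auto
  show "0 \<le> \<mu> A" if "A \<in> \<R>" for A
    unfolding \<mu>_def using indicator_mem[OF that] by (rule J_nonneg) auto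
  show "additive \<R> \<mu>"
    unfolding additive_def
  proof (intro ballI impI)
    fix A B assume AB: "A \<in> \<R>" "B \<in> \<R>" "A \<inter> B = {}"
    have "indicator (A \<union> B) = (\<lambda>x. indicator A x + (indicator B x :: real))"
      using AB(3) by (auto simp: fun_eq_iff indicator_def)
    then show "\<mu> (A \<union> B) = \<mu> A + \<mu> B"
      using AB by (simp add: \<mu>_def J_add indicator_mem)
  qed
qed

sublocale content \<R> \<mu>
  using measure_structure_\<R> by unfold_locales

lemma simple_integral_eq_J:
  assumes f: "f \<in> simple_functions \<R>"
  shows "f \<in> V" and "simple_integral \<mu> f = J f"
proof -
  have fin: "finite (range f)" and R: "\<And>y. y \<noteq> 0 \<Longrightarrow> f -` {y} \<in> \<R>"
    using f by (auto simp: simple_functions_iff step_def)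
  have "(\<Sum>y\<in>range f - {0}. y * indicator (f -` {y}) x) = f x" for x
  proof -
    have "(\<Sum>y\<in>range f - {0}. y * indicator (f -` {y}) x) = (\<Sum>y\<in>range f - {0}. if y = f x then y else 0)"
      by (intro sum.cong) (auto simp: indicator_def)
    also have "\<dots> = f x" using fin by (simp add: sum.delta')
    finally show ?thesis .
  qed
  then have eq: "f = (\<lambda>x. \<Sum>y\<in>range f - {0}. y * indicator (f -` {y}) x)" by simp
  show "f \<in> V"
    by (subst eq, rule sum_mem) (auto simp: fin R intro!: indicator_mem)
  have "J f = (\<Sum>y\<in>range f - {0}. y * \<mu> (f -` {y}))"
    unfolding \<mu>_def by (subst eq, rule J_sum) (auto simp: fin R intro!: indicator_mem)
  also have "\<dots> = simple_integral \<mu> f"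
    unfolding simple_integral_def using fin by (intro sum.mono_neutral_left) auto
  finally show "simple_integral \<mu> f = J f" by simp
qed

text \<open>\<open>U t\<close> is the upper integral of the indicator of the superlevel set at
  \<open>t\<close>. It decreases in \<open>t\<close>, so it has only countably many discontinuities.
  At a continuity point the superlevel set is squeezed between a ramp from below and a near-optimal
  majorant from above.\<close>

lemma countable_bad_levels:
  assumes g: "g \<in> V" and nn: "\<And>x. 0 \<le> g x"
  shows "countable {t\<in>{0<..}. {x. t < g x} \<notin> \<R>}"
proof -
  define D where "D t = {f\<in>V. \<forall>x. indicator {x. t < g x} x \<le> f x}" for t
  define U where "U t = (INF f\<in>D t. J f)" for t
  have D0: "(\<lambda>x. 1 / t * g x) \<in> D t" if "0 < t" for t
    using that nn cmult_mem[OF g, of "1 / t"] by (auto simp: D_def indicator_def)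
  have bdd: "bdd_below (J ` D t)" for t
  proof (rule bdd_belowI2)
    fix f assume f: "f \<in> D t"
    have "0 \<le> f x" for x
      using f by (auto simp: D_def intro: order_trans[OF indicator_pos_le])
    with f show "0 \<le> J f" by (intro J_nonneg) (auto simp: D_def)
  qed
  have antimono: "U t \<le> U s" if "0 < s" "s \<le> t" for s t
  proof -
    have "indicator {x. t < g x} x \<le> (indicator {x. s < g x} x :: real)" for x
      using that by (auto simp: indicator_def)
    then have "D s \<subseteq> D t" by (auto simp: D_def intro: order_trans)
    then show ?thesis
      unfolding U_def using D0[OF that(1)] bdd by (intro cINF_superset_mono) auto
  qed
  have mem: "{x. s < g x} \<in> \<R>" if s: "0 < s" and cont: "isCont (\<lambda>t. - U t) s" for s
    unfolding \<R>_def mem_Collect_eq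
  proof (rule sandwich_mem)
    fix e :: real assume e: "0 < e"
    have "isCont U s" using isCont_minus[OF cont] by simp
    then obtain d where d: "0 < d" "\<And>t. \<bar>t - s\<bar> < d \<Longrightarrow> \<bar>U t - U s\<bar> < e / 2"
      using e unfolding continuous_at_eps_delta dist_real_def by (metis half_gt_zero)
    define t where "t = s + d / 2"
    have t: "s < t" "0 < t" "U s - e / 2 < U t"
      using d(1) d(2)[of t] s unfolding t_def by (linarith | simp)+
    \<comment> \<open>This ramp is 0 where \<open>g x \<le> s\<close> and 1 where
      \<open>g x \<ge> t\<close>. It lies between the indicators of the two superlevel sets, so
      \<open>J q\<close> is at least \<open>U t\<close>, which by continuity is close to
      \<open>U s\<close>.\<close>
    define q where "q x = 1 / (t - s) * (min (g x) t - min (g x) s)" for x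
    have q: "q \<in> V" unfolding q_def using g s t by (intro cmult_mem diff_mem min_const_mem) auto
    have "indicator {x. t < g x} x \<le> q x" for x
      using t by (auto simp: q_def indicator_def)
    with q have "q \<in> D t" by (auto simp: D_def)
    then have "U t \<le> J q" unfolding U_def by (rule cINF_lower[OF bdd])
    have qs: "q x \<le> indicator {x. s < g x} x" for x
      using t by (auto simp: q_def indicator_def field_simps)
    have "\<exists>f\<in>D s. J f < U s + e / 2"
    proof -
      have "Inf (J ` D s) < U s + e / 2" using e by (simp add: U_def)
      from cInf_lessD[OF _ this] show ?thesis using D0[OF s] by auto
    qed
    then obtain f where f: "f \<in> V" "\<And>x. indicator {x. s < g x} x \<le> f x" "J f < U s + e / 2"
      by (auto simp: D_def)
    show "\<exists>g'\<in>V. \<exists>h\<in>V. (\<forall>x. g' x \<le> indicator {x. s < g x} x \<and> indicator {x. s < g x} x \<le> h x) \<and> J h - J g' < e"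
      using q f qs \<open>U t \<le> J q\<close> t(3) by (intro bexI[of _ q] bexI[of _ f]) auto
  qed
  \<comment> \<open>The countability result concerns increasing functions, hence the sign change of
    \<open>U\<close>.\<close>
  have "countable {t\<in>{0<..}. \<not> isCont (\<lambda>t. - U t) t}"
    by (rule mono_on_ctble_discont_open) (auto simp: mono_on_def antimono)
  then show ?thesis
    by (rule countable_subset[rotated]) (use mem in auto)
qed

lemma good_level:
  assumes "g \<in> V" and "\<And>x. 0 \<le> g x" and "0 \<le> a" "a < b"
  obtains t where "a < t" "t < b" "{x. t < g x} \<in> \<R>"
proof -
  have "uncountable ({a<..<b} - {t\<in>{0<..}. {x. t < g x} \<notin> \<R>})" (is "uncountable ?U")
    using countable_bad_levels[OF assms(1,2)] \<open>a < b\<close>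
    by (intro uncountable_minus_countable) (simp_all add: uncountable_open_interval)
  then have "?U \<noteq> {}" by (rule contrapos_nn) (simp only: countable_empty)
  then obtain t where "t \<in> ?U" by blast
  with assms(3) that show thesis by auto
qed

text \<open>\<open>d\<close> has to avoid all quotients of bad levels by natural numbers, which form
  a countable set. The divisor 0 contributes at most the point 0, which is outside the
  interval.\<close>

lemma good_mesh:
  assumes "g \<in> V" and "\<And>x. 0 \<le> g x" and "0 < b"
  obtains d where "0 < d" "d < b" "\<And>k. 0 < k \<Longrightarrow> {x. real k * d < g x} \<in> \<R>"
proof -
  let ?B = "{t\<in>{0<..}. {x. t < g x} \<notin> \<R>}"
  have "uncountable ({0<..<b} - (\<Union>k. (\<lambda>t. t / real k) ` ?B))"
      (is "uncountable ?U")
    using countable_bad_levels[OF assms(1,2)] \<open>0 < b\<close>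
    by (intro uncountable_minus_countable countable_UN countable_image)
      (simp_all add: uncountable_open_interval)
  then have "?U \<noteq> {}" by (rule contrapos_nn) (simp only: countable_empty)
  then obtain d where d: "d \<in> ?U" by blast
  have "{x. real k * d < g x} \<in> \<R>" if "0 < k" for k
  proof (rule ccontr)
    assume "{x. real k * d < g x} \<notin> \<R>"
    then have "real k * d \<in> ?B" using d that by auto
    then have "real k * d / real k \<in> (\<lambda>t. t / real k) ` ?B" by blast
    with d that show False by auto
  qed
  with d that show thesis by auto
qed

lemma staircase_bounds:
  fixes y d :: real
  assumes "0 \<le> y" "0 < d"
  shows "(\<Sum>k\<in>{1..K}. d * of_bool (real k * d < y)) \<le> y"
    and "min y (real K * d) - (\<Sum>k\<in>{1..K}. d * of_bool (real k * d < y)) \<le> min y d"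
proof -
  let ?F = "\<lambda>K. \<Sum>k\<in>{1..K}. d * of_bool (real k * d < y)"
  \<comment> \<open>The middle conjunct strengthens the induction hypothesis: while \<open>y\<close>
    exceeds \<open>real K * d\<close>, every step so far has been counted, so the staircase value is
    known exactly.\<close>
  have "?F K \<le> y \<and> (real K * d < y \<longrightarrow> ?F K = real K * d) \<and> min y (real K * d) - ?F K \<le> min y d"
  proof (induction K)
    case 0
    then show ?case using assms by simp
  next
    case (Suc K)
    have lt: "real K * d < real (Suc K) * d" and eq: "real (Suc K) * d = real K * d + d"
      using assms by (simp_all add: distrib_right)
    have F: "?F (Suc K) = ?F K + d * of_bool (real (Suc K) * d < y)" by simp
    show ?case
    proof (cases "real (Suc K) * d < y")
      case True
      with Suc lt have "?F K = real K * d" by simp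
      with F True eq have "?F (Suc K) = real (Suc K) * d" by simp
      with True assms show ?thesis by simp
    next
      case False
      with F have "?F (Suc K) = ?F K" by simp
      moreover have "y - ?F K \<le> min y d"
        using Suc False eq assms by (cases "real K * d < y") auto
      ultimately show ?thesis using Suc False by (simp add: min_absorb1)
    qed
  qed
  then show "?F K \<le> y" "min y (real K * d) - ?F K \<le> min y d" by blast+
qed

text \<open>A staircase with mesh \<open>d\<close> and \<open>K\<close> steps misses
  \<open>g\<close> by at most the part of \<open>g\<close> above \<open>real K * d\<close> plus the
  truncation of \<open>g\<close> at \<open>d\<close>. The two truncation laws make these losses
  small separately.\<close>

lemma simple_approx_nonneg:
  assumes g: "g \<in> V" and nn: "\<And>x. 0 \<le> g x" and e: "0 < e"
  obtains F where "F \<in> simple_functions \<R>" "J (\<lambda>x. \<bar>g x - F x\<bar>) < e"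
proof -
  obtain M where M: "0 < M" "J g - J (\<lambda>x. min (g x) M) < e / 2"
    using J_truncate_above[OF g nn, of "e / 2"] e by auto
  obtain b where b: "0 < b" "J (\<lambda>x. min (g x) b) < e / 2"
    using J_truncate_below[OF g nn, of "e / 2"] e by auto
  obtain d where d: "0 < d" "d < b" "\<And>k. 0 < k \<Longrightarrow> {x. real k * d < g x} \<in> \<R>"
    using good_mesh[OF g nn b(1)] by blast
  obtain K where "M / d \<le> real K" using real_arch_simple by blast
  then have K: "M \<le> real K * d" using d by (simp add: field_simps)
  with M have K0: "0 < real K * d" by simp
  define F where "F x = (\<Sum>k\<in>{1..K}. d * indicator {x. real k * d < g x} x)" for x
  have F_eq: "F x = (\<Sum>k\<in>{1..K}. d * of_bool (real k * d < g x))" for x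
    by (simp add: F_def indicator_def)
  have "F \<in> V" unfolding F_def using d by (intro sum_mem indicator_mem) auto
  have F: "F \<in> simple_functions \<R>"
  proof -
    have "(\<lambda>x. \<Sum>k\<in>S. d * indicator {x. real k * d < g x} x) \<in> simple_functions \<R>"
      if "finite S" "S \<subseteq> {1..K}" for S
      using that
    proof (induction S rule: finite_induct)
      case empty
      then show ?case by (auto simp: simple_functions_def intro!: exI[of _ "{}"])
    next
      case (insert k S)
      have "(\<lambda>x. d * indicator {x. real k * d < g x} x + (\<Sum>k\<in>S. d * indicator {x. real k * d < g x} x))
          \<in> simple_functions \<R>"
        using insert d(3)[of k] by (intro simple_add simple_cmult simple_indicator) auto
      then show ?case by (simp only: sum.insert[OF insert.hyps(1,2)])
    qed
    from this[of "{1..K}"] show ?thesis by (simp add: F_def[abs_def])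
  qed
  have "J (\<lambda>x. \<bar>g x - F x\<bar>) \<le> J (\<lambda>x. (g x - min (g x) (real K * d)) + min (g x) d)"
  proof (intro J_mono abs_mem diff_mem add_mem min_const_mem g \<open>F \<in> V\<close> K0 d(1))
    fix x
    show "\<bar>g x - F x\<bar> \<le> g x - min (g x) (real K * d) + min (g x) d"
      using staircase_bounds[OF nn[of x] d(1), of K] unfolding F_eq by linarith
  qed
  also have "\<dots> = (J g - J (\<lambda>x. min (g x) (real K * d))) + J (\<lambda>x. min (g x) d)"
    by (simp add: J_add J_diff diff_mem min_const_mem g K0 d(1))
  also have "\<dots> \<le> (J g - J (\<lambda>x. min (g x) M)) + J (\<lambda>x. min (g x) b)"
    using K d(2)
    by (intro add_mono diff_mono order_refl J_mono min_const_mem g K0 M(1) d(1) b(1)) auto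
  also have "\<dots> < e" using M b by simp
  finally have "J (\<lambda>x. \<bar>g x - F x\<bar>) < e" .
  with F show thesis by (rule that)
qed

lemma simple_approx:
  assumes g: "g \<in> V" and e: "0 < e"
  obtains F where "F \<in> simple_functions \<R>" "J (\<lambda>x. \<bar>g x - F x\<bar>) < e"
proof -
  let ?p = "\<lambda>x. max (g x) 0" and ?n = "\<lambda>x. max (- g x) 0"
  have pn: "?p \<in> V" "?n \<in> V" using g zero_mem by (auto intro!: max_mem uminus_mem)
  obtain P where P: "P \<in> simple_functions \<R>" "J (\<lambda>x. \<bar>?p x - P x\<bar>) < e / 2"
    using simple_approx_nonneg[OF pn(1), of "e / 2"] e by auto
  obtain N where N: "N \<in> simple_functions \<R>" "J (\<lambda>x. \<bar>?n x - N x\<bar>) < e / 2"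
    using simple_approx_nonneg[OF pn(2), of "e / 2"] e by auto
  note V = simple_integral_eq_J(1)[OF P(1)] simple_integral_eq_J(1)[OF N(1)]
  have m: "(\<lambda>x. \<bar>?p x - P x\<bar>) \<in> V" "(\<lambda>x. \<bar>?n x - N x\<bar>) \<in> V"
    using pn V by (intro abs_mem diff_mem; simp)+
  have "J (\<lambda>x. \<bar>g x - (P x - N x)\<bar>) \<le> J (\<lambda>x. \<bar>?p x - P x\<bar> + \<bar>?n x - N x\<bar>)"
    by (intro J_mono abs_mem add_mem diff_mem g V m) auto
  also have "\<dots> < e" using J_add[OF m] P N by simp
  finally show thesis using simple_minus[OF P(1) N(1)] that by blast
qed

text \<open>Simple functions converging to \<open>g\<close> in the seminorm given by
  \<open>J\<close> form a defining sequence: the triangle inequality gives the Cauchy property, and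
  a Chebyshev estimate gives convergence in content.\<close>

theorem integral_eq_J:
  assumes g: "g \<in> V"
  shows "g \<in> L1 \<R> \<mu>" and "content_integral \<R> \<mu> g = J g"
proof -
  have "\<exists>F. F \<in> simple_functions \<R> \<and> J (\<lambda>x. \<bar>g x - F x\<bar>) < 1 / real (Suc n)" for n
    using simple_approx[OF g, of "1 / real (Suc n)"] by (metis divide_pos_pos of_nat_0_less_iff zero_less_Suc zero_less_one)
  then obtain F where F: "\<And>n. F n \<in> simple_functions \<R>"
    and Fg: "\<And>n. J (\<lambda>x. \<bar>g x - F n x\<bar>) < 1 / real (Suc n)" by metis
  note FV = simple_integral_eq_J(1)[OF F]
  have absV: "(\<lambda>x. \<bar>g x - F n x\<bar>) \<in> V" for n using g FV by (intro abs_mem diff_mem)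
  have lim: "(\<lambda>n. J (\<lambda>x. \<bar>g x - F n x\<bar>)) \<longlonglongrightarrow> 0"
  proof (rule tendsto_sandwich)
    show "\<forall>\<^sub>F n in sequentially. 0 \<le> J (\<lambda>x. \<bar>g x - F n x\<bar>)"
      using absV by (intro always_eventually allI J_nonneg) auto
    show "\<forall>\<^sub>F n in sequentially. J (\<lambda>x. \<bar>g x - F n x\<bar>) \<le> 1 / real (Suc n)"
      using Fg by (intro always_eventually) (auto intro: less_imp_le)
    show "(\<lambda>n. 1 / real (Suc n)) \<longlonglongrightarrow> 0"
      using LIMSEQ_inverse_real_of_nat by (simp add: inverse_eq_divide)
  qed simp
  have def: "defining_sequence \<R> \<mu> F g"
  proof (rule defining_sequenceI[OF F])
    fix c e :: real assume c: "0 < c" and e: "0 < e"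
    have "\<forall>\<^sub>F n in sequentially. J (\<lambda>x. \<bar>g x - F n x\<bar>) < c / 2 * e"
      using order_tendstoD(2)[OF lim, of "c / 2 * e"] c e by simp
    then show "\<forall>\<^sub>F n in sequentially. \<exists>A\<in>\<R>. {x. \<bar>F n x - g x\<bar> > c} \<subseteq> A \<and> \<mu> A < e"
    proof eventually_elim
      case (elim n)
      let ?h = "\<lambda>x. \<bar>g x - F n x\<bar>"
      \<comment> \<open>The superlevel set at \<open>c\<close> itself may lie outside the ring, so
        it is covered by the one at a good level just below. Since \<open>t\<close> exceeds
        \<open>c / 2\<close>, the Chebyshev factor is at most \<open>2 / c\<close>.\<close>
      obtain t where t: "c / 2 < t" "t < c" "{x. t < ?h x} \<in> \<R>"
        using good_level[OF absV[of n], of "c / 2" c] c by auto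
      have "\<mu> {x. t < ?h x} \<le> J (\<lambda>x. 2 / c * ?h x)"
        unfolding \<mu>_def using t c
        by (intro J_mono indicator_mem cmult_mem absV) (auto simp: indicator_def field_simps)
      also have "\<dots> = 2 / c * J ?h" by (rule J_cmult[OF absV])
      also have "\<dots> < e" using elim c by (simp add: field_simps)
      finally show ?case using t by (intro bexI[of _ "{x. t < ?h x}"]) (auto simp: abs_minus_commute)
    qed
  next
    fix e :: real assume e: "0 < e"
    then have "\<forall>\<^sub>F n in sequentially. J (\<lambda>x. \<bar>g x - F n x\<bar>) < e / 2"
      using order_tendstoD(2)[OF lim, of "e / 2"] by simp
    then obtain n0 where n0: "\<And>n. n0 \<le> n \<Longrightarrow> J (\<lambda>x. \<bar>g x - F n x\<bar>) < e / 2"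
      by (auto simp: eventually_sequentially)
    have "simple_integral \<mu> (\<lambda>x. \<bar>F n x - F k x\<bar>) < e" if "n0 \<le> n" "n0 \<le> k" for n k
    proof -
      have "simple_integral \<mu> (\<lambda>x. \<bar>F n x - F k x\<bar>) = J (\<lambda>x. \<bar>F n x - F k x\<bar>)"
        by (intro simple_integral_eq_J simple_abs_diff F)
      also have "\<dots> \<le> J (\<lambda>x. \<bar>g x - F n x\<bar> + \<bar>g x - F k x\<bar>)"
        by (intro J_mono abs_mem diff_mem add_mem FV absV g) auto
      also have "\<dots> < e" using n0[of n] n0[of k] that by (simp add: J_add absV)
      finally show ?thesis .
    qed
    then show "\<exists>n0. \<forall>n\<ge>n0. \<forall>k\<ge>n0. simple_integral \<mu> (\<lambda>x. \<bar>F n x - F k x\<bar>) < e" by blast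
  qed
  then show "g \<in> L1 \<R> \<mu>" by (auto simp: L1_def)
  have "(\<lambda>n. simple_integral \<mu> (F n) - J g) \<longlonglongrightarrow> 0"
  proof (rule Lim_null_comparison[OF _ lim], intro always_eventually allI)
    fix n
    show "norm (simple_integral \<mu> (F n) - J g) \<le> J (\<lambda>x. \<bar>g x - F n x\<bar>)"
      using abs_J_le[OF diff_mem[OF g FV[of n]]]
      by (simp add: simple_integral_eq_J(2)[OF F] J_diff g FV abs_minus_commute)
  qed
  with defining_sequence_integral[OF def] show "content_integral \<R> \<mu> g = J g"
    by (simp add: LIM_zero_iff LIMSEQ_unique)
qed

end

section \<open>Transport of a functional modulo an ideal\<close>

primrec running_min :: "(nat \<Rightarrow> 'x \<Rightarrow> real) \<Rightarrow> nat \<Rightarrow> 'x \<Rightarrow> real" where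
  "running_min b 0 = b 0"
| "running_min b (Suc n) = (\<lambda>x. min (running_min b n x) (b (Suc n) x))"

lemma running_min_le: "running_min b n x \<le> b n x"
  by (cases n) auto

lemma running_min_antimono: "i \<le> n \<Longrightarrow> running_min b n x \<le> running_min b i x"
  by (induction n rule: dec_induct) auto

lemma running_min_nonneg: "(\<And>n. 0 \<le> b n x) \<Longrightarrow> 0 \<le> running_min b n x"
  by (induction n) auto

lemma (in stone_functional) running_min_mem: "(\<And>n. b n \<in> V) \<Longrightarrow> running_min b n \<in> V"
  by (induction n) (auto intro: min_mem)

text \<open>Taking the minimum with a new minorant loses at most the sum of the old loss and the new
  gap, because \<open>a\<close> decreases. With geometric gaps the total loss stays below
  \<open>e\<close> for all \<open>n\<close>.\<close>

lemma (in stone_functional) J_running_min: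
  assumes a: "\<And>n. a n \<in> V" and b: "\<And>n. b n \<in> V" and le: "\<And>n x. b n x \<le> a n x"
    and dec: "\<And>n x. a (Suc n) x \<le> a n x"
    and gap: "\<And>n. J (a n) - J (b n) \<le> e * (1/2) ^ Suc n"
  shows "J (a n) - J (running_min b n) \<le> e * (1 - (1/2) ^ Suc n)"
proof (induction n)
  case 0
  then show ?case using gap[of 0] by simp
next
  case (Suc n)
  let ?B = "running_min b"
  note B = running_min_mem[of b, OF b]
  have "J (a (Suc n)) - J (?B (Suc n)) = J (\<lambda>x. a (Suc n) x - ?B (Suc n) x)"
    using a B by (simp only: J_diff)
  also have "\<dots> \<le> J (\<lambda>x. (a n x - ?B n x) + (a (Suc n) x - b (Suc n) x))"
  proof (intro J_mono diff_mem add_mem a b B)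
    show "a (Suc n) x - ?B (Suc n) x \<le> (a n x - ?B n x) + (a (Suc n) x - b (Suc n) x)" for x
      using dec[of n x] le[of "Suc n" x] le[of n x] running_min_le[of b n x] by auto
  qed
  also have "\<dots> = (J (a n) - J (?B n)) + (J (a (Suc n)) - J (b (Suc n)))"
    by (simp only: J_add J_diff diff_mem a b B)
  also have "\<dots> \<le> e * (1 - (1/2) ^ Suc n) + e * (1/2) ^ Suc (Suc n)"
    using Suc gap[of "Suc n"] by (intro add_mono)
  also have "\<dots> = e * (1 - (1/2) ^ Suc (Suc n))" by (simp add: field_simps)
  finally show ?case .
qed

text \<open>\<open>I_nonneg_mod\<close>, applied to a difference and its negative, shows that
  \<open>I h\<close> depends only on \<open>h \<circ> X'\<close> modulo \<open>\<N>\<close>. This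
  makes a functional on \<open>'b\<close> well defined although \<open>X'\<close> need not be
  onto.\<close>

locale pullback_functional = stone_functional L I
  for L :: "('s \<Rightarrow> real) set" and I :: "('s \<Rightarrow> real) \<Rightarrow> real" +
  fixes X' :: "'b \<Rightarrow> 's" and \<N> :: "'b set set"
  assumes ideal: "set_ideal \<N>"
    and I_nonneg_mod: "h \<in> L \<Longrightarrow> N \<in> \<N> \<Longrightarrow> (\<And>w. w \<notin> N \<Longrightarrow> 0 \<le> h (X' w)) \<Longrightarrow> 0 \<le> I h"
begin

lemma ideal_Un: "M \<in> \<N> \<Longrightarrow> N \<in> \<N> \<Longrightarrow> M \<union> N \<in> \<N>"
  using ideal by (auto simp: set_ideal_def)

lemma empty_ideal: "{} \<in> \<N>"
  using ideal by (auto simp: set_ideal_def)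

lemma I_mono_mod:
  "g \<in> L \<Longrightarrow> h \<in> L \<Longrightarrow> N \<in> \<N> \<Longrightarrow> (\<And>w. w \<notin> N \<Longrightarrow> g (X' w) \<le> h (X' w)) \<Longrightarrow> I g \<le> I h"
  using I_nonneg_mod[of "\<lambda>s. h s - g s" N] by (simp add: diff_mem J_diff)

text \<open>
  Approximation by one function with an error bound, instead of squeezing between two functions:
  this form passes through linear and lattice operations without case distinctions on signs.
\<close>

definition approx :: "('b \<Rightarrow> real) \<Rightarrow> ('s \<Rightarrow> real) \<Rightarrow> ('s \<Rightarrow> real) \<Rightarrow> bool" where
  "approx f g k \<longleftrightarrow> g \<in> L \<and> k \<in> L \<and> (\<exists>N\<in>\<N>. \<forall>w. w \<notin> N \<longrightarrow> \<bar>f w - g (X' w)\<bar> \<le> k (X' w))"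

definition V :: "('b \<Rightarrow> real) set" where
  "V = {f. \<forall>e>0. \<exists>g k. approx f g k \<and> I k < e}"

text \<open>Defining the value as the supremum of the lower estimates avoids choosing approximating
  sequences. By \<open>approx_le\<close> each lower estimate is below each upper estimate
  \<open>I g + I k\<close>, so one approximation makes the supremum finite.\<close>

definition J :: "('b \<Rightarrow> real) \<Rightarrow> real" where
  "J f = (SUP (g, k)\<in>{(g, k). approx f g k}. I g - I k)"

lemma approxI: "g \<in> L \<Longrightarrow> k \<in> L \<Longrightarrow> N \<in> \<N> \<Longrightarrow>
    (\<And>w. w \<notin> N \<Longrightarrow> \<bar>f w - g (X' w)\<bar> \<le> k (X' w)) \<Longrightarrow> approx f g k"
  by (auto simp: approx_def)

text \<open>The exceptional sets are united here once and for all; each later closure property is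
  left with an inequality between numbers.\<close>

lemma approx_combine:
  assumes "approx f g k" "approx f' g' k'" "G \<in> L" "K \<in> L"
    and "\<And>w. \<bar>f w - g (X' w)\<bar> \<le> k (X' w) \<Longrightarrow> \<bar>f' w - g' (X' w)\<bar> \<le> k' (X' w) \<Longrightarrow>
      \<bar>F w - G (X' w)\<bar> \<le> K (X' w)"
  shows "approx F G K"
proof -
  obtain N N' where "N \<in> \<N>" "\<And>w. w \<notin> N \<Longrightarrow> \<bar>f w - g (X' w)\<bar> \<le> k (X' w)"
    and "N' \<in> \<N>" "\<And>w. w \<notin> N' \<Longrightarrow> \<bar>f' w - g' (X' w)\<bar> \<le> k' (X' w)"
    using assms(1,2) by (auto simp: approx_def)
  with assms(3-) show ?thesis
    by (intro approxI[where N="N \<union> N'"]) (auto intro: ideal_Un)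
qed

text \<open>With \<open>f = f'\<close> this compares lower with upper estimates of the same
  function; with \<open>f = 0\<close> it yields positivity of \<open>J\<close>.\<close>

lemma approx_le:
  assumes "approx f g k" "approx f' g' k'" and le: "\<And>w. f w \<le> f' w"
  shows "I g - I k \<le> I g' + I k'"
proof -
  obtain N N' where N: "N \<in> \<N>" "\<And>w. w \<notin> N \<Longrightarrow> \<bar>f w - g (X' w)\<bar> \<le> k (X' w)"
    and N': "N' \<in> \<N>" "\<And>w. w \<notin> N' \<Longrightarrow> \<bar>f' w - g' (X' w)\<bar> \<le> k' (X' w)"
    using assms(1,2) by (auto simp: approx_def)
  have L: "g \<in> L" "k \<in> L" "g' \<in> L" "k' \<in> L" using assms(1,2) by (auto simp: approx_def)
  have "I (\<lambda>s. g s - k s) \<le> I (\<lambda>s. g' s + k' s)"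
  proof (rule I_mono_mod[OF _ _ ideal_Un[OF N(1) N'(1)]])
    fix w assume "w \<notin> N \<union> N'"
    then show "g (X' w) - k (X' w) \<le> g' (X' w) + k' (X' w)"
      using N(2)[of w] N'(2)[of w] le[of w] by auto
  qed (auto intro: diff_mem add_mem L)
  then show ?thesis by (simp add: J_diff J_add L)
qed

lemma J_bounds:
  assumes "approx f g k"
  shows "\<bar>J f - I g\<bar> \<le> I k"
proof -
  have "bdd_above ((\<lambda>(g, k). I g - I k) ` {(g, k). approx f g k})"
    using approx_le[OF _ assms] by (intro bdd_aboveI2[where M="I g + I k"]) auto
  then have "I g - I k \<le> J f"
    unfolding J_def using assms by (intro cSUP_upper2[where x="(g, k)"]) auto
  moreover have "J f \<le> I g + I k"
    unfolding J_def using assms approx_le[OF _ assms] by (intro cSUP_least) auto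
  ultimately show ?thesis by (simp add: abs_le_iff)
qed

lemma V_approx:
  assumes "f \<in> V" "0 < e"
  obtains g k where "approx f g k" "I k < e" "g \<in> L" "k \<in> L"
proof -
  obtain g k where "approx f g k" "I k < e" using assms by (auto simp: V_def)
  with that show thesis by (auto simp: approx_def)
qed

lemma J_linear_V:
  assumes f: "f \<in> V" and f': "f' \<in> V"
  shows "(\<lambda>w. a * f w + b * f' w) \<in> V" and "J (\<lambda>w. a * f w + b * f' w) = a * J f + b * J f'"
proof -
  let ?F = "\<lambda>w. a * f w + b * f' w"
  have *: "\<exists>g k. approx ?F g k \<and> I k < e \<and> \<bar>I g - (a * J f + b * J f')\<bar> < e" if e: "0 < e" for e
  proof -
    \<comment> \<open>The summand 1 allows division when both coefficients vanish and makes the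
      final estimate strict.\<close>
    let ?c = "\<bar>a\<bar> + \<bar>b\<bar> + 1"
    have c: "0 < ?c" by simp
    then have ec: "0 < e / ?c" using e by simp
    obtain g k where gk: "approx f g k" "I k < e / ?c" "g \<in> L" "k \<in> L" using V_approx[OF f ec] .
    obtain g' k' where gk': "approx f' g' k'" "I k' < e / ?c" "g' \<in> L" "k' \<in> L" using V_approx[OF f' ec] .
    have "approx ?F (\<lambda>s. a * g s + b * g' s) (\<lambda>s. \<bar>a\<bar> * k s + \<bar>b\<bar> * k' s)"
    proof (rule approx_combine[OF gk(1) gk'(1)])
      fix w assume w: "\<bar>f w - g (X' w)\<bar> \<le> k (X' w)" "\<bar>f' w - g' (X' w)\<bar> \<le> k' (X' w)"
      have "\<bar>?F w - (a * g (X' w) + b * g' (X' w))\<bar> = \<bar>a * (f w - g (X' w)) + b * (f' w - g' (X' w))\<bar>"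
        by (simp add: algebra_simps)
      also have "\<dots> \<le> \<bar>a\<bar> * \<bar>f w - g (X' w)\<bar> + \<bar>b\<bar> * \<bar>f' w - g' (X' w)\<bar>"
        by (metis abs_mult abs_triangle_ineq)
      also have "\<dots> \<le> \<bar>a\<bar> * k (X' w) + \<bar>b\<bar> * k' (X' w)"
        using w by (intro add_mono mult_left_mono) auto
      finally show "\<bar>?F w - (a * g (X' w) + b * g' (X' w))\<bar> \<le> \<bar>a\<bar> * k (X' w) + \<bar>b\<bar> * k' (X' w)" .
    qed (auto intro: linear_mem gk gk')
    moreover have small: "\<bar>a\<bar> * I k + \<bar>b\<bar> * I k' < e"
    proof -
      have "\<bar>a\<bar> * I k + \<bar>b\<bar> * I k' \<le> \<bar>a\<bar> * (e / ?c) + \<bar>b\<bar> * (e / ?c)"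
        using gk gk' by (intro add_mono mult_left_mono) auto
      also have "\<dots> < ?c * (e / ?c)" unfolding distrib_right using ec by linarith
      finally show ?thesis using c by simp
    qed
    moreover have "\<bar>(a * I g + b * I g') - (a * J f + b * J f')\<bar> \<le> \<bar>a\<bar> * I k + \<bar>b\<bar> * I k'"
    proof -
      have "\<bar>(a * I g + b * I g') - (a * J f + b * J f')\<bar> = \<bar>a * (I g - J f) + b * (I g' - J f')\<bar>"
        by (simp add: algebra_simps)
      also have "\<dots> \<le> \<bar>a\<bar> * \<bar>I g - J f\<bar> + \<bar>b\<bar> * \<bar>I g' - J f'\<bar>"
        by (metis abs_mult abs_triangle_ineq)
      also have "\<dots> \<le> \<bar>a\<bar> * I k + \<bar>b\<bar> * I k'"
        using J_bounds[OF gk(1)] J_bounds[OF gk'(1)]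
        by (intro add_mono mult_left_mono) (auto simp: abs_minus_commute)
      finally show ?thesis .
    qed
    ultimately show ?thesis
      by (intro exI[of _ "\<lambda>s. a * g s + b * g' s"] exI[of _ "\<lambda>s. \<bar>a\<bar> * k s + \<bar>b\<bar> * k' s"])
        (use J_linear[OF gk(3) gk'(3)] J_linear[OF gk(4) gk'(4)] in auto)
  qed
  then show "?F \<in> V" unfolding V_def by blast
  have "\<bar>J ?F - (a * J f + b * J f')\<bar> \<le> 0 + e" if e: "0 < e" for e
  proof -
    have "0 < e / 2" using e by simp
    from *[OF this] obtain g k where gk: "approx ?F g k" "I k < e / 2"
      "\<bar>I g - (a * J f + b * J f')\<bar> < e / 2" by blast
    with J_bounds[OF gk(1)] show ?thesis by linarith
  qed
  then have "\<bar>J ?F - (a * J f + b * J f')\<bar> \<le> 0" by (rule field_le_epsilon)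
  then show "J ?F = a * J f + b * J f'" by simp
qed

lemma approx_min_const:
  assumes "approx f g k" "0 < t"
  shows "approx (\<lambda>w. min (f w) t) (\<lambda>s. min (g s) t) k"
  by (rule approx_combine[OF assms(1) assms(1)])
    (use assms in \<open>auto simp: approx_def intro: min_const_mem\<close>)

lemma approx_pullback:
  assumes "h \<in> L" "N \<in> \<N>" "\<And>w. w \<notin> N \<Longrightarrow> f w = h (X' w)"
  shows "approx f h (\<lambda>s. 0)"
  by (rule approxI[OF assms(1) zero_mem assms(2)]) (use assms(3) in simp)

lemma J_eq_of_approx_0:
  assumes "approx f h (\<lambda>s. 0)"
  shows "f \<in> V" and "J f = I h"
proof -
  show "f \<in> V"
    unfolding V_def
    by (intro CollectI allI impI exI[of _ h] exI[of _ "\<lambda>s. 0"]) (simp add: J_0 assms)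
  show "J f = I h" using J_bounds[OF assms] by (simp add: J_0)
qed

text \<open>The truncation laws of \<open>L\<close> require a function that is non-negative on all
  of \<open>'s\<close>, whereas the approximation controls \<open>g\<close> only at points
  \<open>X' w\<close> with \<open>w\<close> off a null set. The maximum with 0 repairs this at no
  cost in the error.\<close>

lemma approx_max_0:
  assumes "approx f g k" "\<And>w. 0 \<le> f w"
  shows "approx f (\<lambda>s. max (g s) 0) k"
proof (rule approx_combine[OF assms(1) assms(1)])
  show "(\<lambda>s. max (g s) 0) \<in> L" "k \<in> L"
    using assms(1) by (auto simp: approx_def intro: max_mem zero_mem)
  show "\<bar>f w - max (g (X' w)) 0\<bar> \<le> k (X' w)" if "\<bar>f w - g (X' w)\<bar> \<le> k (X' w)" for w
    using that assms(2)[of w] by auto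
qed

text \<open>The truncation laws are inherited because one error function \<open>k\<close> serves
  both \<open>f\<close> and its truncations (\<open>approx_min_const\<close>); hence
  \<open>J\<close> differs from \<open>I\<close> by at most \<open>I k\<close> at each
  place.\<close>

sublocale pull: complete_stone_functional V J
proof
  show "(\<lambda>w. 0) \<in> V"
    using J_eq_of_approx_0(1)[OF approx_pullback[OF zero_mem empty_ideal]] by simp
  show "(\<lambda>w. a * f w + b * f' w) \<in> V" "J (\<lambda>w. a * f w + b * f' w) = a * J f + b * J f'"
    if "f \<in> V" "f' \<in> V" for f f' a b
    using that by (rule J_linear_V)+
  show "(\<lambda>w. max (f w) (f' w)) \<in> V" if f: "f \<in> V" and f': "f' \<in> V" for f f'
    unfolding V_def
  proof safe
    fix e :: real assume "0 < e"
    then have e: "0 < e / 2" by simp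
    obtain g k where gk: "approx f g k" "I k < e / 2" "g \<in> L" "k \<in> L" using V_approx[OF f e] .
    obtain g' k' where gk': "approx f' g' k'" "I k' < e / 2" "g' \<in> L" "k' \<in> L" using V_approx[OF f' e] .
    have "approx (\<lambda>w. max (f w) (f' w)) (\<lambda>s. max (g s) (g' s)) (\<lambda>s. k s + k' s)"
      by (rule approx_combine[OF gk(1) gk'(1)]) (auto intro: max_mem add_mem gk gk')
    then show "\<exists>G K. approx (\<lambda>w. max (f w) (f' w)) G K \<and> I K < e"
      using gk gk' by (intro exI[of _ "\<lambda>s. max (g s) (g' s)"] exI[of _ "\<lambda>s. k s + k' s"])
        (simp add: J_add)
  qed
  show "(\<lambda>w. min (f w) 1) \<in> V" if "f \<in> V" for f
    using that approx_min_const[where t=1] unfolding V_def by fastforce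
  fix f assume f: "f \<in> V"
  {
    assume nn: "\<And>w. 0 \<le> f w"
    show "0 \<le> J f"
    proof (rule field_le_epsilon)
      fix e :: real assume "0 < e"
      then have "0 < e / 2" by simp
      from V_approx[OF f this] obtain g k where gk: "approx f g k" "I k < e / 2" by metis
      have "I (\<lambda>s. 0) - I (\<lambda>s. 0) \<le> I g + I k"
        by (rule approx_le[OF approx_pullback[OF zero_mem empty_ideal] gk(1)]) (use nn in auto)
      then show "0 \<le> J f + e" using J_bounds[OF gk(1)] gk(2) by (simp add: J_0 abs_le_iff)
    qed
    fix e :: real assume "0 < e"
    then have e: "0 < e / 4" by simp
    obtain g0 k where g0: "approx f g0 k" "I k < e / 4" using V_approx[OF f e] by metis
    define g where "g s = max (g0 s) 0" for s
    have g: "approx f g k" unfolding g_def using approx_max_0[OF g0(1) nn] .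
    have gL: "g \<in> L" and g_nn: "0 \<le> g s" for s
      using g by (auto simp: approx_def g_def)
    from J_truncate_above[OF gL g_nn e] obtain K where K: "0 < K" "I g - I (\<lambda>s. min (g s) K) < e / 4"
      by blast
    show "\<exists>K>0. J f - J (\<lambda>w. min (f w) K) < e"
      using J_bounds[OF g] J_bounds[OF approx_min_const[OF g K(1)]] K g0(2)
      by (intro exI[of _ K]) linarith
    from J_truncate_below[OF gL g_nn e] obtain d where d: "0 < d" "I (\<lambda>s. min (g s) d) < e / 4"
      by blast
    show "\<exists>d>0. J (\<lambda>w. min (f w) d) < e"
      using J_bounds[OF approx_min_const[OF g d(1)]] d g0(2) \<open>0 < e\<close>
      by (intro exI[of _ d]) linarith
  }
next
  fix f assume *: "\<And>e. 0 < e \<Longrightarrow> \<exists>u\<in>V. \<exists>v\<in>V. (\<forall>w. u w \<le> f w \<and> f w \<le> v w) \<and> J v - J u < e"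
  show "f \<in> V"
    unfolding V_def
  proof safe
    fix e :: real assume "0 < e"
    then have e: "0 < e / 10" by simp
    from *[OF this] obtain u v where uv: "u \<in> V" "v \<in> V" "\<And>w. u w \<le> f w" "\<And>w. f w \<le> v w"
      "J v - J u < e / 10" by blast
    obtain g k where gk: "approx u g k" "I k < e / 10" "g \<in> L" "k \<in> L" using V_approx[OF uv(1) e] .
    obtain h k' where hk: "approx v h k'" "I k' < e / 10" "h \<in> L" "k' \<in> L" using V_approx[OF uv(2) e] .
    \<comment> \<open>\<open>h - g\<close> majorizes \<open>f - g\<close> up to \<open>k'\<close>,
      but may itself be as low as \<open>- (k + k')\<close>; the multiple of \<open>k + k'\<close>
      absorbs both. In the budget of tenths, \<open>I h - I g\<close> takes three and the multiple
      takes six.\<close>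
    let ?K = "\<lambda>s. (h s - g s) + 3 * (k s + k' s)"
    have "approx f g ?K"
    proof (rule approx_combine[OF gk(1) hk(1) gk(3)])
      show "?K \<in> L" using gk hk by (intro add_mem diff_mem cmult_mem)
      show "\<bar>f w - g (X' w)\<bar> \<le> h (X' w) - g (X' w) + 3 * (k (X' w) + k' (X' w))"
        if "\<bar>u w - g (X' w)\<bar> \<le> k (X' w)" "\<bar>v w - h (X' w)\<bar> \<le> k' (X' w)" for w
        using that uv(3,4)[of w] by (simp add: abs_le_iff)
    qed
    moreover have "I ?K = (I h - I g) + 3 * (I k + I k')"
      using gk hk by (simp only: J_add J_diff J_cmult add_mem diff_mem cmult_mem)
    moreover have "(I h - I g) + 3 * (I k + I k') < e"
      using J_bounds[OF gk(1)] J_bounds[OF hk(1)] gk(2) hk(2) uv(5) \<open>0 < e\<close>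
      by (simp add: abs_le_iff)
    ultimately show "\<exists>g k. approx f g k \<and> I k < e" by (intro exI[of _ g] exI[of _ ?K]) simp
  qed
qed

lemma pullback_mem: "h \<in> L \<Longrightarrow> h \<circ> X' \<in> V"
  and J_pullback: "h \<in> L \<Longrightarrow> J (h \<circ> X') = I h"
  using J_eq_of_approx_0[OF approx_pullback[OF _ empty_ideal, of h "h \<circ> X'"]] by auto

lemma null_sets: "N \<in> \<N> \<Longrightarrow> N \<in> pull.\<R>"
  and null_measure: "N \<in> \<N> \<Longrightarrow> pull.\<mu> N = 0"
  using J_eq_of_approx_0[OF approx_pullback[OF zero_mem, of N "indicator N"]]
  by (auto simp: pull.\<R>_def pull.\<mu>_def J_0)

text \<open>The sets \<open>A n\<close> live on \<open>'b\<close>, but their minorants are functions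
  on \<open>'s\<close> and can therefore also be composed with \<open>X\<close>. The \<sigma>-ideal
  collects the null sets of all \<open>n\<close> into one set \<open>M\<close>; off
  \<open>M\<close>, each \<open>w\<close> leaves some \<open>A n\<close>, and there the minorant
  vanishes.\<close>

lemma decseq_minorants:
  assumes sigma: "set_sigma_ideal \<N>" and A: "\<And>n. A n \<in> pull.\<R>" "decseq A" "(\<Inter>n. A n) = {}"
    and c: "0 < c" "\<And>n. c < pull.\<mu> (A n)"
  obtains h M where "\<And>n. h n \<in> L" "\<And>n s. 0 \<le> h n s" "\<And>n s. h (Suc n) s \<le> h n s"
    "\<And>n. c / 2 < I (h n)" "M \<in> \<N>" "\<And>w. w \<notin> M \<Longrightarrow> \<exists>n. h n (X' w) = 0"
proof -
  have V: "indicator (A n) \<in> V" for n using A(1) by (rule pull.indicator_mem)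
  have "\<exists>h N. h \<in> L \<and> N \<in> \<N> \<and> (\<forall>s. 0 \<le> h s) \<and> (\<forall>w. w \<notin> N \<longrightarrow> h (X' w) \<le> indicator (A n) w)
      \<and> pull.\<mu> (A n) - I h \<le> c / 2 * (1/2) ^ Suc n" for n
  proof -
    \<comment> \<open>Half of the allowed gap: \<open>I k\<close> is lost once in passing from
      \<open>J\<close> to \<open>I g\<close>, and once more in lowering \<open>g\<close> by
      \<open>k\<close>.\<close>
    define e where "e = c / 4 * (1/2) ^ Suc n"
    have "0 < e" using c by (simp add: e_def)
    from V_approx[OF V[of n] this] obtain g k where gk: "approx (indicator (A n)) g k" "I k < e"
      "g \<in> L" "k \<in> L" .
    then obtain N where N: "N \<in> \<N>" "\<And>w. w \<notin> N \<Longrightarrow> \<bar>indicator (A n) w - g (X' w)\<bar> \<le> k (X' w)"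
      by (auto simp: approx_def)
    define h where "h s = max (g s - k s) 0" for s
    have h: "h \<in> L" unfolding h_def using gk zero_mem by (auto intro!: max_mem diff_mem)
    have "h (X' w) \<le> indicator (A n) w" if "w \<notin> N" for w
      using N(2)[OF that] by (auto simp: h_def)
    moreover have "I g - I k \<le> I h"
      using J_mono[OF diff_mem[OF gk(3,4)] h] J_diff[OF gk(3,4)] by (simp add: h_def)
    then have "pull.\<mu> (A n) - I h \<le> c / 2 * (1/2) ^ Suc n"
      using J_bounds[OF gk(1)] gk(2) unfolding pull.\<mu>_def e_def by (simp add: abs_le_iff)
    ultimately show ?thesis using h N(1) by (intro exI[of _ h] exI[of _ N]) (auto simp: h_def)
  qed
  then obtain h N where h: "\<And>n. h n \<in> L" "\<And>n s. 0 \<le> h n s" and N: "\<And>n. N n \<in> \<N>"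
    and h_le: "\<And>n w. w \<notin> N n \<Longrightarrow> h n (X' w) \<le> indicator (A n) w"
    and gap: "\<And>n. pull.\<mu> (A n) - I (h n) \<le> c / 2 * (1/2) ^ Suc n"
    by metis
  define M where "M = (\<Union>n. N n)"
  have M: "M \<in> \<N>" using sigma N by (auto simp: M_def set_sigma_ideal_def)
  \<comment> \<open>\<open>J_running_min\<close> needs inequalities at every point, so the minorants
    are set to 0 on \<open>M\<close>. This does not change their value under
    \<open>J\<close>.\<close>
  define b where "b n w = (if w \<in> M then 0 else h n (X' w))" for n w
  have rm: "running_min b n w = running_min h n (X' w)" if "w \<notin> M" for n w
    using that by (induction n) (auto simp: b_def)
  have "approx (b n) (h n) (\<lambda>s. 0)" for n
    by (rule approx_pullback[OF h(1) M]) (simp add: b_def)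
  note b = J_eq_of_approx_0[OF this]
  have "approx (running_min b n) (running_min h n) (\<lambda>s. 0)" for n
    by (rule approx_pullback[OF running_min_mem[OF h(1)] M]) (simp add: rm)
  note Jb = J_eq_of_approx_0(2)[OF this]
  have "pull.\<mu> (A n) - I (running_min h n) \<le> c / 2 * (1 - (1/2) ^ Suc n)" for n
    unfolding Jb[symmetric] pull.\<mu>_def
  proof (rule pull.J_running_min[where a="\<lambda>n. indicator (A n)"])
    show "b n w \<le> indicator (A n) w" for n w
      using h_le[of w n] by (auto simp: b_def M_def)
    show "indicator (A (Suc n)) w \<le> (indicator (A n) w :: real)" for n w
      using decseq_SucD[OF A(2), of n] by (auto simp: indicator_def)
    show "J (indicator (A n)) - J (b n) \<le> c / 2 * (1/2) ^ Suc n" for n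
      using gap[of n] by (simp add: pull.\<mu>_def b)
  qed (rule V b)+
  moreover have "c / 2 * (1 - (1/2) ^ Suc n) \<le> c / 2" for n
    using c by simp
  ultimately have "c / 2 < I (running_min h n)" for n
    using c(2)[of n] by (smt (verit) field_sum_of_halves)
  moreover have "\<exists>n. running_min h n (X' w) = 0" if "w \<notin> M" for w
  proof -
    obtain n where "w \<notin> A n" using A(3) by auto
    then have "running_min h n (X' w) \<le> 0"
      using h_le[of w n] that running_min_le[of h n "X' w"] by (auto simp: M_def)
    moreover have "0 \<le> running_min h n (X' w)" using h(2) by (rule running_min_nonneg)
    ultimately show ?thesis by (intro exI[of _ n]) simp
  qed
  moreover have "running_min h (Suc n) s \<le> running_min h n s" for n s by simp
  ultimately show thesis
    by (intro that[of "running_min h" M] running_min_mem running_min_nonneg h M)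
qed

end

section \<open>Decreasing sequences of integrable functions on a \<sigma>-ring\<close>

context content
begin

text \<open>Superlevel sets of the \<open>f n\<close> may lie outside the ring, so decreasing simple
  minorants take their place. Below \<open>G 0\<close> they share one support and one bound, which
  forces their superlevel sets to keep a fixed content; countable additivity carries this to the
  intersection.\<close>

lemma L1_decseq_limit_pos:
  assumes sigma: "sigma_ring \<A>" and ca: "countably_additive_content \<A> l"
    and f: "\<And>n. f n \<in> L1 \<A> l" "\<And>n x. 0 \<le> f n x" "\<And>n x. f (Suc n) x \<le> f n x"
    and e: "0 < e" "\<And>n. e \<le> content_integral \<A> l (f n)"
  obtains B where "B \<in> \<A>" "0 < l B" "\<And>n x. x \<in> B \<Longrightarrow> 0 < f n x"
proof -
  have "\<exists>G. G \<in> simple_functions \<A> \<and> (\<forall>x. 0 \<le> G x \<and> G x \<le> f n x)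
      \<and> \<I> (f n) - \<I> G \<le> e / 2 * (1/2) ^ Suc n" for n
  proof -
    have "0 < e / 2 * (1/2) ^ Suc n" using e by simp
    from L1_lower_approx[OF f(1) f(2) this, of n] obtain G where "G \<in> simple_functions \<A>"
      "\<And>x. 0 \<le> G x" "\<And>x. G x \<le> f n x" "\<I> (f n) - e / 2 * (1/2) ^ Suc n < \<I> G" by blast
    then show ?thesis by (intro exI[of _ G]) auto
  qed
  then obtain G where G: "\<And>n. G n \<in> simple_functions \<A>" "\<And>n x. 0 \<le> G n x" "\<And>n x. G n x \<le> f n x"
    and gap: "\<And>n. \<I> (f n) - \<I> (G n) \<le> e / 2 * (1/2) ^ Suc n" by metis
  let ?F = "running_min G"
  have F: "?F n \<in> simple_functions \<A>" for n
    by (induction n) (auto intro: G simple_comp2[where \<phi>=min])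
  have F_nn: "0 \<le> ?F n x" for n x using G(2) by (rule running_min_nonneg)
  have "\<I> (f n) - \<I> (?F n) \<le> e / 2 * (1 - (1/2) ^ Suc n)" for n
    using f(1) simple_L1(1)[OF G(1)] G(3) f(3) gap by (rule integral.J_running_min)
  moreover have "e / 2 * (1 - (1/2) ^ Suc n) \<le> e / 2" for n using e by simp
  ultimately have F_int: "e / 2 \<le> \<I> (?F n)" for n
    using e(2)[of n] by (smt (verit) field_sum_of_halves)
  obtain M where M: "0 < M" "\<And>x. \<bar>G 0 x\<bar> \<le> M" using simple_bounded[OF G(1)] by blast
  define S where "S = {x. G 0 x \<noteq> 0}"
  have S: "S \<in> \<A>" unfolding S_def using G(1) by (rule simple_support)
  \<comment> \<open>With this level, the part of \<open>?F n\<close> below \<open>c\<close>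
    contributes less than \<open>e / 4\<close> over \<open>S\<close>. Of the integral
    \<open>e / 2\<close> more than \<open>e / 4\<close> is left for \<open>B n\<close>, where the
    height is at most \<open>M\<close>.\<close>
  define c where "c = e / (4 * (l S + 1))"
  have c: "0 < c" "c * l S < e / 4" using e content_nonneg[OF S] by (auto simp: c_def field_simps)
  define B where "B n = {x. c < ?F n x}" for n
  have B: "B n \<in> \<A>" for n unfolding B_def using F c by (intro simple_superlevel) auto
  have lB: "e / (4 * M) \<le> l (B n)" for n
  proof -
    have "\<I> (?F n) \<le> \<I> (\<lambda>x. c * indicator S x + M * indicator (B n) x)"
    proof (intro integral.J_mono integral.linear_mem L1_indicator S B simple_L1(1)[OF F])
      show "?F n x \<le> c * indicator S x + M * indicator (B n) x" for x
        using running_min_antimono[of 0 n G x] F_nn[of n x] M(1) M(2)[of x] c(1)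
        by (cases "x \<in> B n"; cases "G 0 x = 0") (auto simp: S_def B_def)
    qed
    also have "\<dots> = c * l S + M * l (B n)"
      by (simp add: integral.J_linear L1_indicator S B integral_indicator)
    finally have "e / 4 \<le> M * l (B n)" using F_int[of n] c(2) by simp
    then show ?thesis using M by (simp add: field_simps)
  qed
  \<comment> \<open>Passing to complements inside \<open>B 0\<close> turns the decreasing sequence
    into an increasing one, to which continuity from below applies.\<close>
  define A where "A n = B 0 - B n" for n
  have A: "range A \<subseteq> \<A>" using B by (auto simp: A_def)
  have UA: "(\<Union>n. A n) \<in> \<A>" using sigma A by (auto simp: sigma_ring_def)
  have B_Int: "(\<Inter>n. B n) = B 0 - (\<Union>n. A n)" by (auto simp: A_def)
  have Bdec: "B n \<subseteq> B i" if "i \<le> n" for i n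
    using running_min_antimono[OF that, of G] by (auto simp: B_def intro: less_le_trans)
  have "incseq A" using Bdec by (auto simp: A_def incseq_def)
  have ca': "countably_additive \<A> (\<lambda>A. ennreal (l A))"
    using ca by (simp add: countably_additive_content_def)
  have pos: "positive \<A> (\<lambda>A. ennreal (l A))" by (simp add: positive_def content_empty)
  have "(\<lambda>n. ennreal (l (A n))) \<longlonglongrightarrow> ennreal (l (\<Union>n. A n))"
    using countably_additive_iff_continuous_from_below[OF pos countably_additive_additive[OF pos ca']]
      ca' A \<open>incseq A\<close> UA by blast
  moreover have An: "l (A n) \<le> l (B 0) - e / (4 * M)" for n
    using content_Diff[OF B B Bdec, of 0 n] lB[of n] by (simp add: A_def)
  then have "ennreal (l (A n)) \<le> ennreal (l (B 0) - e / (4 * M))" for n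
    by (intro ennreal_leI)
  ultimately have "ennreal (l (\<Union>n. A n)) \<le> ennreal (l (B 0) - e / (4 * M))"
    by (intro LIMSEQ_le_const2) auto
  moreover have "0 \<le> l (B 0) - e / (4 * M)" using lB[of 0] by simp
  ultimately have "l (\<Union>n. A n) \<le> l (B 0) - e / (4 * M)" by simp
  moreover have "l (\<Inter>n. B n) = l (B 0) - l (\<Union>n. A n)"
    unfolding B_Int by (rule content_Diff[OF UA B]) (auto simp: A_def)
  moreover have "0 < e / (4 * M)" using e M by simp
  ultimately have "0 < l (\<Inter>n. B n)" by linarith
  moreover have "(\<Inter>n. B n) \<in> \<A>" unfolding B_Int using UA B by auto
  moreover have "0 < f n x" if x: "x \<in> (\<Inter>n. B n)" for n x
  proof -
    have "c < ?F n x" using x by (auto simp: B_def)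
    also have "\<dots> \<le> G n x" by (rule running_min_le)
    also have "\<dots> \<le> f n x" by (rule G)
    finally show ?thesis using c by simp
  qed
  ultimately show thesis using that by blast
qed

end

section \<open>The transferred content\<close>

context content
begin

lemma completion_setsI:
  assumes "\<And>e. 0 < e \<Longrightarrow> \<exists>A\<in>\<A>. \<exists>B\<in>\<A>. B \<subseteq> E \<and> E \<subseteq> A \<and> l A \<le> r + e \<and> r - e \<le> l B"
  shows "E \<in> completion_sets \<A> l" and "extended_content \<A> l E = r"
proof -
  have r: "0 \<le> r"
  proof (rule field_le_epsilon)
    show "0 \<le> r + e" if "0 < e" for e
      using assms[OF that] content_nonneg by (blast intro: order_trans)
  qed
  have "outer_content \<A> l E \<le> ennreal r"
  proof (rule ennreal_le_epsilon)
    fix e :: real assume e: "0 < e"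
    from assms[OF this] obtain A where "A \<in> \<A>" "E \<subseteq> A" "l A \<le> r + e" by blast
    then have "outer_content \<A> l E \<le> ennreal (r + e)"
      unfolding outer_content_def by (intro INF_lower2[of A] ennreal_leI) auto
    then show "outer_content \<A> l E \<le> ennreal r + ennreal e"
      using r e by (simp add: ennreal_plus)
  qed
  moreover have "ennreal r \<le> inner_content \<A> l E"
  proof (rule ennreal_le_epsilon)
    fix e :: real assume e: "0 < e"
    from assms[OF this] obtain B where B: "B \<in> \<A>" "B \<subseteq> E" "r - e \<le> l B" by blast
    then have "ennreal r \<le> ennreal (l B + e)" by (intro ennreal_leI) simp
    also have "\<dots> = ennreal (l B) + ennreal e" using B e content_nonneg by (intro ennreal_plus) auto
    also have "\<dots> \<le> inner_content \<A> l E + ennreal e"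
      unfolding inner_content_def using B by (intro add_right_mono SUP_upper) auto
    finally show "ennreal r \<le> inner_content \<A> l E + ennreal e" .
  qed
  moreover have "inner_content \<A> l E \<le> outer_content \<A> l E"
    unfolding inner_content_def outer_content_def
    by (intro SUP_least INF_greatest ennreal_leI content_mono) auto
  ultimately have "outer_content \<A> l E = ennreal r" "inner_content \<A> l E = ennreal r"
    by (auto intro: antisym order_trans)
  with r show "E \<in> completion_sets \<A> l" "extended_content \<A> l E = r"
    by (simp_all add: completion_sets_def extended_content_def)
qed

lemma completion_sets_approx:
  assumes E: "E \<in> completion_sets \<A> l" and e: "0 < e"
  obtains A B where "A \<in> \<A>" "B \<in> \<A>" "B \<subseteq> E" "E \<subseteq> A"
    "l A < extended_content \<A> l E + e" "extended_content \<A> l E - e < l B"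
proof -
  define r where "r = extended_content \<A> l E"
  have r: "0 \<le> r" by (simp add: r_def extended_content_def)
  have outer: "outer_content \<A> l E = ennreal r" and inner: "inner_content \<A> l E = ennreal r"
    using E by (auto simp: completion_sets_def r_def extended_content_def)
  have "outer_content \<A> l E < ennreal (r + e)" using outer r e by (simp add: ennreal_less_iff)
  then obtain A where A: "A \<in> \<A>" "E \<subseteq> A" "l A < r + e"
    using content_nonneg by (auto simp: outer_content_def INF_less_iff ennreal_less_iff)
  have "\<exists>B\<in>\<A>. B \<subseteq> E \<and> r - e < l B"
  proof (cases "r - e < 0")
    \<comment> \<open>A negative number would become 0 in \<open>ennreal\<close> and the strict
      comparison could fail; here the empty set suffices.\<close>
    case True
    then show ?thesis by (intro bexI[of _ "{}"]) (auto simp: content_empty)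
  next
    case False
    then have "ennreal (r - e) < inner_content \<A> l E" using inner e by (simp add: ennreal_less_iff)
    then show ?thesis
      using False content_nonneg by (auto simp: inner_content_def less_SUP_iff ennreal_less_iff)
  qed
  with A that show thesis by (auto simp: r_def)
qed

text \<open>The same defining sequence works in the larger structure. Integrals of simple functions
  agree since only fibres of non-zero values count, and these lie in the smaller ring.\<close>

lemma L1_subset_extension:
  assumes ext: "content \<B> k" and sub: "\<A> \<subseteq> \<B>" and eq: "\<And>A. A \<in> \<A> \<Longrightarrow> k A = l A"
    and f: "f \<in> L1 \<A> l"
  shows "f \<in> L1 \<B> k" and "content_integral \<B> k f = content_integral \<A> l f"
proof -
  interpret ext: content \<B> k by (rule ext)
  have S: "g \<in> simple_functions \<B>" if "g \<in> simple_functions \<A>" for g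
    using that sub by (auto simp: simple_functions_def)
  have SI: "simple_integral k g = simple_integral l g" if "g \<in> simple_functions \<A>" for g
    unfolding simple_integral_def
  proof (intro sum.cong refl)
    fix y
    show "y * k (g -` {y}) = y * l (g -` {y})"
      using that eq[of "g -` {y}"] by (cases "y = 0") (auto simp: simple_functions_iff step_def)
  qed
  obtain F where F: "defining_sequence \<A> l F f" using f by (auto simp: L1_def)
  note FS = defining_sequenceD(1)[OF F]
  have F': "defining_sequence \<B> k F f"
  proof (rule ext.defining_sequenceI)
    show "F n \<in> simple_functions \<B>" for n by (intro S FS)
    show "\<forall>\<^sub>F n in sequentially. \<exists>A\<in>\<B>. {x. \<bar>F n x - f x\<bar> > c} \<subseteq> A \<and> k A < e"
      if "0 < c" "0 < e" for c e
      using defining_sequenceD(2)[OF F that]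
    proof eventually_elim
      case (elim n)
      then obtain A where "A \<in> \<A>" "{x. \<bar>F n x - f x\<bar> > c} \<subseteq> A" "l A < e" by blast
      then show ?case using sub eq[of A] by (intro bexI[of _ A]) auto
    qed
    show "\<exists>n0. \<forall>n\<ge>n0. \<forall>j\<ge>n0. simple_integral k (\<lambda>x. \<bar>F n x - F j x\<bar>) < e" if "0 < e" for e
      using defining_sequenceD(3)[OF F that] by (simp add: SI simple_abs_diff FS)
  qed
  then show "f \<in> L1 \<B> k" by (auto simp: L1_def)
  have "(\<lambda>n. simple_integral l (F n)) \<longlonglongrightarrow> content_integral \<B> k f"
    using ext.defining_sequence_integral[OF F'] by (simp add: SI FS)
  then show "content_integral \<B> k f = content_integral \<A> l f"
    using defining_sequence_integral[OF F] by (rule LIMSEQ_unique)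
qed

text \<open>Necessity of the condition, in contraposed form. The hypothesis only gives
  \<open>f \<ge> - d\<close> off a null set, for every \<open>d > 0\<close>. As the space may have
  infinite mass, this alone bounds no integral; truncation of the negative part at a small
  \<open>d\<close> does.\<close>

lemma sup_inf_nonneg_imp_integral_nonneg:
  assumes N: "\<N> \<subseteq> \<A>" "\<And>N. N \<in> \<N> \<Longrightarrow> l N = 0" and f: "f \<in> L1 \<A> l"
    and sup: "0 \<le> sup_inf_modulo \<N> f"
  shows "0 \<le> content_integral \<A> l f"
proof (rule field_le_epsilon)
  fix e :: real assume e: "0 < e"
  let ?p = "\<lambda>x. max (f x) 0" and ?n = "\<lambda>x. max (- f x) 0"
  have pn: "?p \<in> L1 \<A> l" "?n \<in> L1 \<A> l"
    using f by (auto intro!: integral.max_mem integral.uminus_mem integral.zero_mem)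
  obtain d where d: "0 < d" "\<I> (\<lambda>x. min (?n x) d) < e"
    using integral.J_truncate_below[OF pn(2) _ e] by auto
  have "ereal (- d) < sup_inf_modulo \<N> f"
    by (rule less_le_trans[OF _ sup]) (use d in simp)
  then obtain M where M: "M \<in> \<N>" "ereal (- d) < (INF w\<in>- M. ereal (f w))"
    by (auto simp: sup_inf_modulo_def less_SUP_iff)
  have "- d \<le> f w" if "w \<notin> M" for w
    using M(2) INF_lower[of w "- M" "\<lambda>w. ereal (f w)"] that by (auto dest: order_less_le_trans)
  then have "\<I> ?n \<le> \<I> (\<lambda>x. min (?n x) d)"
    using N M(1) d(1)
    by (intro integral_mono_null[of _ _ M] pn integral.min_const_mem) (auto simp: minus_le_iff)
  moreover have "\<I> f = \<I> ?p - \<I> ?n"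
  proof -
    have "f = (\<lambda>x. ?p x - ?n x)" by (auto simp: fun_eq_iff)
    then show ?thesis using integral.J_diff[OF pn] by simp
  qed
  moreover have "0 \<le> \<I> ?p" using pn(1) by (rule integral.J_nonneg) auto
  ultimately show "0 \<le> \<I> f + e" using d(2) by simp
qed

text \<open>Constants need not be integrable, so \<open>c\<close> cannot be integrated directly. For
  positive \<open>c\<close>, \<open>c * l A\<close> is a lower bound for every \<open>A\<close> in
  the ring, and the supremum of \<open>l A\<close> is 1. Otherwise the negative part of
  \<open>f\<close> is close to a simple function, whose support has content at most 1.\<close>

lemma probability_integral_ge:
  assumes prob: "probability \<A> l" and N: "N \<in> \<A>" "l N = 0" and f: "f \<in> L1 \<A> l"
    and c: "\<And>w. w \<notin> N \<Longrightarrow> c \<le> f w"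
  shows "c \<le> content_integral \<A> l f"
proof (cases "0 < c")
  case True
  show ?thesis
  proof (rule ccontr)
    assume less: "\<not> c \<le> \<I> f"
    have cl: "c * l A \<le> \<I> f" if A: "A \<in> \<A>" for A
    proof -
      have "\<I> (\<lambda>x. c * indicator A x) \<le> \<I> f"
        by (rule integral_mono_null[OF integral.cmult_mem[OF L1_indicator[OF A]] f N])
          (use c True in \<open>force simp: indicator_def\<close>)
      then show ?thesis
        by (simp add: integral.J_cmult L1_indicator integral_indicator A)
    qed
    have nn: "0 \<le> \<I> f" using cl[OF empty_sets] by (simp add: content_empty)
    have "ennreal (\<I> f / c) < (SUP A\<in>\<A>. ennreal (l A))"
      using prob less True nn by (simp add: probability_def ennreal_less_one_iff)
    then obtain A where "A \<in> \<A>" "\<I> f / c < l A"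
      using nn True by (auto simp: less_SUP_iff ennreal_less_iff)
    with cl[of A] True show False by (simp add: field_simps)
  qed
next
  case False
  have l1: "l A \<le> 1" if "A \<in> \<A>" for A
    using SUP_upper[OF that, of "\<lambda>A. ennreal (l A)"] prob by (simp add: probability_def ennreal_le_1)
  show ?thesis
  proof (rule field_le_epsilon)
    fix e :: real assume e: "0 < e"
    let ?n = "\<lambda>x. max (- f x) 0"
    have n: "?n \<in> L1 \<A> l"
      using f by (auto intro!: integral.max_mem integral.uminus_mem integral.zero_mem)
    obtain F where F: "F \<in> simple_functions \<A>" "\<I> (\<lambda>x. \<bar>?n x - F x\<bar>) < e"
      using L1_simple_approx[OF n e] .
    define S where "S = {x. F x \<noteq> 0}"
    have S: "S \<in> \<A>" unfolding S_def using F(1) by (rule simple_support)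
    have d: "(\<lambda>x. \<bar>?n x - F x\<bar>) \<in> L1 \<A> l"
      by (intro integral.abs_mem integral.diff_mem n simple_L1 F)
    have "- \<I> f = \<I> (\<lambda>x. - f x)" using f by (simp add: integral.J_uminus)
    also have "\<dots> \<le> \<I> (\<lambda>x. - c * indicator S x + 1 * \<bar>?n x - F x\<bar>)"
    proof (rule integral_mono_null[OF _ _ N])
      show "- f w \<le> - c * indicator S w + 1 * \<bar>?n w - F w\<bar>" if "w \<notin> N" for w
        using c[OF that] False by (cases "F w = 0") (auto simp: S_def)
    qed (intro integral.uminus_mem integral.linear_mem L1_indicator S f d)+
    also have "\<dots> = - c * l S + \<I> (\<lambda>x. \<bar>?n x - F x\<bar>)"
      by (subst integral.J_linear) (auto intro: L1_indicator S d simp: integral_indicator S)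
    also have "- c * l S \<le> - c * 1" using l1[OF S] False by (intro mult_left_mono) auto
    finally show "c \<le> \<I> f + e" using F(2) by simp
  qed
qed

lemma probability_integral_ge_sup_inf:
  assumes prob: "probability \<A> l" and N: "\<N> \<subseteq> \<A>" "\<And>N. N \<in> \<N> \<Longrightarrow> l N = 0" and f: "f \<in> L1 \<A> l"
  shows "sup_inf_modulo \<N> f \<le> ereal (content_integral \<A> l f)"
  unfolding sup_inf_modulo_def
proof (rule SUP_least, rule ccontr)
  fix M assume M: "M \<in> \<N>" and "\<not> (INF w\<in>- M. ereal (f w)) \<le> ereal (\<I> f)"
  then have "ereal (\<I> f) < (INF w\<in>- M. ereal (f w))" by simp
  \<comment> \<open>The infimum may be infinite, so a real number strictly between is used.\<close>
  then obtain c where c: "ereal (\<I> f) < ereal c" "ereal c < (INF w\<in>- M. ereal (f w))"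
    using ereal_dense2 by blast
  have "c \<le> f w" if "w \<notin> M" for w
    using c(2) INF_lower[of w "- M" "\<lambda>w. ereal (f w)"] that by (auto dest: order_less_le_trans)
  then have "c \<le> \<I> f" using M N by (intro probability_integral_ge[OF prob _ _ f, of M]) auto
  with c(1) show False by simp
qed

lemma probability_if_UNIV:
  assumes "UNIV \<in> \<A>" "l UNIV = 1"
  shows "probability \<A> l"
  unfolding probability_def
proof (rule antisym)
  show "(SUP A\<in>\<A>. ennreal (l A)) \<le> 1"
    using content_mono[OF _ assms(1)] assms(2) by (intro SUP_least) (simp add: ennreal_le_1)
  show "1 \<le> (SUP A\<in>\<A>. ennreal (l A))"
    using assms by (intro SUP_upper2[of UNIV]) auto
qed

text \<open>Complements of ring sets are adjoined and receive the remaining mass. Since the whole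
  space is missing from the ring, no set lies in it together with its complement, and two adjoined
  complements are never disjoint; this leaves only one new case of additivity.\<close>

lemma probability_extension:
  assumes le1: "\<And>A. A \<in> \<A> \<Longrightarrow> l A \<le> 1" and UNIV: "UNIV \<notin> \<A>"
  obtains \<B> k where "measure_structure \<B> k" "probability \<B> k" "\<A> \<subseteq> \<B>" "\<And>A. A \<in> \<A> \<Longrightarrow> k A = l A"
proof -
  define \<B> where "\<B> = {E. E \<in> \<A> \<or> - E \<in> \<A>}"
  define k where "k E = (if E \<in> \<A> then l E else 1 - l (- E))" for E
  have disj: "- E \<notin> \<A>" if "E \<in> \<A>" for E
    using Un[OF that, of "- E"] UNIV by (auto simp: Compl_partition)
  have diff: "A - B \<in> \<B>" and union: "A \<union> B \<in> \<B>" if A: "A \<in> \<B>" and B: "B \<in> \<B>" for A B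
  proof -
    consider "A \<in> \<A>" "B \<in> \<A>" | "A \<in> \<A>" "- B \<in> \<A>" | "- A \<in> \<A>" "B \<in> \<A>" | "- A \<in> \<A>" "- B \<in> \<A>"
      using A B by (auto simp: \<B>_def)
    then have "A - B \<in> \<B> \<and> A \<union> B \<in> \<B>"
    proof cases
      case 1
      then show ?thesis by (auto simp: \<B>_def)
    next
      case 2
      have "A - B = A \<inter> - B" "- (A \<union> B) = - B - A" by auto
      with 2 show ?thesis unfolding \<B>_def by (simp only: mem_Collect_eq) (metis Diff Int)
    next
      case 3
      have "- (A - B) = - A \<union> B" "- (A \<union> B) = - A - B" by auto
      with 3 show ?thesis unfolding \<B>_def by (simp only: mem_Collect_eq) (metis Diff Un)
    next
      case 4
      have "A - B = - B - - A" "- (A \<union> B) = - A \<inter> - B" by auto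
      with 4 show ?thesis unfolding \<B>_def by (simp only: mem_Collect_eq) (metis Diff Int)
    qed
    then show "A - B \<in> \<B>" "A \<union> B \<in> \<B>" by blast+
  qed
  have "measure_structure \<B> k"
    unfolding measure_structure_def
  proof (intro conjI ballI)
    show "ring_of_sets UNIV \<B>"
      unfolding ring_of_sets_iff using diff union by (auto simp: \<B>_def)
    show "0 \<le> k A" if "A \<in> \<B>" for A
      using that le1 content_nonneg by (auto simp: \<B>_def k_def)
    have co: "k (A \<union> B) = k A + k B" if A: "A \<in> \<A>" and B: "- B \<in> \<A>" and "A \<inter> B = {}" for A B
    proof -
      have "A \<subseteq> - B" using that(3) by auto
      have eq: "- (A \<union> B) = - B - A" by auto
      have "- (A \<union> B) \<in> \<A>" unfolding eq using A B by auto
      then have "A \<union> B \<notin> \<A>" using disj by blast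
      moreover have "B \<notin> \<A>" using disj B by blast
      ultimately have "k (A \<union> B) = 1 - l (- B - A)" "k A = l A" "k B = 1 - l (- B)"
        using A by (simp_all only: k_def eq if_True if_False)
      then show ?thesis
        using content_Diff[OF A B \<open>A \<subseteq> - B\<close>] by simp
    qed
    show "additive \<B> k"
      unfolding additive_def
    proof (intro ballI impI)
      fix A B assume AB: "A \<in> \<B>" "B \<in> \<B>" "A \<inter> B = {}"
      consider "A \<in> \<A>" "B \<in> \<A>" | "A \<in> \<A>" "- B \<in> \<A>" | "- A \<in> \<A>" "B \<in> \<A>" | "- A \<in> \<A>" "- B \<in> \<A>"
        using AB by (auto simp: \<B>_def)
      then show "k (A \<union> B) = k A + k B"
      proof cases
        case 1
        then show ?thesis using AB(3) by (simp add: k_def content_Un Un)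
      next
        case 2
        then show ?thesis using AB(3) by (rule co)
      next
        case 3
        then show ?thesis using co[of B A] AB(3) by (simp add: Un_commute Int_commute)
      next
        case 4
        then have "- A \<union> - B \<in> \<A>" by (rule Un)
        moreover have "- A \<union> - B = UNIV" using AB(3) by auto
        ultimately show ?thesis using UNIV by simp
      qed
    qed
  qed
  moreover have "k UNIV = 1" using UNIV by (simp add: k_def content_empty)
  moreover have "UNIV \<in> \<B>" by (simp add: \<B>_def)
  ultimately have "probability \<B> k" by (intro content.probability_if_UNIV content.intro)
  with \<open>measure_structure \<B> k\<close> show thesis
    by (rule that) (auto simp: \<B>_def k_def)
qed

end

section \<open>Existence, minimality, total mass and countable additivity of the transferred
  content\<close>

locale transfer_problem =
  fixes \<A> :: "'a set set" and m :: "'a set \<Rightarrow> real"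
    and X :: "'a \<Rightarrow> 's" and X' :: "'b \<Rightarrow> 's"
    and H :: "('s \<Rightarrow> real) set" and \<N> :: "'b set set"
  assumes measure_structure_m: "measure_structure \<A> m"
    and lattice: "vector_sublattice H" and stonean: "stonean H"
    and ideal_\<N>: "set_ideal \<N>"
    and condition: "\<And>h. h \<in> H \<Longrightarrow> h \<circ> X \<in> L1 \<A> m \<Longrightarrow> content_integral \<A> m (h \<circ> X) < 0 \<Longrightarrow>
      sup_inf_modulo \<N> (h \<circ> X') < 0"
begin

sublocale content \<A> m
  by unfold_locales (rule measure_structure_m)

definition L :: "('s \<Rightarrow> real) set" where
  "L = {h \<in> H. h \<circ> X \<in> L1 \<A> m}"

definition I :: "('s \<Rightarrow> real) \<Rightarrow> real" where
  "I h = content_integral \<A> m (h \<circ> X)"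

lemma H_linear:
  assumes "f \<in> H" "g \<in> H"
  shows "(\<lambda>s. a * f s + b * g s) \<in> H"
proof -
  have "(\<lambda>s. a * f s) \<in> H" "(\<lambda>s. b * g s) \<in> H"
    using lattice assms by (auto simp: vector_sublattice_def)
  moreover have "(\<lambda>s. u s + v s) \<in> H" if "u \<in> H" "v \<in> H" for u v
    using lattice that by (simp add: vector_sublattice_def)
  ultimately show ?thesis by blast
qed

sublocale pullback_functional L I X' \<N>
proof
  show "(\<lambda>s. 0) \<in> L"
    using lattice integral.zero_mem by (simp add: L_def vector_sublattice_def comp_def)
  show "(\<lambda>s. a * f s + b * g s) \<in> L" "I (\<lambda>s. a * f s + b * g s) = a * I f + b * I g"
    if "f \<in> L" "g \<in> L" for f g a b
    using that integral.linear_mem[of "f \<circ> X" "g \<circ> X" a b] integral.J_linear[of "f \<circ> X" "g \<circ> X" a b]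
    by (simp_all add: L_def I_def H_linear comp_def)
  show "(\<lambda>s. max (f s) (g s)) \<in> L" if "f \<in> L" "g \<in> L" for f g
    using that integral.max_mem[of "f \<circ> X" "g \<circ> X"] lattice
    by (simp add: L_def comp_def vector_sublattice_def)
  fix h assume h: "h \<in> L"
  then show "(\<lambda>s. min (h s) 1) \<in> L"
    using integral.min_1_mem[of "h \<circ> X"] stonean by (simp add: L_def comp_def stonean_def)
  {
    assume nn: "\<And>s. 0 \<le> h s"
    show "0 \<le> I h"
      using integral.J_nonneg[of "h \<circ> X"] h nn by (simp add: L_def I_def)
    fix e :: real assume e: "0 < e"
    show "\<exists>K>0. I h - I (\<lambda>s. min (h s) K) < e"
      using integral.J_truncate_above[of "h \<circ> X" e] h nn e by (simp add: L_def I_def comp_def)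
    show "\<exists>d>0. I (\<lambda>s. min (h s) d) < e"
      using integral.J_truncate_below[of "h \<circ> X" e] h nn e by (simp add: L_def I_def comp_def)
  }
  \<comment> \<open>The hypothesis \<open>condition\<close> enters here, contraposed: a function
    that is non-negative off \<open>N\<close> has a non-negative supremum of infima.\<close>
  fix N assume N: "N \<in> \<N>" and nn: "\<And>w. w \<notin> N \<Longrightarrow> 0 \<le> h (X' w)"
  have "0 \<le> (INF w\<in>- N. ereal ((h \<circ> X') w))"
    using nn by (intro INF_greatest) auto
  also have "\<dots> \<le> sup_inf_modulo \<N> (h \<circ> X')"
    unfolding sup_inf_modulo_def using N by (rule SUP_upper)
  finally show "0 \<le> I h"
    using condition[of h] h by (force simp: L_def I_def not_less)
qed (rule ideal_\<N>)

abbreviation "property \<equiv> represents \<A> m X X' H \<N>"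

lemma represents_pull: "property pull.\<R> pull.\<mu>"
  unfolding represents_def
  using null_sets null_measure pull.integral_eq_J pullback_mem J_pullback
  by (auto simp: L_def I_def)

text \<open>The other structure integrates compositions with \<open>X'\<close> but knows nothing
  about \<open>E\<close>. Integrable functions above and below the indicator of \<open>E\<close> are
  converted into ring sets: by \<open>L1_cover\<close> from outside, and through a simple minorant
  from inside.\<close>

lemma pull_structure_le:
  assumes "measure_structure \<B> k" and rep: "property \<B> k"
  shows "structure_le pull.\<R> pull.\<mu> \<B> k"
proof -
  interpret B: content \<B> k by unfold_locales fact
  have NB: "N \<in> \<B>" "k N = 0" if "N \<in> \<N>" for N
    using rep that by (auto simp: represents_def)
  have LB: "h \<circ> X' \<in> L1 \<B> k" "content_integral \<B> k (h \<circ> X') = I h" if "h \<in> L" for h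
    using rep that by (auto simp: represents_def L_def I_def)
  have "E \<in> completion_sets \<B> k \<and> extended_content \<B> k E = pull.\<mu> E" if E: "E \<in> pull.\<R>" for E
  proof -
    have "\<exists>A\<in>\<B>. \<exists>B\<in>\<B>. B \<subseteq> E \<and> E \<subseteq> A \<and> k A \<le> pull.\<mu> E + e \<and> pull.\<mu> E - e \<le> k B" if "0 < e" for e
    proof -
      have e: "0 < e / 4" using that by simp
      from V_approx[OF pull.indicator_mem[OF E] e] obtain g h
        where gh: "approx (indicator E) g h" "I h < e / 4" "g \<in> L" "h \<in> L" .
      then obtain N where N: "N \<in> \<N>"
        and bound: "\<And>w. w \<notin> N \<Longrightarrow> \<bar>indicator E w - g (X' w)\<bar> \<le> h (X' w)"
        by (auto simp: approx_def)
      have mu: "\<bar>pull.\<mu> E - I g\<bar> \<le> I h"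
        unfolding pull.\<mu>_def using gh(1) by (rule J_bounds)
      \<comment> \<open>The approximation says nothing on \<open>N\<close>. Redefining both bounds
        there makes them hold everywhere, and their integrals are unchanged because \<open>N\<close>
        is null.\<close>
      define u where "u w = (if w \<in> N then indicator E w else g (X' w) + h (X' w))" for w
      define v where "v w = (if w \<in> N then 0 else max (g (X' w) - h (X' w)) 0)" for w
      have uL: "(\<lambda>w. g (X' w) + h (X' w)) \<in> L1 \<B> k"
        "content_integral \<B> k (\<lambda>w. g (X' w) + h (X' w)) = I g + I h"
        using LB[OF add_mem[OF gh(3,4)]] J_add[OF gh(3,4)] by (simp_all add: comp_def)
      have max: "(\<lambda>s. max (g s - h s) 0) \<in> L"
        using gh zero_mem by (intro max_mem diff_mem)
      then have "I (\<lambda>s. g s - h s) \<le> I (\<lambda>s. max (g s - h s) 0)"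
        using gh by (intro J_mono diff_mem) auto
      then have Imax: "I g - I h \<le> I (\<lambda>s. max (g s - h s) 0)"
        by (simp add: J_diff gh)
      have vL: "(\<lambda>w. max (g (X' w) - h (X' w)) 0) \<in> L1 \<B> k"
        "I g - I h \<le> content_integral \<B> k (\<lambda>w. max (g (X' w) - h (X' w)) 0)"
        using LB[OF max] Imax by (simp_all add: comp_def)
      have u: "u \<in> L1 \<B> k" "content_integral \<B> k u = I g + I h"
        using B.L1_null_modification[OF uL(1) NB[OF N], of u] uL(2) by (auto simp: u_def)
      have v: "v \<in> L1 \<B> k" "I g - I h \<le> content_integral \<B> k v"
        using B.L1_null_modification[OF vL(1) NB[OF N], of v] vL(2) by (auto simp: v_def)
      have uE: "indicator E w \<le> u w" and vE: "v w \<le> indicator E w" for w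
        using bound[of w] by (auto simp: u_def v_def abs_le_iff)
      have "0 \<le> u w" for w using uE[of w] by (auto intro: order_trans[OF indicator_pos_le])
      moreover have "1 \<le> u w" if "w \<in> E" for w using uE[of w] that by simp
      ultimately obtain A where A: "A \<in> \<B>" "E \<subseteq> A" "k A < I g + I h + e / 4"
        using B.L1_cover[OF u(1) _ _ e, of E] u(2) by metis
      have "0 \<le> v w" for w by (simp add: v_def)
      from B.L1_lower_approx[OF v(1) this e] obtain G where G: "G \<in> simple_functions \<B>"
        "\<And>w. 0 \<le> G w" "\<And>w. G w \<le> v w" "content_integral \<B> k v - e / 4 < content_integral \<B> k G" by blast
      \<comment> \<open>As \<open>G\<close> lies below the indicator of \<open>E\<close>, its
        positivity set is contained in \<open>E\<close>, and \<open>G\<close> is at most the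
        indicator of that set; so \<open>k B\<close> is at least the integral of
        \<open>G\<close>.\<close>
      define B where "B = {w. 0 < G w}"
      have B: "B \<in> \<B>" unfolding B_def using G(1) by (rule B.simple_superlevel) simp
      have GE: "G w \<le> indicator E w" for w using G(3) vE by (rule order_trans)
      have BE: "B \<subseteq> E"
      proof
        fix w assume "w \<in> B"
        with GE[of w] show "w \<in> E" by (cases "w \<in> E") (auto simp: B_def)
      qed
      have "G w \<le> indicator B w" for w
        using GE[of w] G(2)[of w] BE by (cases "w \<in> B"; cases "w \<in> E") (auto simp: B_def)
      then have "content_integral \<B> k G \<le> content_integral \<B> k (indicator B)"
        by (intro B.integral.J_mono B.simple_L1(1)[OF G(1)] B.L1_indicator B)
      then have "I g - I h - e / 4 \<le> k B"
        using v(2) G(4) by (simp add: B.integral_indicator[OF B])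
      with A B BE mu gh(2) show ?thesis
        by (intro bexI[of _ A] bexI[of _ B]) (auto simp: abs_le_iff)
    qed
    then show ?thesis by (intro conjI B.completion_setsI)
  qed
  then show ?thesis by (auto simp: structure_le_def)
qed

lemma minimal_pull: "minimal_structure property pull.\<R> pull.\<mu>"
  using pull.measure_structure_\<R> represents_pull pull_structure_le
  by (auto simp: minimal_structure_def)

text \<open>Inner and outer ring sets squeeze the indicator of \<open>E\<close>, so
  \<open>sandwich_mem\<close> puts \<open>E\<close> into the ring. The order relation against this
  structure thereby becomes plain inclusion with equal values.\<close>

lemma completion_pull:
  assumes E: "E \<in> completion_sets pull.\<R> pull.\<mu>"
  shows "E \<in> pull.\<R>" and "extended_content pull.\<R> pull.\<mu> E = pull.\<mu> E"
proof -
  show ER: "E \<in> pull.\<R>"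
    unfolding pull.\<R>_def mem_Collect_eq
  proof (rule pull.sandwich_mem)
    fix e :: real assume "0 < e"
    then have "0 < e / 2" by simp
    from pull.completion_sets_approx[OF E this] obtain A B where AB: "A \<in> pull.\<R>" "B \<in> pull.\<R>"
      "B \<subseteq> E" "E \<subseteq> A" "pull.\<mu> A < extended_content pull.\<R> pull.\<mu> E + e / 2"
      "extended_content pull.\<R> pull.\<mu> E - e / 2 < pull.\<mu> B" .
    then show "\<exists>g\<in>V. \<exists>h\<in>V. (\<forall>x. g x \<le> indicator E x \<and> indicator E x \<le> h x) \<and> J h - J g < e"
      by (intro bexI[of _ "indicator B"] bexI[of _ "indicator A"] pull.indicator_mem)
        (auto simp: indicator_def pull.\<mu>_def)
  qed
  show "extended_content pull.\<R> pull.\<mu> E = pull.\<mu> E"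
  proof (rule pull.completion_setsI)
    show "\<exists>A\<in>pull.\<R>. \<exists>B\<in>pull.\<R>. B \<subseteq> E \<and> E \<subseteq> A \<and> pull.\<mu> A \<le> pull.\<mu> E + e \<and> pull.\<mu> E - e \<le> pull.\<mu> B"
      if "0 < e" for e
      using that by (intro bexI[OF _ ER]) auto
  qed
qed

text \<open>Minimal structures with the same completion can have different rings. This lemma makes
  each of them a restriction of the constructed one, so that statements about an arbitrary minimal
  structure can be read off there.\<close>

lemma minimal_structure_le_pull:
  assumes "minimal_structure property \<R> \<mu>"
  shows "\<R> \<subseteq> pull.\<R>" and "A \<in> \<R> \<Longrightarrow> \<mu> A = pull.\<mu> A"
proof -
  have "structure_le \<R> \<mu> pull.\<R> pull.\<mu>"
    using assms pull.measure_structure_\<R> represents_pull by (auto simp: minimal_structure_def)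
  then have *: "A \<in> completion_sets pull.\<R> pull.\<mu> \<and> extended_content pull.\<R> pull.\<mu> A = \<mu> A"
    if "A \<in> \<R>" for A
    using that by (auto simp: structure_le_def)
  show "\<R> \<subseteq> pull.\<R>" using * completion_pull(1) by blast
  show "\<mu> A = pull.\<mu> A" if "A \<in> \<R>" using *[OF that] completion_pull(2)[of A] by simp
qed

lemma ge_sup_infD:
  assumes "\<And>h. h \<in> L \<Longrightarrow> sup_inf_modulo \<N> (h \<circ> X') \<le> ereal (I h)"
    and "h \<in> L" "N \<in> \<N>" "\<And>w. w \<notin> N \<Longrightarrow> c \<le> h (X' w)"
  shows "c \<le> I h"
proof -
  have "ereal c \<le> (INF w\<in>- N. ereal ((h \<circ> X') w))"
    using assms(4) by (intro INF_greatest) auto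
  also have "\<dots> \<le> sup_inf_modulo \<N> (h \<circ> X')"
    unfolding sup_inf_modulo_def using assms(3) by (rule SUP_upper)
  also have "\<dots> \<le> ereal (I h)" using assms(1,2) by blast
  finally show ?thesis by simp
qed

text \<open>Off \<open>N\<close>, \<open>g - k\<close> is at most the indicator of \<open>E\<close>
  and hence at most 1. As the inequality bounds integrals from below only, it is applied to
  \<open>k - g\<close> with the constant -1. For the whole space, \<open>g + k\<close> is at least 1
  off \<open>N\<close>.\<close>

lemma pull_le_1:
  assumes ineq: "\<And>h. h \<in> L \<Longrightarrow> sup_inf_modulo \<N> (h \<circ> X') \<le> ereal (I h)"
    and E: "E \<in> pull.\<R>"
  shows "pull.\<mu> E \<le> 1" and "E = UNIV \<Longrightarrow> 1 \<le> pull.\<mu> E"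
proof -
  have *: "pull.\<mu> E \<le> 1 + e \<and> (E = UNIV \<longrightarrow> 1 \<le> pull.\<mu> E + e)" if "0 < e" for e
  proof -
    have "0 < e / 2" using that by simp
    from V_approx[OF pull.indicator_mem[OF E] this] obtain g k
      where gk: "approx (indicator E) g k" "I k < e / 2" "g \<in> L" "k \<in> L" .
    then obtain N where N: "N \<in> \<N>"
      and bound: "\<And>w. w \<notin> N \<Longrightarrow> \<bar>indicator E w - g (X' w)\<bar> \<le> k (X' w)"
      by (auto simp: approx_def)
    have mu: "\<bar>pull.\<mu> E - I g\<bar> \<le> I k"
      unfolding pull.\<mu>_def using gk(1) by (rule J_bounds)
    have "- 1 \<le> I (\<lambda>s. k s - g s)"
    proof (rule ge_sup_infD[OF ineq _ N])
      show "- 1 \<le> k (X' w) - g (X' w)" if "w \<notin> N" for w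
        using bound[OF that] by (cases "w \<in> E") (simp_all add: abs_le_iff)
    qed (auto intro: diff_mem gk)
    then have "pull.\<mu> E \<le> 1 + e" using mu gk(2) by (simp add: J_diff gk abs_le_iff)
    moreover have "1 \<le> pull.\<mu> E + e" if "E = UNIV"
    proof -
      have "1 \<le> I (\<lambda>s. g s + k s)"
      proof (rule ge_sup_infD[OF ineq _ N])
        show "1 \<le> g (X' w) + k (X' w)" if "w \<notin> N" for w
          using bound[OF that] \<open>E = UNIV\<close> by (simp add: abs_le_iff)
      qed (auto intro: add_mem gk)
      then show ?thesis using mu gk(2) by (simp add: J_add gk abs_le_iff)
    qed
    ultimately show ?thesis by blast
  qed
  show "pull.\<mu> E \<le> 1" by (rule field_le_epsilon) (use * in blast)
  show "1 \<le> pull.\<mu> E" if "E = UNIV" by (rule field_le_epsilon) (use * that in blast)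
qed

text \<open>If the whole space is in the ring, \<open>pull_le_1\<close> forces its mass to be 1.
  Otherwise the mass is at most 1 on the ring and complements are adjoined.\<close>

lemma exists_probability:
  assumes ineq: "\<And>h. h \<in> L \<Longrightarrow> sup_inf_modulo \<N> (h \<circ> X') \<le> ereal (I h)"
  obtains \<B> \<xi> where "measure_structure \<B> \<xi>" "property \<B> \<xi>" "probability \<B> \<xi>"
proof (cases "UNIV \<in> pull.\<R>")
  case True
  then have "probability pull.\<R> pull.\<mu>"
    using pull_le_1[OF ineq True] by (intro pull.probability_if_UNIV) auto
  with that represents_pull pull.measure_structure_\<R> show thesis by blast
next
  case False
  obtain \<B> \<xi> where B: "measure_structure \<B> \<xi>" "probability \<B> \<xi>" "pull.\<R> \<subseteq> \<B>"
    "\<And>A. A \<in> pull.\<R> \<Longrightarrow> \<xi> A = pull.\<mu> A"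
    using pull.probability_extension[OF pull_le_1(1)[OF ineq] False] by blast
  have "property \<B> \<xi>"
    unfolding represents_def
  proof (intro conjI ballI impI)
    note rep = represents_pull[unfolded represents_def]
    show "\<N> \<subseteq> \<B>" using null_sets B(3) by blast
    show "\<xi> N = 0" if "N \<in> \<N>" for N
      using null_sets[OF that] null_measure[OF that] B(4) by simp
    fix h assume h: "h \<in> H" "h \<circ> X \<in> L1 \<A> m"
    with rep have "h \<circ> X' \<in> L1 pull.\<R> pull.\<mu>"
      "content_integral \<A> m (h \<circ> X) = content_integral pull.\<R> pull.\<mu> (h \<circ> X')" by blast+
    with pull.L1_subset_extension[OF content.intro[OF B(1)] B(3,4)]
    show "h \<circ> X' \<in> L1 \<B> \<xi>" "content_integral \<A> m (h \<circ> X) = content_integral \<B> \<xi> (h \<circ> X')"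
      by simp_all
  qed
  with B that show thesis by blast
qed

lemma countably_additive_pull:
  assumes "sigma_ring \<A>" "countably_additive_content \<A> m" and sigma: "set_sigma_ideal \<N>"
    and inner: "\<And>N. N \<in> \<N> \<Longrightarrow> inner_content \<A> m {w. X w \<notin> X' ` (- N)} = 0"
  shows "countably_additive pull.\<R> (\<lambda>A. ennreal (pull.\<mu> A))"
proof (rule pull.empty_continuous_imp_countably_additive)
  show "positive pull.\<R> (\<lambda>A. ennreal (pull.\<mu> A))"
    by (simp add: positive_def pull.content_empty)
  show "additive pull.\<R> (\<lambda>A. ennreal (pull.\<mu> A))"
    by (auto simp: additive_def pull.content_Un pull.content_nonneg ennreal_plus)
  show "\<forall>A\<in>pull.\<R>. ennreal (pull.\<mu> A) \<noteq> \<infinity>" by simp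
  fix A :: "nat \<Rightarrow> 'b set" assume "range A \<subseteq> pull.\<R>" and A: "decseq A" "(\<Inter>i. A i) = {}"
  then have AR: "A n \<in> pull.\<R>" for n by auto
  have small: "\<exists>n. pull.\<mu> (A n) \<le> c" if c: "0 < c" for c
  proof (rule ccontr)
    assume "\<nexists>n. pull.\<mu> (A n) \<le> c"
    then have "c < pull.\<mu> (A n)" for n by (simp add: not_le)
    from decseq_minorants[OF sigma AR A c this] obtain h M where h: "\<And>n. h n \<in> L" "\<And>n s. 0 \<le> h n s"
      "\<And>n s. h (Suc n) s \<le> h n s" "\<And>n. c / 2 < I (h n)" and M: "M \<in> \<N>"
      "\<And>w. w \<notin> M \<Longrightarrow> \<exists>n. h n (X' w) = 0" by blast
    have "0 < c / 2" using c by simp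
    moreover have "c / 2 \<le> content_integral \<A> m (h n \<circ> X)" for n
      using h(4)[of n] by (simp add: I_def)
    moreover have "h n \<circ> X \<in> L1 \<A> m" for n using h(1) by (simp add: L_def)
    ultimately obtain B where B: "B \<in> \<A>" "0 < m B" "\<And>n x. x \<in> B \<Longrightarrow> 0 < (h n \<circ> X) x"
      using L1_decseq_limit_pos[OF assms(1,2), of "\<lambda>n. h n \<circ> X" "c / 2"] h(2,3) by auto
    \<comment> \<open>Every value \<open>X' w\<close> with \<open>w\<close> outside \<open>M\<close>
      is a zero of some \<open>h n\<close>, whereas all \<open>h n\<close> are positive at
      \<open>X x\<close>.\<close>
    have "X x \<notin> X' ` (- M)" if "x \<in> B" for x
    proof
      assume "X x \<in> X' ` (- M)"
      then obtain w where w: "w \<notin> M" "X x = X' w" by auto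
      with M(2) obtain n where "h n (X' w) = 0" by blast
      with B(3)[OF that, of n] w(2) show False by simp
    qed
    then have "B \<subseteq> {w. X w \<notin> X' ` (- M)}" by auto
    then have "ennreal (m B) \<le> inner_content \<A> m {w. X w \<notin> X' ` (- M)}"
      unfolding inner_content_def using B(1) by (intro SUP_upper) auto
    with inner[OF M(1)] B(2) show False by simp
  qed
  have dec: "pull.\<mu> (A n) \<le> pull.\<mu> (A i)" if "i \<le> n" for i n
    using decseqD[OF A(1) that] by (intro pull.content_mono AR)
  have "(\<lambda>n. pull.\<mu> (A n)) \<longlonglongrightarrow> 0"
  proof (rule LIMSEQ_I)
    fix e :: real assume "0 < e"
    then have "0 < e / 2" by simp
    from small[OF this] obtain n0 where "pull.\<mu> (A n0) \<le> e / 2" by blast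
    then have "norm (pull.\<mu> (A n) - 0) < e" if "n0 \<le> n" for n
      using dec[OF that] pull.content_nonneg[OF AR[of n]] \<open>0 < e\<close> by simp
    then show "\<exists>n0. \<forall>n\<ge>n0. norm (pull.\<mu> (A n) - 0) < e" by blast
  qed
  then show "(\<lambda>n. ennreal (pull.\<mu> (A n))) \<longlonglongrightarrow> 0"
    using tendsto_ennrealI[of "\<lambda>n. pull.\<mu> (A n)" 0 sequentially] by simp
qed

end

text \<open>Part (a) speaks of extensions because the minimal content itself can have too little
  mass: for \<open>H = {\<lambda>s. 0}\<close> and \<open>\<N> = {{}}\<close> the ring
  \<open>{{}}\<close> is minimal and carries mass 0, while the inequality reads 0 \<ge> 0. The
  equivalence holds for the minimal structure itself when \<open>UNIV \<in> \<R>\<close>, and in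
  general for the existence of a representing probability above it.\<close>

theorem theorem3:
  fixes \<A> :: "'a set set" and m :: "'a set \<Rightarrow> real"
    and X :: "'a \<Rightarrow> 's" and X' :: "'b \<Rightarrow> 's"
    and H :: "('s \<Rightarrow> real) set" and \<N> :: "'b set set"
  assumes "measure_structure \<A> m"
    and "vector_sublattice H" and "stonean H"
    and "set_ideal \<N>"
  shows "((\<forall>h\<in>H. h \<circ> X \<in> L1 \<A> m \<longrightarrow>
             content_integral \<A> m (h \<circ> X) < 0 \<longrightarrow> sup_inf_modulo \<N> (h \<circ> X') < 0)
          \<longleftrightarrow> (\<exists>\<R> \<mu>. minimal_structure (represents \<A> m X X' H \<N>) \<R> \<mu>)) \<and>
         (\<forall>\<R> \<mu>. minimal_structure (represents \<A> m X X' H \<N>) \<R> \<mu> \<longrightarrow>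
            (probability \<R> \<mu> \<longrightarrow>
                (\<forall>h\<in>H. h \<circ> X \<in> L1 \<A> m \<longrightarrow>
                   content_integral \<A> m (h \<circ> X) \<ge> sup_inf_modulo \<N> (h \<circ> X'))) \<and>
            (UNIV \<in> \<R> \<longrightarrow>
              (probability \<R> \<mu> \<longleftrightarrow>
                (\<forall>h\<in>H. h \<circ> X \<in> L1 \<A> m \<longrightarrow>
                   content_integral \<A> m (h \<circ> X) \<ge> sup_inf_modulo \<N> (h \<circ> X')))) \<and>
            ((\<exists>\<B> \<xi>. measure_structure \<B> \<xi> \<and> represents \<A> m X X' H \<N> \<B> \<xi> \<and>
                  structure_le \<R> \<mu> \<B> \<xi> \<and> probability \<B> \<xi>) \<longleftrightarrow>
                (\<forall>h\<in>H. h \<circ> X \<in> L1 \<A> m \<longrightarrow>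
                   content_integral \<A> m (h \<circ> X) \<ge> sup_inf_modulo \<N> (h \<circ> X'))) \<and>
            (sigma_ring \<A> \<and> countably_additive_content \<A> m \<and> set_sigma_ideal \<N> \<and>
                (\<forall>N\<in>\<N>. inner_content \<A> m {w. X w \<notin> X' ` (- N)} = 0) \<longrightarrow>
              countably_additive_content \<R> \<mu>))"
    (is "(?C \<longleftrightarrow> (\<exists>\<R> \<mu>. ?min \<R> \<mu>)) \<and> ?moreover")
proof -
  let ?P = "represents \<A> m X X' H \<N>"
  let ?ineq = "\<forall>h\<in>H. h \<circ> X \<in> L1 \<A> m \<longrightarrow>
    content_integral \<A> m (h \<circ> X) \<ge> sup_inf_modulo \<N> (h \<circ> X')"
  have problem: "transfer_problem \<A> m X X' H \<N>" if ?C
    using assms that by (intro transfer_problem.intro) auto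
  have cond: ?C if P: "measure_structure \<B> k" "?P \<B> k" for \<B> k
  proof (intro ballI impI)
    fix h assume h: "h \<in> H" "h \<circ> X \<in> L1 \<A> m" "content_integral \<A> m (h \<circ> X) < 0"
    interpret content \<B> k by unfold_locales fact
    have "\<not> 0 \<le> sup_inf_modulo \<N> (h \<circ> X')"
      using sup_inf_nonneg_imp_integral_nonneg[of \<N> "h \<circ> X'"] P(2) h
      by (auto simp: represents_def)
    then show "sup_inf_modulo \<N> (h \<circ> X') < 0" by simp
  qed
  have prob: ?ineq if P: "measure_structure \<B> k" "?P \<B> k" "probability \<B> k" for \<B> k
  proof (intro ballI impI)
    fix h assume h: "h \<in> H" "h \<circ> X \<in> L1 \<A> m"
    interpret content \<B> k by unfold_locales fact
    show "content_integral \<A> m (h \<circ> X) \<ge> sup_inf_modulo \<N> (h \<circ> X')"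
      using probability_integral_ge_sup_inf[OF P(3), of \<N> "h \<circ> X'"] P(2) h
      by (auto simp: represents_def)
  qed
  have "?C \<longleftrightarrow> (\<exists>\<R> \<mu>. ?min \<R> \<mu>)"
  proof
    assume ?C
    then show "\<exists>\<R> \<mu>. ?min \<R> \<mu>"
      using transfer_problem.minimal_pull[OF problem] by blast
  next
    assume "\<exists>\<R> \<mu>. ?min \<R> \<mu>"
    then obtain \<R> \<mu> where "measure_structure \<R> \<mu>" "?P \<R> \<mu>"
      by (auto simp: minimal_structure_def)
    then show ?C by (rule cond)
  qed
  moreover have ?moreover
  proof (intro allI impI)
    fix \<R> \<mu> assume min: "?min \<R> \<mu>"
    then have R: "measure_structure \<R> \<mu>" "?P \<R> \<mu>"
      and least: "\<And>\<B> k. measure_structure \<B> k \<Longrightarrow> ?P \<B> k \<Longrightarrow> structure_le \<R> \<mu> \<B> k"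
      by (auto simp: minimal_structure_def)
    interpret transfer_problem \<A> m X X' H \<N> by (rule problem[OF cond[OF R]])
    interpret R: content \<R> \<mu> by unfold_locales (rule R)
    note sub = minimal_structure_le_pull[OF min]
    have ineqD: "sup_inf_modulo \<N> (h \<circ> X') \<le> ereal (I h)" if ?ineq "h \<in> L" for h
      using that by (auto simp: L_def I_def)
    have 1: "probability \<R> \<mu> \<longrightarrow> ?ineq" using prob[OF R] by blast
    have 2: "probability \<R> \<mu>" if "UNIV \<in> \<R>" ?ineq
    proof (rule R.probability_if_UNIV)
      have "UNIV \<in> pull.\<R>" using that(1) sub(1) by blast
      from pull_le_1[OF ineqD[OF that(2)] this] sub(2)[OF that(1)] show "\<mu> UNIV = 1" by simp
    qed fact
    have 3: "(\<exists>\<B> \<xi>. measure_structure \<B> \<xi> \<and> ?P \<B> \<xi> \<and> structure_le \<R> \<mu> \<B> \<xi> \<and> probability \<B> \<xi>) \<longleftrightarrow> ?ineq"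
    proof
      assume ?ineq
      from exists_probability[OF ineqD[OF this]] obtain \<B> \<xi>
        where "measure_structure \<B> \<xi>" "?P \<B> \<xi>" "probability \<B> \<xi>" by auto
      with least show "\<exists>\<B> \<xi>. measure_structure \<B> \<xi> \<and> ?P \<B> \<xi> \<and> structure_le \<R> \<mu> \<B> \<xi> \<and> probability \<B> \<xi>"
        by (intro exI[of _ \<B>] exI[of _ \<xi>] conjI)
    next
      assume "\<exists>\<B> \<xi>. measure_structure \<B> \<xi> \<and> ?P \<B> \<xi> \<and> structure_le \<R> \<mu> \<B> \<xi> \<and> probability \<B> \<xi>"
      then obtain \<B> \<xi> where "measure_structure \<B> \<xi>" "?P \<B> \<xi>" "probability \<B> \<xi>" by auto
      then show ?ineq by (rule prob)
    qed
    have 4: "countably_additive_content \<R> \<mu>" if "sigma_ring \<A> \<and> countably_additive_content \<A> m \<and>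
        set_sigma_ideal \<N> \<and> (\<forall>N\<in>\<N>. inner_content \<A> m {w. X w \<notin> X' ` (- N)} = 0)"
    proof -
      have ca: "countably_additive pull.\<R> (\<lambda>A. ennreal (pull.\<mu> A))"
        using that by (intro countably_additive_pull) auto
      show ?thesis
        unfolding countably_additive_content_def countably_additive_def
      proof (intro allI impI)
        fix A :: "nat \<Rightarrow> 'b set"
        assume A: "range A \<subseteq> \<R>" "disjoint_family A" "(\<Union>i. A i) \<in> \<R>"
        then have "(\<Sum>i. ennreal (pull.\<mu> (A i))) = ennreal (pull.\<mu> (\<Union>i. A i))"
          using sub(1) ca unfolding countably_additive_def by blast
        moreover have "\<mu> (A i) = pull.\<mu> (A i)" for i using A(1) sub(2) by blast
        ultimately show "(\<Sum>i. ennreal (\<mu> (A i))) = ennreal (\<mu> (\<Union>i. A i))"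
          using sub(2)[OF A(3)] by simp
      qed
    qed
    show "(probability \<R> \<mu> \<longrightarrow> ?ineq) \<and> (UNIV \<in> \<R> \<longrightarrow> (probability \<R> \<mu> \<longleftrightarrow> ?ineq)) \<and>
      ((\<exists>\<B> \<xi>. measure_structure \<B> \<xi> \<and> ?P \<B> \<xi> \<and> structure_le \<R> \<mu> \<B> \<xi> \<and> probability \<B> \<xi>) \<longleftrightarrow> ?ineq) \<and>
      (sigma_ring \<A> \<and> countably_additive_content \<A> m \<and> set_sigma_ideal \<N> \<and>
        (\<forall>N\<in>\<N>. inner_content \<A> m {w. X w \<notin> X' ` (- N)} = 0) \<longrightarrow> countably_additive_content \<R> \<mu>)"
      using 1 2 3 4 by blast
  qed
  ultimately show ?thesis by (rule conjI)
qed

end
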